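(* Let $\Omega\subset\mathbb{R}^n$ be open and let $\varphi\in\Phi_w(\Omega)$ be such that there exists $\beta>0$ with $\varphi(x,\beta)\geq 1$ for almost every $x\in\Omega$. If $C^1(\Omega)$-functions are dense in $W^{1,\varphi}(\Omega)$, then $$ACC^\varphi(\Omega)\cap L^\varphi(\Omega)=ACL^\varphi(\Omega)\cap L^\varphi(\Omega)=W^{1,\varphi}(\Omega),$$ where the equalities are understood up to the choice of representatives, i.e. after identifying functions that are equal almost everywhere.
   Context: **Weak $\Phi$-functions.** $\Omega\subset\mathbb{R}^n$ is an open set. A function $\varphi:\Omega\times[0,\infty)\to[0,\infty]$ is a weak $\Phi$-function, $\varphi\in\Phi_w(\Omega)$, if: (i) for every measurable $f:\Omega\to[-\infty,\infty]$ the function $x\mapsto\varphi(x,|f(x)|)$ is measurable, and for every $x\in\Omega$ the function $t\mapsto\varphi(x,t)$ is non-decreasing; (ii) $\varphi(x,0)=\lim_{t\to0^+}\varphi(x,t)=0$ and $\lim_{t\to\infty}\varphi(x,t)=\infty$ for every $x\in\Omega$; (iii) there is $L\ge1$ independent of $x$ such that $\frac{\varphi(x,s)}{s}\le L\frac{\varphi(x,t)}{t}$ for all $x\in\Omega$ and $0<s<t$. Convention: $\varphi(x,\infty)=\infty$. **Spaces.** For measurable $f$ on $\Omega$, $\varrho_\varphi(f)=\int_\Omega\varphi(x,|f(x)|)\,dx$. $L^\varphi(\Omega)$ is the set of measurable $f$ with $\lim_{\lambda\to0^+}\varrho_\varphi(\lambda f)=0$, equipped with $\|f\|_\varphi=\inf\{\lambda>0:\varrho_\varphi(f/\lambda)\le1\}$;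 functions equal a.e. are identified. $W^{1,\varphi}(\Omega)$ is the set of $u\in L^\varphi(\Omega)$ whose weak partial derivatives $\partial_1u,\dots,\partial_nu$ exist and belong to $L^\varphi(\Omega)$, with $\|u\|_{1,\varphi}=\|u\|_\varphi+\||\nabla u|\|_\varphi$. "$C^1(\Omega)$-functions are dense in $W^{1,\varphi}(\Omega)$" means that every $u\in W^{1,\varphi}(\Omega)$ is the limit, with respect to $\|\cdot\|_{1,\varphi}$, of a sequence in $C^1(\Omega)\cap W^{1,\varphi}(\Omega)$. **Curves and modulus.** A curve is a continuous map $\gamma:I\to\mathbb{R}^n$ on a nondegenerate closed interval $I=[a,b]$; rectifiable curves have finite length $\ell(\gamma)>0$ and are parametrized by arc length, $I=[0,\ell(\gamma)]$. $\Gamma_{rect}(\Omega)$ is the family of all rectifiable curves with image contained in $\Omega$. For Borel $v:\Omega\to[0,\infty]$, $\int_\gamma v\,ds=\int_0^{\ell(\gamma)}v(\gamma(t))\,dt$. For $\Gamma\subset\Gamma_{rect}(\Omega)$, $F_{adm}(\Gamma)$ is the set of Borel functions $v:\Omega\to[0,\infty]$ with $\int_\gamma v\,ds\ge1$ for all $\gamma\in\Gamma$, and the $\varphi$-modulus is $M_\varphi(\Gamma)=\inf_{v\in F_{adm}(\Gamma)}\|v\|_\varphi$ (with $M_\varphi(\Gamma)=\infty$ if $F_{adm}(\Gamma)=\emptyset$). **ACL.** For $k\in\{1,\dots,n\}$, $y\in\mathbb{R}^{n-1}$, $z\in\mathbb{R}$ let $(y,z)_k=(y_1,\dots,y_{k-1},z,y_k,\dots,y_{n-1})\in\mathbb{R}^n$,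 let $\widetilde\Omega_k=\{y\in\mathbb{R}^{n-1}:(y,z)_k\in\Omega\text{ for some }z\in\mathbb{R}\}$, and for $y\in\widetilde\Omega_k$ let $Z_k(y)=\{z\in\mathbb{R}:(y,z)_k\in\Omega\}$. For $u:\Omega\to\mathbb{R}$ let $E_k\subset\widetilde\Omega_k$ be the set of $y$ such that $z\mapsto u((y,z)_k)$ is absolutely continuous on every compact interval $[a,b]\subset Z_k(y)$. Then $u\in ACL(\Omega)$ (absolutely continuous on lines) if and only if $\widetilde\Omega_k\setminus E_k$ has $(n-1)$-dimensional Lebesgue measure zero for every $k$. For $u \in ACL(\Omega)$ the classical partial derivatives exist almost everywhere in $\Omega$; $u\in ACL^\varphi(\Omega)$ means $u\in ACL(\Omega)$ and $|\nabla u|\in L^\varphi(\Omega)$, where $\nabla u$ is the classical gradient. **ACC.** For $u:\Omega\to\mathbb{R}$, let $\Gamma_{NAC}(u)\subset\Gamma_{rect}(\Omega)$ be the family of curves $\gamma:[0,\ell(\gamma)]\to\Omega$ such that $u\circ\gamma$ is not absolutely continuous on $[0,\ell(\gamma)]$. Then $u\in ACC(\Omega)$ (absolutely continuous on curves) if $M_\varphi(\Gamma_{NAC}(u))=0$. Under the stated condition on $\varphi$, the classical partial derivatives of every $u\in ACC(\Omega)$ exist almost everywhere in $\Omega$; $u\in ACC^\varphi(\Omega)$ means $u\in ACC(\Omega)$ and $|\nabla u|\in L^\varphi(\Omega)$, where $\nabla u$ is the classical gradient. *)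

theory Defs
  imports "HOL-Analysis.Analysis"
begin

text \<open>
  Functions on an open set \<open>\<Omega>\<close> are total functions on the ambient space \<open>real ^ 'n\<close>; their values
  outside \<open>\<Omega>\<close> play no role in any of the notions below. ``Measurable'' means Lebesgue measurable.
\<close>


section \<open>Weak Phi-functions and the spaces they generate\<close>

text \<open>The convention \<open>\<phi>(x,\<infinity>) = \<infinity>\<close>. Only the values \<open>\<phi> x t\<close> with \<open>t \<ge> 0\<close> are ever used.\<close>

definition Phi_ext :: "('a \<Rightarrow> real \<Rightarrow> ennreal) \<Rightarrow> 'a \<Rightarrow> ennreal \<Rightarrow> ennreal" where
  "Phi_ext \<phi> x t = (if t = \<infinity> then \<infinity> else \<phi> x (enn2real t))"

definition weak_Phi :: "(real ^ 'n) set \<Rightarrow> (real ^ 'n \<Rightarrow> real \<Rightarrow> ennreal) set" where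
  "weak_Phi \<Omega> = {\<phi>.
     (\<forall>f :: real ^ 'n \<Rightarrow> ereal. f \<in> borel_measurable (lebesgue_on \<Omega>) \<longrightarrow>
        (\<lambda>x. Phi_ext \<phi> x (e2ennreal \<bar>f x\<bar>)) \<in> borel_measurable (lebesgue_on \<Omega>)) \<and>
     (\<forall>x\<in>\<Omega>. mono_on {0..} (\<phi> x)) \<and>
     (\<forall>x\<in>\<Omega>. \<phi> x 0 = 0 \<and> (\<phi> x \<longlongrightarrow> 0) (at_right 0) \<and> (\<phi> x \<longlongrightarrow> \<infinity>) at_top) \<and>
     (\<exists>L::real. L \<ge> 1 \<and> (\<forall>x\<in>\<Omega>. \<forall>s t. 0 < s \<and> s < t \<longrightarrow>
        \<phi> x s / ennreal s \<le> ennreal L * (\<phi> x t / ennreal t)))}"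

text \<open>
  Modular and Luxemburg norm depend on a function only through its absolute value, so their argument
  is the absolute value \<open>g :: _ \<Rightarrow> ennreal\<close>; the infimum of the empty set is \<open>\<infinity>\<close>.
\<close>

definition modular ::
    "(real ^ 'n) set \<Rightarrow> (real ^ 'n \<Rightarrow> real \<Rightarrow> ennreal) \<Rightarrow> (real ^ 'n \<Rightarrow> ennreal) \<Rightarrow> ennreal" where
  "modular \<Omega> \<phi> g = (\<integral>\<^sup>+ x. Phi_ext \<phi> x (g x) \<partial>lebesgue_on \<Omega>)"

definition lux_norm ::
    "(real ^ 'n) set \<Rightarrow> (real ^ 'n \<Rightarrow> real \<Rightarrow> ennreal) \<Rightarrow> (real ^ 'n \<Rightarrow> ennreal) \<Rightarrow> ennreal" where
  "lux_norm \<Omega> \<phi> g =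
     Inf {ennreal l | l. l > 0 \<and> modular \<Omega> \<phi> (\<lambda>x. g x / ennreal l) \<le> 1}"

definition Lphi ::
    "(real ^ 'n) set \<Rightarrow> (real ^ 'n \<Rightarrow> real \<Rightarrow> ennreal) \<Rightarrow> (real ^ 'n \<Rightarrow> real) set" where
  "Lphi \<Omega> \<phi> = {f. f \<in> borel_measurable (lebesgue_on \<Omega>) \<and>
     ((\<lambda>l. modular \<Omega> \<phi> (\<lambda>x. ennreal \<bar>l * f x\<bar>)) \<longlongrightarrow> 0) (at_right 0)}"

definition ae_eq :: "(real ^ 'n) set \<Rightarrow> ((real ^ 'n \<Rightarrow> real) \<times> (real ^ 'n \<Rightarrow> real)) set" where
  "ae_eq \<Omega> = {(f, g). AE x in lebesgue_on \<Omega>. f x = g x}"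


section \<open>Classical and weak derivatives, Sobolev space\<close>

text \<open>Where the classical partial derivative does not exist, the value is an unspecified constant.\<close>

definition partial_deriv :: "'n \<Rightarrow> (real ^ 'n \<Rightarrow> real) \<Rightarrow> real ^ 'n \<Rightarrow> real" where
  "partial_deriv k u x = deriv (\<lambda>z. u (x + z *\<^sub>R axis k 1)) 0"

definition gradient :: "(real ^ 'n \<Rightarrow> real) \<Rightarrow> real ^ 'n \<Rightarrow> real ^ 'n" where
  "gradient u x = (\<chi> k. partial_deriv k u x)"

primrec Ck_on :: "nat \<Rightarrow> (real ^ 'n) set \<Rightarrow> (real ^ 'n \<Rightarrow> real) \<Rightarrow> bool" where
  "Ck_on 0 S f \<longleftrightarrow> continuous_on S f"
| "Ck_on (Suc m) S f \<longleftrightarrow>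
     (\<exists>f'. (\<forall>x\<in>S. (f has_derivative f' x) (at x)) \<and> (\<forall>k. Ck_on m S (\<lambda>x. f' x (axis k 1))))"

definition test_functions :: "(real ^ 'n) set \<Rightarrow> (real ^ 'n \<Rightarrow> real) set" where
  "test_functions \<Omega> = {\<psi>. (\<forall>m. Ck_on m UNIV \<psi>) \<and>
     compact (closure {x. \<psi> x \<noteq> 0}) \<and> closure {x. \<psi> x \<noteq> 0} \<subseteq> \<Omega>}"

definition locally_integrable :: "(real ^ 'n) set \<Rightarrow> (real ^ 'n \<Rightarrow> real) \<Rightarrow> bool" where
  "locally_integrable \<Omega> f \<longleftrightarrow> (\<forall>K. compact K \<and> K \<subseteq> \<Omega> \<longrightarrow> integrable (lebesgue_on K) f)"

definition has_weak_partial ::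
    "(real ^ 'n) set \<Rightarrow> 'n \<Rightarrow> (real ^ 'n \<Rightarrow> real) \<Rightarrow> (real ^ 'n \<Rightarrow> real) \<Rightarrow> bool" where
  "has_weak_partial \<Omega> k u g \<longleftrightarrow>
     locally_integrable \<Omega> u \<and> locally_integrable \<Omega> g \<and>
     (\<forall>\<psi> \<in> test_functions \<Omega>.
        (\<integral>x. u x * partial_deriv k \<psi> x \<partial>lebesgue_on \<Omega>) = - (\<integral>x. g x * \<psi> x \<partial>lebesgue_on \<Omega>))"

text \<open>Weak partial derivatives are unique up to null sets, which is why a choice is harmless.\<close>

definition weak_gradient :: "(real ^ 'n) set \<Rightarrow> (real ^ 'n \<Rightarrow> real) \<Rightarrow> real ^ 'n \<Rightarrow> real ^ 'n" where
  "weak_gradient \<Omega> u x = (\<chi> k. (SOME g. has_weak_partial \<Omega> k u g) x)"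

definition W1phi ::
    "(real ^ 'n) set \<Rightarrow> (real ^ 'n \<Rightarrow> real \<Rightarrow> ennreal) \<Rightarrow> (real ^ 'n \<Rightarrow> real) set" where
  "W1phi \<Omega> \<phi> = {u \<in> Lphi \<Omega> \<phi>. \<forall>k. \<exists>g \<in> Lphi \<Omega> \<phi>. has_weak_partial \<Omega> k u g}"

definition W1phi_norm ::
    "(real ^ 'n) set \<Rightarrow> (real ^ 'n \<Rightarrow> real \<Rightarrow> ennreal) \<Rightarrow> (real ^ 'n \<Rightarrow> real) \<Rightarrow> ennreal" where
  "W1phi_norm \<Omega> \<phi> u =
     lux_norm \<Omega> \<phi> (\<lambda>x. ennreal \<bar>u x\<bar>) + lux_norm \<Omega> \<phi> (\<lambda>x. ennreal (norm (weak_gradient \<Omega> u x)))"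

definition C1_dense_in_W1phi ::
    "(real ^ 'n) set \<Rightarrow> (real ^ 'n \<Rightarrow> real \<Rightarrow> ennreal) \<Rightarrow> bool" where
  "C1_dense_in_W1phi \<Omega> \<phi> \<longleftrightarrow> (\<forall>u \<in> W1phi \<Omega> \<phi>.
     \<exists>w :: nat \<Rightarrow> real ^ 'n \<Rightarrow> real. (\<forall>j. Ck_on 1 \<Omega> (w j) \<and> w j \<in> W1phi \<Omega> \<phi>) \<and>
       (\<lambda>j. W1phi_norm \<Omega> \<phi> (\<lambda>x. w j x - u x)) \<longlonglongrightarrow> 0)"


section \<open>Absolute continuity on lines\<close>

definition abs_cont_on :: "real \<Rightarrow> real \<Rightarrow> (real \<Rightarrow> real) \<Rightarrow> bool" where
  "abs_cont_on a b f \<longleftrightarrow> (\<forall>\<epsilon>>0. \<exists>\<delta>>0. \<forall>(m::nat) s t.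
     (\<forall>i<m. a \<le> s i \<and> s i < t i \<and> t i \<le> b) \<and>
     disjoint_family_on (\<lambda>i. {s i <..< t i}) {..<m} \<and>
     (\<Sum>i<m. t i - s i) < \<delta> \<longrightarrow> (\<Sum>i<m. \<bar>f (t i) - f (s i)\<bar>) < \<epsilon>)"

text \<open>
  Points \<open>y\<close> of the \<open>(n-1)\<close>-dimensional space of coordinates other than \<open>k\<close> are the functions in
  \<open>(UNIV - {k}) \<rightarrow>\<^sub>E UNIV\<close>, and \<open>(n-1)\<close>-dimensional Lebesgue measure is the completion of the product
  of one-dimensional Lebesgue measures over these coordinates. For \<open>n = 1\<close> this is the unit mass on
  a one-point space.
\<close>

definition insert_coord :: "'n \<Rightarrow> ('n \<Rightarrow> real) \<Rightarrow> real \<Rightarrow> real ^ 'n" where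
  "insert_coord k y z = (\<chi> i. if i = k then z else y i)"

definition line_proj :: "(real ^ 'n) set \<Rightarrow> 'n \<Rightarrow> ('n \<Rightarrow> real) set" where
  "line_proj \<Omega> k = {y \<in> (UNIV - {k}) \<rightarrow>\<^sub>E UNIV. \<exists>z. insert_coord k y z \<in> \<Omega>}"

definition line_section :: "(real ^ 'n) set \<Rightarrow> 'n \<Rightarrow> ('n \<Rightarrow> real) \<Rightarrow> real set" where
  "line_section \<Omega> k y = {z. insert_coord k y z \<in> \<Omega>}"

definition AC_lines :: "(real ^ 'n) set \<Rightarrow> (real ^ 'n \<Rightarrow> real) \<Rightarrow> 'n \<Rightarrow> ('n \<Rightarrow> real) set" where
  "AC_lines \<Omega> u k = {y \<in> line_proj \<Omega> k. \<forall>a b. a \<le> b \<and> {a..b} \<subseteq> line_section \<Omega> k y \<longrightarrow>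
     abs_cont_on a b (\<lambda>z. u (insert_coord k y z))}"

definition ACL :: "(real ^ 'n) set \<Rightarrow> (real ^ 'n \<Rightarrow> real) set" where
  "ACL \<Omega> = {u. \<forall>k. line_proj \<Omega> k - AC_lines \<Omega> u k
     \<in> null_sets (completion (PiM (UNIV - {k}) (\<lambda>_. lborel)))}"

definition ACLphi ::
    "(real ^ 'n) set \<Rightarrow> (real ^ 'n \<Rightarrow> real \<Rightarrow> ennreal) \<Rightarrow> (real ^ 'n \<Rightarrow> real) set" where
  "ACLphi \<Omega> \<phi> = {u \<in> ACL \<Omega>. (\<lambda>x. norm (gradient u x)) \<in> Lphi \<Omega> \<phi>}"


section \<open>Curves, modulus, and absolute continuity on curves\<close>

definition curve_length :: "real \<Rightarrow> real \<Rightarrow> (real \<Rightarrow> 'a::metric_space) \<Rightarrow> ennreal" where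
  "curve_length a b \<gamma> = Sup {\<Sum>i<m. ennreal (dist (\<gamma> (t i)) (\<gamma> (t (Suc i)))) | (m::nat) t.
     mono_on {..m} t \<and> t 0 = a \<and> t m = b}"

text \<open>
  A rectifiable curve parametrized by arc length is a pair \<open>(l, \<gamma>)\<close> of its length \<open>l\<close> and the
  parametrization \<open>\<gamma>\<close>, of which only the restriction to \<open>{0..l}\<close> matters.
\<close>

definition Gamma_rect :: "(real ^ 'n) set \<Rightarrow> (real \<times> (real \<Rightarrow> real ^ 'n)) set" where
  "Gamma_rect \<Omega> = {(l, \<gamma>). 0 < l \<and> continuous_on {0..l} \<gamma> \<and>
     (\<forall>t\<in>{0..l}. curve_length 0 t \<gamma> = ennreal t) \<and> \<gamma> ` {0..l} \<subseteq> \<Omega>}"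

definition curve_integral :: "real \<times> (real \<Rightarrow> real ^ 'n) \<Rightarrow> (real ^ 'n \<Rightarrow> ennreal) \<Rightarrow> ennreal" where
  "curve_integral c v = (\<integral>\<^sup>+ t\<in>{0..fst c}. v (snd c t) \<partial>lborel)"

definition F_adm ::
    "(real ^ 'n) set \<Rightarrow> (real \<times> (real \<Rightarrow> real ^ 'n)) set \<Rightarrow> (real ^ 'n \<Rightarrow> ennreal) set" where
  "F_adm \<Omega> \<Gamma> = {v. v \<in> borel_measurable (restrict_space borel \<Omega>) \<and>
     (\<forall>c\<in>\<Gamma>. curve_integral c v \<ge> 1)}"

definition phi_modulus ::
    "(real ^ 'n) set \<Rightarrow> (real ^ 'n \<Rightarrow> real \<Rightarrow> ennreal) \<Rightarrow>
      (real \<times> (real \<Rightarrow> real ^ 'n)) set \<Rightarrow> ennreal" where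
  "phi_modulus \<Omega> \<phi> \<Gamma> = (INF v \<in> F_adm \<Omega> \<Gamma>. lux_norm \<Omega> \<phi> v)"

definition Gamma_NAC ::
    "(real ^ 'n) set \<Rightarrow> (real ^ 'n \<Rightarrow> real) \<Rightarrow> (real \<times> (real \<Rightarrow> real ^ 'n)) set" where
  "Gamma_NAC \<Omega> u = {(l, \<gamma>) \<in> Gamma_rect \<Omega>. \<not> abs_cont_on 0 l (u \<circ> \<gamma>)}"

definition ACC ::
    "(real ^ 'n) set \<Rightarrow> (real ^ 'n \<Rightarrow> real \<Rightarrow> ennreal) \<Rightarrow> (real ^ 'n \<Rightarrow> real) set" where
  "ACC \<Omega> \<phi> = {u. phi_modulus \<Omega> \<phi> (Gamma_NAC \<Omega> u) = 0}"

definition ACCphi ::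
    "(real ^ 'n) set \<Rightarrow> (real ^ 'n \<Rightarrow> real \<Rightarrow> ennreal) \<Rightarrow> (real ^ 'n \<Rightarrow> real) set" where
  "ACCphi \<Omega> \<phi> = {u \<in> ACC \<Omega> \<phi>. (\<lambda>x. norm (gradient u x)) \<in> Lphi \<Omega> \<phi>}"

end

theory Submission
  imports Defs
begin

text \<open>
  Three inclusions close the circle. A curve family of modulus zero meets almost no line: by the
  lower bound on \<open>\<phi>(x, \<beta>)\<close>, admissible functions of small norm have small integral on bounded sets, so
  Fubini and Markov show that almost no line contains a segment belonging to the family; hence
  \<open>ACC \<subseteq> ACL\<close>. For an ACL function, integration by parts on almost every line identifies the
  classical partial derivatives with the weak ones; hence \<open>ACL \<subseteq> W\<close>. Conversely, given \<open>u \<in> W\<close>,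
  choose \<open>C\<^sup>1\<close> functions \<open>w\<^sub>j\<close> converging to \<open>u\<close> so fast that \<open>\<Sum>\<^sub>j \<bar>\<nabla>w\<^sub>j\<^sub>+\<^sub>1 - \<nabla>w\<^sub>j\<bar>\<close> has finite norm.
  Every curve on which this sum is integrable, and which is not contained in the null set where
  \<open>w\<^sub>j\<close> diverges, has a limit of the \<open>w\<^sub>j\<close> along it, which is absolutely continuous
  because \<open>\<bar>\<nabla>w\<^sub>0\<bar> + \<Sum>\<^sub>j \<bar>\<nabla>w\<^sub>j\<^sub>+\<^sub>1 - \<nabla>w\<^sub>j\<bar>\<close> dominates all the gradients (Fuglede's argument). The
  remaining curves have modulus zero.
\<close>

section \<open>Lebesgue differentiation on the line\<close>

text \<open>Since \<open>\<phi>\<close> need not be convex, the modular is not subadditive and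
  \<open>lux_norm\<close> need not be a norm. What replaces convexity is the almost monotonicity of
  the quotient of \<open>\<phi> x t\<close> by \<open>t\<close>: an argument multiplied by c \<le> 1
  has its value multiplied by at most L * c. Hence the geometric weights wherever a series of
  functions is estimated. The second obstacle is measurability. The function \<open>u\<close> is
  only Lebesgue measurable, its partial derivatives have unspecified values where they fail to
  exist, and a set of bad lines need not be measurable. Fubini's theorem is therefore applied only
  to sets and functions prepared for it: Borel parts, conditions on rational difference quotients,
  supersets defined by integrals of Borel functions. Third, an arc length parametrization is merely
  1-Lipschitz, so the growth of a C1 function along it is estimated by linearization on short
  intervals and bisection, without differentiating the curve. The theory on the real line serves the
  lines: an absolutely continuous function is the integral of its almost everywhere existing
  derivative.\<close>

text \<open>The measure with density \<open>h\<close> is outer regular and gives no mass to the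
  zeros of \<open>h\<close>, so these lie in an open U of small mass. Around a bad point there are
  short intervals inside U whose mass exceeds e times their length. Vitali's covering lemma selects
  disjoint ones whose five-fold enlargements still cover the bad points, so the bad set has outer
  measure at most 5 / e times the mass of U.\<close>

lemma AE_small_averages_where_zero:
  fixes h :: "real \<Rightarrow> real"
  assumes h: "integrable lborel h" and nonneg: "\<And>x. 0 \<le> h x"
  shows "AE x in lborel. h x = 0 \<longrightarrow> (\<forall>\<epsilon>>0. \<exists>\<delta>>0. \<forall>a b. a \<le> x \<and> x \<le> b \<and> a < b \<and> b - a < \<delta> \<longrightarrow>
           (LBINT t:{a..b}. h t) \<le> \<epsilon> * (b - a))"
proof -
  have [measurable]: "h \<in> borel_measurable borel" using h by auto
  define M where "M = density lborel (\<lambda>x. ennreal (h x))"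
  have M_sets: "sets M = sets borel" by (simp add: M_def)
  have M_eq: "emeasure M A = ennreal (LBINT t:A. h t)" if "A \<in> sets borel" for A
  proof -
    have "emeasure M A = (\<integral>\<^sup>+x. ennreal (indicator A x * h x) \<partial>lborel)"
      unfolding M_def using that
      by (subst emeasure_density) (auto intro!: nn_integral_cong simp: indicator_def)
    also have "\<dots> = ennreal (LBINT t:A. h t)"
      unfolding set_lebesgue_integral_def using that h nonneg
      by (subst nn_integral_eq_integral) (auto intro!: integrable_real_mult_indicator simp: mult.commute[of _ "h _"])
    finally show ?thesis .
  qed
  have fin: "finite_measure M"
    by (rule finite_measureI) (use M_eq[of UNIV] in \<open>auto simp: M_def\<close>)
  have meas: "measure M A = (LBINT t:A. h t)" if "A \<in> sets borel" for A
  proof -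
    have "0 \<le> (LBINT t:A. h t)"
      unfolding set_lebesgue_integral_def using nonneg by (intro integral_nonneg_AE) auto
    then show ?thesis using M_eq[OF that] by (simp add: measure_def)
  qed
  define B where "B e = {x. h x = 0 \<and> (\<forall>\<delta>>0. \<exists>a b. a \<le> x \<and> x \<le> b \<and> a < b \<and> b - a < \<delta> \<and>
      (LBINT t:{a..b}. h t) > e * (b - a))}" for e
  have neg: "negligible (B e)" if "e > 0" for e
    unfolding negligible_outer_le
  proof (intro allI impI)
    fix \<eta> :: real assume "\<eta> > 0"
    have A: "{x. h x = 0} \<in> sets borel" by measurable
    have "emeasure M {x. h x = 0} = 0"
      unfolding M_def using A by (subst emeasure_density) (auto simp: nn_integral_0_iff_AE indicator_def)
    moreover have "emeasure M {x. h x = 0} = (INF U\<in>{U. {x. h x = 0} \<subseteq> U \<and> open U}. emeasure M U)"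
      using finite_measure.emeasure_finite[OF fin] by (intro outer_regular M_sets A) auto
    \<comment> \<open>The bound \<open>\<eta> * e / 5\<close> compensates the factor 5 of the Vitali
      enlargement and the factor 1 / e relating length to mass.\<close>
    ultimately have "(INF U\<in>{U. {x. h x = 0} \<subseteq> U \<and> open U}. emeasure M U) < ennreal (\<eta> * e / 5)"
      using \<open>\<eta> > 0\<close> \<open>e > 0\<close> by (simp add: )
    then obtain U where U: "{x. h x = 0} \<subseteq> U" "open U" "emeasure M U < ennreal (\<eta> * e / 5)"
      unfolding INF_less_iff by auto
    have MU: "measure M U < \<eta> * e / 5"
      using U(3) \<open>\<eta> > 0\<close> \<open>e > 0\<close> by (simp add: finite_measure.emeasure_eq_measure[OF fin] ennreal_less_iff)
    have "\<exists>a b. a \<le> x \<and> x \<le> b \<and> a < b \<and> b - a < 1 \<and> {a..b} \<subseteq> U \<and> (LBINT t:{a..b}. h t) > e * (b - a)"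
      if xB: "x \<in> B e" for x
    proof -
      from that U(1) have "x \<in> U" by (auto simp: B_def)
      then obtain d where d: "d > 0" "ball x d \<subseteq> U" using U(2) openE by blast
      have "min d 1 > 0" using d by simp
      then obtain a b where ab: "a \<le> x" "x \<le> b" "a < b" "b - a < min d 1" "(LBINT t:{a..b}. h t) > e * (b - a)"
        using xB unfolding B_def by blast
      have "{a..b} \<subseteq> ball x d" using ab by (auto simp: dist_real_def)
      then show ?thesis using ab d by auto
    qed
    then obtain a b where ab: "\<And>x. x \<in> B e \<Longrightarrow> a x \<le> x \<and> x \<le> b x \<and> a x < b x \<and> b x - a x < 1 \<and>
        {a x..b x} \<subseteq> U \<and> (LBINT t:{a x..b x}. h t) > e * (b x - a x)" by metis
    let ?c = "\<lambda>x. (a x + b x) / 2" and ?r = "\<lambda>x. (b x - a x) / 2"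
    have cb: "cball (?c x) (?r x) = {a x..b x}" for x
      by (simp only: cball_eq_atLeastAtMost) (simp add: field_simps)
    have "B e \<subseteq> (\<Union>i\<in>B e. cball (?c i) (?r i))"
      using ab by (force simp: cb)
    then obtain C where C: "countable C" "C \<subseteq> B e"
      "pairwise (\<lambda>i j. disjnt (cball (?c i) (?r i)) (cball (?c j) (?r j))) C"
      "B e \<subseteq> (\<Union>i\<in>C. cball (?c i) (5 * ?r i))"
      by (rule Vitali_covering_lemma_cballs[where B=1]) (use ab in force)+
    have bound: "measure lebesgue (\<Union>i\<in>I. cball (?c i) (5 * ?r i)) \<le> \<eta>" if I: "I \<subseteq> C" "finite I" for I
    proof -
      have IB: "i \<in> B e" if "i \<in> I" for i using that I C by auto
      have "measure lebesgue (\<Union>i\<in>I. cball (?c i) (5 * ?r i)) \<le> (\<Sum>i\<in>I. measure lebesgue (cball (?c i) (5 * ?r i)))"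
        by (rule measure_UNION_le) (use I in auto)
      also have "\<dots> = (\<Sum>i\<in>I. 5 * (b i - a i))"
      proof (rule sum.cong[OF refl])
        fix i assume "i \<in> I"
        then have "a i < b i" using IB ab by blast
        then show "measure lebesgue (cball (?c i) (5 * ?r i)) = 5 * (b i - a i)"
          by (simp only: cball_eq_atLeastAtMost) (simp add: field_simps)
      qed
      also have "\<dots> \<le> (\<Sum>i\<in>I. 5 / e * measure M {a i..b i})"
      proof (rule sum_mono)
        fix i assume "i \<in> I"
        then show "5 * (b i - a i) \<le> 5 / e * measure M {a i..b i}"
          using ab[OF IB[OF \<open>i \<in> I\<close>]] \<open>e > 0\<close> by (simp add: meas field_simps)
      qed
      also have "\<dots> = 5 / e * (\<Sum>i\<in>I. measure M {a i..b i})" by (simp add: sum_distrib_left)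
      also have "(\<Sum>i\<in>I. measure M {a i..b i}) = measure M (\<Union>i\<in>I. {a i..b i})"
      proof (rule finite_measure.finite_measure_finite_Union[OF fin, symmetric])
        show "disjoint_family_on (\<lambda>i. {a i..b i}) I"
          using C(3) I(1) unfolding cb by (auto simp: pairwise_def disjoint_family_on_def disjnt_def subset_iff)
      qed (use I M_sets in auto)
      also have "\<dots> \<le> measure M U"
        by (rule finite_measure.finite_measure_mono[OF fin]) (use ab IB U in \<open>auto simp: M_sets\<close>)
      finally have "measure lebesgue (\<Union>i\<in>I. cball (?c i) (5 * ?r i)) \<le> 5 / e * measure M U"
        using \<open>e > 0\<close> by (simp add: divide_right_mono)
      also have "\<dots> \<le> \<eta>" using MU \<open>e > 0\<close> by (simp add: field_simps)
      finally show ?thesis .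
    qed
    have fm: "cball (?c i) (5 * ?r i) \<in> lmeasurable" for i by auto
    show "\<exists>T. B e \<subseteq> T \<and> T \<in> lmeasurable \<and> measure lebesgue T \<le> \<eta>"
      using C(4) fmeasurable_UN_bound[OF C(1) fm bound] measure_UN_bound[OF C(1) fm bound] by blast
  qed
  have "(\<Union>n. B (1 / real (Suc n))) \<in> null_sets lebesgue"
    using neg by (intro null_sets_UN) (auto simp: negligible_iff_null_sets)
  then have "AE x in lborel. x \<notin> (\<Union>n. B (1 / real (Suc n)))"
    using AE_not_in AE_completion_iff by blast
  then show ?thesis
  proof eventually_elim
    case (elim x)
    show ?case
    proof (intro impI allI)
      fix \<epsilon> :: real assume "h x = 0" "\<epsilon> > 0"
      obtain n where n: "1 / real (Suc n) < \<epsilon>" using \<open>\<epsilon> > 0\<close> by (meson nat_approx_posE)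
      have "x \<notin> B (1 / real (Suc n))" using elim by auto
      then obtain \<delta> where "\<delta> > 0" and *: "\<And>a b. a \<le> x \<Longrightarrow> x \<le> b \<Longrightarrow> a < b \<Longrightarrow> b - a < \<delta> \<Longrightarrow>
          (LBINT t:{a..b}. h t) \<le> 1 / real (Suc n) * (b - a)"
        using \<open>h x = 0\<close> unfolding B_def mem_Collect_eq not_less[symmetric] by blast
      have "(LBINT t:{a..b}. h t) \<le> \<epsilon> * (b - a)" if "a \<le> x" "x \<le> b" "a < b" "b - a < \<delta>" for a b
        using *[OF that] n mult_right_mono[of "1 / real (Suc n)" \<epsilon> "b - a"] that by linarith
      then show "\<exists>\<delta>>0. \<forall>a b. a \<le> x \<and> x \<le> b \<and> a < b \<and> b - a < \<delta> \<longrightarrow> (LBINT t:{a..b}. h t) \<le> \<epsilon> * (b - a)"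
        using \<open>\<delta> > 0\<close> by blast
    qed
  qed
qed

text \<open>Reduction to zeros: for a rational q slightly above \<open>g x\<close> the positive part
  of g - q vanishes at x, so its averages near x are small and those of \<open>g\<close> exceed q by
  little. The lower bound is the same argument for the negative. Only countably many functions
  occur, so one null set serves all of them.\<close>

lemma AE_lebesgue_differentiation:
  fixes g :: "real \<Rightarrow> real"
  assumes g: "integrable lborel g"
  shows "AE x in lborel. \<forall>\<epsilon>>0. \<exists>\<delta>>0. \<forall>a b. a \<le> x \<and> x \<le> b \<and> a < b \<and> b - a < \<delta> \<longrightarrow>
           \<bar>(LBINT t:{a..b}. g t) - g x * (b - a)\<bar> \<le> \<epsilon> * (b - a)"
proof -
  have [measurable]: "g \<in> borel_measurable borel" using g by auto
  define P where "P h x \<longleftrightarrow> (h x = 0 \<longrightarrow> (\<forall>\<epsilon>>0. \<exists>\<delta>>0. \<forall>a b. a \<le> x \<and> x \<le> b \<and> a < b \<and> b - a < \<delta> \<longrightarrow>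
           (LBINT t:{a..b}. h t) \<le> \<epsilon> * (b - a)))" for h :: "real \<Rightarrow> real" and x
  \<comment> \<open>The sign \<open>s\<close> treats the upper and the lower bound together; the
    cutoff to (-n, n) keeps the function integrable, which the constant q alone would not
    be.\<close>
  define h where "h s n q t = indicator {-real n<..<real n} t * max 0 (s * (g t - of_rat q))"
    for s :: real and n :: nat and q :: rat and t :: real
  have int: "integrable lborel (h s n q)" if "s = 1 \<or> s = -1" for s n q
  proof -
    have "integrable lborel (\<lambda>t. indicator {-real n<..<real n} t * (g t - of_rat q))"
      using integrable_mult_indicator[of "{-real n<..<real n}" lborel g] g
      by (auto simp: right_diff_distrib intro!: Bochner_Integration.integrable_diff integrable_mult_left)
    then show ?thesis
      by (rule Bochner_Integration.integrable_bound)
         (use that in \<open>auto simp: h_def[abs_def] indicator_def\<close>)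
  qed
  have "AE x in lborel. \<forall>q. \<forall>n. P (h 1 n q) x \<and> P (h (-1) n q) x"
    unfolding AE_all_countable P_def
    by (intro allI AE_conjI AE_small_averages_where_zero int) (auto simp: h_def)
  then show ?thesis
  proof eventually_elim
    case (elim x)
    obtain n :: nat where n: "\<bar>x\<bar> < real n" using reals_Archimedean2 by blast
    have half: "\<exists>\<delta>>0. \<forall>a b. a \<le> x \<and> x \<le> b \<and> a < b \<and> b - a < \<delta> \<longrightarrow>
           s * ((LBINT t:{a..b}. g t) - g x * (b - a)) \<le> \<epsilon> * (b - a)"
      if s: "s = 1 \<or> s = -1" and "\<epsilon> > 0" for s \<epsilon>
    proof -
      obtain q where q: "s * (g x - of_rat q) \<le> 0" "s * (of_rat q - g x) < \<epsilon> / 2"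
      proof (cases "s = 1")
        case True
        obtain q where "g x < of_rat q" "of_rat q < g x + \<epsilon> / 2"
          using of_rat_dense[of "g x" "g x + \<epsilon> / 2"] \<open>\<epsilon> > 0\<close> by auto
        then show ?thesis using True by (intro that[of q]) auto
      next
        case False
        obtain q where "g x - \<epsilon> / 2 < of_rat q" "of_rat q < g x"
          using of_rat_dense[of "g x - \<epsilon> / 2" "g x"] \<open>\<epsilon> > 0\<close> by auto
        then show ?thesis using False s by (intro that[of q]) auto
      qed
      have "P (h s n q) x" using elim s by auto
      moreover have "h s n q x = 0" using q by (simp add: h_def)
      moreover have "\<epsilon> / 2 > 0" using \<open>\<epsilon> > 0\<close> by simp
      ultimately obtain \<delta> where \<delta>: "\<delta> > 0" and *: "\<And>a b. a \<le> x \<Longrightarrow> x \<le> b \<Longrightarrow> a < b \<Longrightarrow> b - a < \<delta> \<Longrightarrow>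
          (LBINT t:{a..b}. h s n q t) \<le> \<epsilon> / 2 * (b - a)" unfolding P_def by blast
      \<comment> \<open>Keeps the interval inside the cutoff (-n, n), where \<open>h s n q\<close>
        dominates s * (g - q).\<close>
      define \<delta>' where "\<delta>' = min \<delta> (real n - \<bar>x\<bar>)"
      have "s * ((LBINT t:{a..b}. g t) - g x * (b - a)) \<le> \<epsilon> * (b - a)"
        if ab: "a \<le> x" "x \<le> b" "a < b" "b - a < \<delta>'" for a b
      proof -
        have sub: "{a..b} \<subseteq> {-real n<..<real n}" using ab by (auto simp: \<delta>'_def)
        have g_int: "set_integrable lborel {a..b} g"
          using g unfolding set_integrable_def by (intro integrable_mult_indicator) auto
        have h_int: "set_integrable lborel {a..b} (h s n q)"
          using int[OF s, of n q] unfolding set_integrable_def by (intro integrable_mult_indicator) auto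
        have c_int: "set_integrable lborel {a..b} (\<lambda>t. s * of_rat q)" for q
          by (rule borel_integrable_atLeastAtMost') auto
        have sg_int: "set_integrable lborel {a..b} (\<lambda>t. s * g t)" using g_int by auto
        have "s * (LBINT t:{a..b}. g t) - s * of_rat q * (b - a) = (LBINT t:{a..b}. s * g t - s * of_rat q)"
          using sg_int c_int \<open>a < b\<close> by (subst set_integral_diff) (auto simp: set_lebesgue_integral_def mult.commute)
        also have "\<dots> \<le> (LBINT t:{a..b}. h s n q t)"
        proof (rule set_integral_mono[OF set_integral_diff(1)[OF sg_int c_int] h_int])
          fix t assume "t \<in> {a..b}"
          then have "t \<in> {-real n<..<real n}" using sub by blast
          then show "s * g t - s * of_rat q \<le> h s n q t" by (simp add: h_def algebra_simps)
        qed
        also have "\<dots> \<le> \<epsilon> / 2 * (b - a)" using * ab by (simp add: \<delta>'_def)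
        finally have "s * (LBINT t:{a..b}. g t) - s * of_rat q * (b - a) \<le> \<epsilon> / 2 * (b - a)" .
        moreover have "s * (of_rat q - g x) * (b - a) \<le> \<epsilon> / 2 * (b - a)"
          using q(2) ab by (intro mult_right_mono) auto
        ultimately show ?thesis by (simp add: algebra_simps)
      qed
      moreover have "\<delta>' > 0" using \<delta> n by (simp add: \<delta>'_def)
      ultimately show ?thesis by blast
    qed
    show ?case
    proof (intro allI impI)
      fix \<epsilon> :: real assume "\<epsilon> > 0"
      obtain d1 where d1: "d1 > 0" "\<And>a b. a \<le> x \<and> x \<le> b \<and> a < b \<and> b - a < d1 \<Longrightarrow>
           1 * ((LBINT t:{a..b}. g t) - g x * (b - a)) \<le> \<epsilon> * (b - a)" using half[OF disjI1[OF refl] \<open>\<epsilon> > 0\<close>] by blast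
      obtain d2 where d2: "d2 > 0" "\<And>a b. a \<le> x \<and> x \<le> b \<and> a < b \<and> b - a < d2 \<Longrightarrow>
           (-1) * ((LBINT t:{a..b}. g t) - g x * (b - a)) \<le> \<epsilon> * (b - a)" using half[OF disjI2[OF refl] \<open>\<epsilon> > 0\<close>] by blast
      have "\<bar>(LBINT t:{a..b}. g t) - g x * (b - a)\<bar> \<le> \<epsilon> * (b - a)"
        if "a \<le> x \<and> x \<le> b \<and> a < b \<and> b - a < min d1 d2" for a b
        using d1(2)[of a b] d2(2)[of a b] that by (auto simp: abs_le_iff)
      then show "\<exists>\<delta>>0. \<forall>a b. a \<le> x \<and> x \<le> b \<and> a < b \<and> b - a < \<delta> \<longrightarrow>
           \<bar>(LBINT t:{a..b}. g t) - g x * (b - a)\<bar> \<le> \<epsilon> * (b - a)"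
        using d1(1) d2(1) by (intro exI[of _ "min d1 d2"]) auto
    qed
  qed
qed

text \<open>The difference quotients of \<open>F\<close> are averages of \<open>g\<close>, so
  \<open>F\<close> is differentiable wherever these averages, taken for the extension of
  \<open>g\<close> by zero, converge to the value of \<open>g\<close>.\<close>

lemma AE_has_derivative_indefinite_integral:
  fixes g F :: "real \<Rightarrow> real"
  assumes g: "set_integrable lborel {a..b} g"
    and F: "\<And>s t. a \<le> s \<Longrightarrow> s \<le> t \<Longrightarrow> t \<le> b \<Longrightarrow> F t - F s = (LBINT x:{s..t}. g x)"
  shows "AE x in lborel. x \<in> {a<..<b} \<longrightarrow> (F has_real_derivative g x) (at x)"
proof -
  define g' where "g' t = indicator {a..b} t * g t" for t
  have g': "integrable lborel g'" using g by (simp add: g'_def[abs_def] set_integrable_def)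
  show ?thesis using AE_lebesgue_differentiation[OF g']
  proof eventually_elim
    case (elim x)
    show ?case
    proof
      assume x: "x \<in> {a<..<b}"
      have *: "\<bar>F d - F c - g x * (d - c)\<bar> = \<bar>(LBINT t:{c..d}. g' t) - g' x * (d - c)\<bar>"
        if "a \<le> c" "c \<le> d" "d \<le> b" for c d
      proof -
        have "(LBINT t:{c..d}. g' t) = (LBINT t:{c..d}. g t)"
          by (rule set_lebesgue_integral_cong) (use that in \<open>auto simp: g'_def\<close>)
        then show ?thesis using F[OF that] x by (simp add: g'_def)
      qed
      show "(F has_real_derivative g x) (at x)"
        unfolding has_field_derivative_def has_derivative_at_alt
      proof (intro conjI allI impI)
        show "bounded_linear ((*) (g x))" by (rule bounded_linear_mult_right)
        fix e :: real assume "e > 0"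
        then obtain \<delta> where \<delta>: "\<delta> > 0" "\<And>a b. a \<le> x \<Longrightarrow> x \<le> b \<Longrightarrow> a < b \<Longrightarrow> b - a < \<delta> \<Longrightarrow>
          \<bar>(LBINT t:{a..b}. g' t) - g' x * (b - a)\<bar> \<le> e * (b - a)" using elim by meson
        show "\<exists>d>0. \<forall>y. norm (y - x) < d \<longrightarrow> norm (F y - F x - g x * (y - x)) \<le> e * norm (y - x)"
        proof (intro exI[of _ "min \<delta> (min (x - a) (b - x))"] conjI allI impI)
          fix y assume y: "norm (y - x) < min \<delta> (min (x - a) (b - x))"
          consider "y = x" | "y < x" | "y > x" by linarith
          then show "norm (F y - F x - g x * (y - x)) \<le> e * norm (y - x)"
          proof cases
            case 2
            then have "\<bar>F x - F y - g x * (x - y)\<bar> \<le> e * (x - y)"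
              using *[of y x] \<delta>(2)[of y x] y x by auto
            moreover have "\<bar>F y - F x - g x * (y - x)\<bar> = \<bar>F x - F y - g x * (x - y)\<bar>"
              by (simp add: abs_minus_commute algebra_simps)
            ultimately show ?thesis using 2 by simp
          next
            case 3
            then show ?thesis using *[of x y] \<delta>(2)[of x y] y x by auto
          qed simp
        qed (use \<delta> x in auto)
      qed
    qed
  qed
qed

section \<open>Variation and absolutely continuous functions\<close>

text \<open>A finite set of pairs instead of the indexed sequences of \<open>abs_cont_on\<close>:
  images, unions and subsets of families can then be formed without renumbering. Intervals may share
  endpoints and may leave gaps.\<close>

definition interval_family :: "real \<Rightarrow> real \<Rightarrow> (real \<times> real) set \<Rightarrow> bool" where
  "interval_family x y D \<longleftrightarrow> finite D \<and> (\<forall>p\<in>D. x \<le> fst p \<and> fst p < snd p \<and> snd p \<le> y) \<and>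
     disjoint_family_on (\<lambda>p. {fst p<..<snd p}) D"

definition var_sum :: "(real \<Rightarrow> real) \<Rightarrow> (real \<times> real) set \<Rightarrow> real" where
  "var_sum F D = (\<Sum>p\<in>D. \<bar>F (snd p) - F (fst p)\<bar>)"

text \<open>Gaps do not change the supremum, so this is the usual total variation. As a real
  supremum it carries information only together with \<open>bounded_var\<close>.\<close>

definition variation :: "(real \<Rightarrow> real) \<Rightarrow> real \<Rightarrow> real \<Rightarrow> real" where
  "variation F x y = Sup (var_sum F ` {D. interval_family x y D})"

definition bounded_var :: "(real \<Rightarrow> real) \<Rightarrow> real \<Rightarrow> real \<Rightarrow> bool" where
  "bounded_var F x y \<longleftrightarrow> bdd_above (var_sum F ` {D. interval_family x y D})"

lemma abs_cont_on_interval_family: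
  assumes "abs_cont_on a b F" "\<epsilon> > 0"
  obtains \<delta> where "\<delta> > 0"
    "\<And>D. interval_family a b D \<Longrightarrow> (\<Sum>p\<in>D. snd p - fst p) < \<delta> \<Longrightarrow> var_sum F D < \<epsilon>"
proof -
  from assms(1)[unfolded abs_cont_on_def, rule_format, OF assms(2)]
  obtain \<delta> where \<delta>: "\<delta> > 0" and *: "\<forall>(m::nat) s t.
     (\<forall>i<m. a \<le> s i \<and> s i < t i \<and> t i \<le> b) \<and>
     disjoint_family_on (\<lambda>i. {s i <..< t i}) {..<m} \<and>
     (\<Sum>i<m. t i - s i) < \<delta> \<longrightarrow> (\<Sum>i<m. \<bar>F (t i) - F (s i)\<bar>) < \<epsilon>"
    by (elim exE conjE)
  have "var_sum F D < \<epsilon>" if D: "interval_family a b D" and len: "(\<Sum>p\<in>D. snd p - fst p) < \<delta>" for D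
  proof -
    have "finite D" using D by (simp add: interval_family_def)
    then obtain h where h: "bij_betw h {0..<card D} D" using ex_bij_betw_nat_finite by blast
    then have h: "bij_betw h {..<card D} D" by (simp add: atLeast0LessThan)
    have hD: "h i \<in> D" if "i < card D" for i using h that by (auto simp: bij_betw_def)
    have "(\<Sum>i<card D. \<bar>F (snd (h i)) - F (fst (h i))\<bar>) < \<epsilon>"
    proof (rule *[THEN spec, THEN spec, THEN spec, THEN mp], intro conjI)
      show "\<forall>i<card D. a \<le> fst (h i) \<and> fst (h i) < snd (h i) \<and> snd (h i) \<le> b"
        using hD D by (auto simp: interval_family_def)
      show "disjoint_family_on (\<lambda>i. {fst (h i)<..<snd (h i)}) {..<card D}"
        unfolding disjoint_family_on_def
      proof (intro ballI impI)
        fix i j assume ij: "i \<in> {..<card D}" "j \<in> {..<card D}" "i \<noteq> j"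
        then have "h i \<noteq> h j" using h by (auto simp: bij_betw_def inj_on_def)
        then show "{fst (h i)<..<snd (h i)} \<inter> {fst (h j)<..<snd (h j)} = {}"
          using D hD[of i] hD[of j] ij unfolding interval_family_def disjoint_family_on_def by auto
      qed
      show "(\<Sum>i<card D. snd (h i) - fst (h i)) < \<delta>"
        using len sum.reindex_bij_betw[OF h, of "\<lambda>p. snd p - fst p"] by simp
    qed
    then show ?thesis
      using sum.reindex_bij_betw[OF h, of "\<lambda>p. \<bar>F (snd p) - F (fst p)\<bar>"] by (simp add: var_sum_def)
  qed
  then show thesis using \<delta> that by blast
qed

lemma interval_family_empty [simp]: "interval_family x y {}"
  by (simp add: interval_family_def disjoint_family_on_def)

lemma interval_family_singleton: "x \<le> s \<Longrightarrow> s < t \<Longrightarrow> t \<le> y \<Longrightarrow> interval_family x y {(s, t)}"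
  by (simp add: interval_family_def disjoint_family_on_def)

lemma interval_family_mono: "interval_family x y D \<Longrightarrow> x' \<le> x \<Longrightarrow> y \<le> y' \<Longrightarrow> interval_family x' y' D"
  by (fastforce simp: interval_family_def)

text \<open>Disjointness passes to smaller intervals. Because the new intervals are nonempty, two
  members with the same image would overlap; this gives injectivity, which is needed to reindex sums
  over the image.\<close>

lemma interval_family_shrink:
  assumes D: "interval_family x y D" and A: "A \<subseteq> D"
    and f: "\<And>p. p \<in> A \<Longrightarrow> x' \<le> fst (f p) \<and> fst (f p) < snd (f p) \<and> snd (f p) \<le> y' \<and>
              fst p \<le> fst (f p) \<and> snd (f p) \<le> snd p"
  shows "interval_family x' y' (f ` A)" "inj_on f A"
proof -
  have eq: "p = q" if "p \<in> A" "q \<in> A" "{fst (f p)<..<snd (f p)} \<inter> {fst (f q)<..<snd (f q)} \<noteq> {}" for p q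
  proof (rule ccontr)
    assume "p \<noteq> q"
    then have "{fst p<..<snd p} \<inter> {fst q<..<snd q} = {}"
      using D A that unfolding interval_family_def disjoint_family_on_def by blast
    then show False using that(3) f[OF that(1)] f[OF that(2)] by fastforce
  qed
  show "inj_on f A"
  proof (rule inj_onI)
    fix p q assume pq: "p \<in> A" "q \<in> A" "f p = f q"
    obtain z where "fst (f p) < z" "z < snd (f p)" using f[OF pq(1)] dense by blast
    then show "p = q" using pq by (intro eq) auto
  qed
  show "interval_family x' y' (f ` A)"
    unfolding interval_family_def
  proof (intro conjI)
    show "finite (f ` A)" using D A finite_subset by (auto simp: interval_family_def)
    show "disjoint_family_on (\<lambda>p. {fst p<..<snd p}) (f ` A)"
      unfolding disjoint_family_on_def using eq by blast
  qed (use f in auto)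
qed

text \<open>Intervals below different members of \<open>E\<close> are disjoint and nonempty, hence
  distinct: the union is a family again and no interval is counted twice in the double sum.\<close>

lemma interval_family_UN:
  assumes E: "interval_family x y E" and D: "\<And>p. p \<in> E \<Longrightarrow> interval_family (fst p) (snd p) (D p)"
  shows "interval_family x y (\<Union>p\<in>E. D p)"
    and "(\<Sum>q\<in>(\<Union>p\<in>E. D p). f q) = (\<Sum>p\<in>E. \<Sum>q\<in>D p. (f q :: real))"
proof -
  have finE: "finite E" using E by (simp add: interval_family_def)
  have finD: "finite (D p)" if "p \<in> E" for p using D[OF that] by (simp add: interval_family_def)
  have sub: "{fst q<..<snd q} \<subseteq> {fst p<..<snd p} \<and> fst q < snd q" if "p \<in> E" "q \<in> D p" for p q
    using D[OF that(1)] that(2) by (force simp: interval_family_def)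
  have disj: "{fst q<..<snd q} \<inter> {fst q'<..<snd q'} = {}"
    if "p \<in> E" "p' \<in> E" "p \<noteq> p'" "q \<in> D p" "q' \<in> D p'" for p p' q q'
    using sub[OF that(1,4)] sub[OF that(2,5)] E that(1-3) 
    unfolding interval_family_def disjoint_family_on_def by blast
  have disjD: "D p \<inter> D p' = {}" if "p \<in> E" "p' \<in> E" "p \<noteq> p'" for p p'
  proof (rule ccontr)
    assume "D p \<inter> D p' \<noteq> {}"
    then obtain q where q: "q \<in> D p" "q \<in> D p'" by blast
    then have "{fst q<..<snd q} = {}" using disj[OF that q] by simp
    then show False using sub[OF that(1) q(1)] by auto
  qed
  show "(\<Sum>q\<in>(\<Union>p\<in>E. D p). f q) = (\<Sum>p\<in>E. \<Sum>q\<in>D p. f q)"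
    using finE finD disjD by (intro sum.UNION_disjoint) auto
  show "interval_family x y (\<Union>p\<in>E. D p)"
    unfolding interval_family_def
  proof (intro conjI)
    show "disjoint_family_on (\<lambda>p. {fst p<..<snd p}) (\<Union>p\<in>E. D p)"
      unfolding disjoint_family_on_def
    proof (intro ballI impI)
      fix q q' assume "q \<in> (\<Union>p\<in>E. D p)" "q' \<in> (\<Union>p\<in>E. D p)" "q \<noteq> q'"
      then obtain p p' where p: "p \<in> E" "p' \<in> E" "q \<in> D p" "q' \<in> D p'" by blast
      show "{fst q<..<snd q} \<inter> {fst q'<..<snd q'} = {}"
      proof (cases "p = p'")
        case True
        then show ?thesis using D[OF p(1)] p \<open>q \<noteq> q'\<close> unfolding interval_family_def disjoint_family_on_def by blast
      next
        case False
        then show ?thesis using disj p by blast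
      qed
    qed
    show "\<forall>p\<in>\<Union> (D ` E). x \<le> fst p \<and> fst p < snd p \<and> snd p \<le> y"
    proof
      fix q assume "q \<in> \<Union> (D ` E)"
      then obtain p where p: "p \<in> E" "q \<in> D p" by blast
      then show "x \<le> fst q \<and> fst q < snd q \<and> snd q \<le> y"
        using D[OF p(1)] E unfolding interval_family_def by (meson order_trans)
    qed
  qed (use finE finD in auto)
qed

text \<open>An interval straddling \<open>y\<close> is cut there, which cannot decrease the sum by
  the triangle inequality; every other interval goes to one side unchanged.\<close>

lemma interval_family_split:
  assumes D: "interval_family x z D" and y: "x \<le> y" "y \<le> z"
  obtains D1 D2 where "interval_family x y D1" "interval_family y z D2"
    "var_sum F D \<le> var_sum F D1 + var_sum F D2"
proof
  \<comment> \<open>The two sets overlap exactly in the straddling intervals; on all others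
    \<open>min\<close> and \<open>max\<close> change nothing.\<close>
  let ?A = "{p \<in> D. fst p < y}" and ?B = "{p \<in> D. y < snd p}"
  let ?f = "\<lambda>p. (fst p, min (snd p) y)" and ?g = "\<lambda>p. (max (fst p) y, snd p)"
  have D': "finite D" "\<And>p. p \<in> D \<Longrightarrow> x \<le> fst p \<and> fst p < snd p \<and> snd p \<le> z"
    using D by (auto simp: interval_family_def)
  have A: "interval_family x y (?f ` ?A)" "inj_on ?f ?A"
    by (rule interval_family_shrink[OF D, where x' = x and y' = y]; use D' y in force)+
  have B: "interval_family y z (?g ` ?B)" "inj_on ?g ?B"
    by (rule interval_family_shrink[OF D, where x' = y and y' = z]; use D' y in force)+
  show "interval_family x y (?f ` ?A)" "interval_family y z (?g ` ?B)" using A B by auto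
  let ?a = "\<lambda>p. if fst p < y then \<bar>F (min (snd p) y) - F (fst p)\<bar> else 0"
  let ?b = "\<lambda>p. if y < snd p then \<bar>F (snd p) - F (max (fst p) y)\<bar> else 0"
  have "var_sum F D \<le> (\<Sum>p\<in>D. ?a p + ?b p)"
    unfolding var_sum_def
  proof (rule sum_mono)
    fix p assume "p \<in> D"
    then show "\<bar>F (snd p) - F (fst p)\<bar> \<le> ?a p + ?b p"
      using D'(2)[of p] by (auto simp: min_def max_def)
  qed
  also have "\<dots> = (\<Sum>p\<in>?A. \<bar>F (min (snd p) y) - F (fst p)\<bar>) + (\<Sum>p\<in>?B. \<bar>F (snd p) - F (max (fst p) y)\<bar>)"
    using D'(1) by (simp add: sum.distrib sum.inter_filter)
  also have "\<dots> = var_sum F (?f ` ?A) + var_sum F (?g ` ?B)"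
    unfolding var_sum_def sum.reindex[OF A(2)] sum.reindex[OF B(2)] by simp
  finally show "var_sum F D \<le> var_sum F (?f ` ?A) + var_sum F (?g ` ?B)" .
qed

lemma interval_family_join:
  assumes D1: "interval_family x y D1" and D2: "interval_family y z D2" and y: "x \<le> y" "y \<le> z"
  shows "interval_family x z (D1 \<union> D2)" "var_sum F (D1 \<union> D2) = var_sum F D1 + var_sum F D2"
proof -
  have disj: "{fst p<..<snd p} \<inter> {fst q<..<snd q} = {} \<and> fst p < snd p" if "p \<in> D1" "q \<in> D2" for p q
    using D1 D2 that unfolding interval_family_def by (force simp: disjoint_iff)
  have "p \<noteq> q" if "p \<in> D1" "q \<in> D2" for p q
    using disj[OF that] dense by auto
  then have D12: "D1 \<inter> D2 = {}" by blast
  then show "var_sum F (D1 \<union> D2) = var_sum F D1 + var_sum F D2"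
    using D1 D2 unfolding var_sum_def interval_family_def by (intro sum.union_disjoint) auto
  have "disjoint_family_on (\<lambda>p. {fst p<..<snd p}) (D1 \<union> D2)"
    unfolding disjoint_family_on_def
  proof (intro ballI impI)
    fix p q assume "p \<in> D1 \<union> D2" "q \<in> D1 \<union> D2" "p \<noteq> q"
    then consider "p \<in> D1" "q \<in> D1" | "p \<in> D2" "q \<in> D2" | "p \<in> D1" "q \<in> D2" | "p \<in> D2" "q \<in> D1" by blast
    then show "{fst p<..<snd p} \<inter> {fst q<..<snd q} = {}"
    proof cases
      case 1
      then show ?thesis using D1 \<open>p \<noteq> q\<close> unfolding interval_family_def disjoint_family_on_def by blast
    next
      case 2
      then show ?thesis using D2 \<open>p \<noteq> q\<close> unfolding interval_family_def disjoint_family_on_def by blast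
    next
      case 3
      then show ?thesis using disj by blast
    next
      case 4
      then show ?thesis using disj[of q p] by blast
    qed
  qed
  then show "interval_family x z (D1 \<union> D2)"
    using interval_family_mono[OF D1 order_refl y(2)] interval_family_mono[OF D2 y(1) order_refl]
    unfolding interval_family_def by blast
qed

lemma sum_measure_interval_family:
  assumes D: "interval_family x y D"
  shows "(\<Sum>p\<in>D. snd p - fst p) = measure lborel (\<Union>p\<in>D. {fst p<..<snd p})"
proof -
  have "(\<Sum>p\<in>D. snd p - fst p) = (\<Sum>p\<in>D. measure lborel {fst p<..<snd p})"
    by (rule sum.cong) (use D in \<open>auto simp: interval_family_def\<close>)
  also have "\<dots> = measure lborel (\<Union>p\<in>D. {fst p<..<snd p})"
  proof (rule measure_finite_Union[symmetric])
    show "emeasure lborel {fst p<..<snd p} \<noteq> \<infinity>" if "p \<in> D" for p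
      using that D by (subst emeasure_lborel_Ioo) (auto simp: interval_family_def less_imp_le)
  qed (use D in \<open>auto simp: interval_family_def\<close>)
  finally show ?thesis .
qed

lemma interval_family_length_le:
  assumes D: "interval_family x y D" and "x \<le> y"
  shows "(\<Sum>p\<in>D. snd p - fst p) \<le> y - x"
proof -
  have "measure lborel (\<Union>p\<in>D. {fst p<..<snd p}) \<le> measure lborel {x..y}"
  proof (rule measure_mono_fmeasurable)
    show "(\<Union>p\<in>D. {fst p<..<snd p}) \<subseteq> {x..y}" using D by (force simp: interval_family_def)
    show "(\<Union>p\<in>D. {fst p<..<snd p}) \<in> sets lborel" by (simp add: open_UN)
    show "{x..y} \<in> fmeasurable lborel" by (simp add: fmeasurable_def emeasure_lborel_Icc_eq)
  qed
  then show ?thesis using \<open>x \<le> y\<close> sum_measure_interval_family[OF D] by simp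
qed

section \<open>Total variation of absolutely continuous functions\<close>

lemma var_sum_le_variation: "bounded_var F x y \<Longrightarrow> interval_family x y D \<Longrightarrow> var_sum F D \<le> variation F x y"
  unfolding variation_def bounded_var_def by (intro cSup_upper) auto

lemma variation_le: "(\<And>D. interval_family x y D \<Longrightarrow> var_sum F D \<le> c) \<Longrightarrow> variation F x y \<le> c"
  unfolding variation_def by (intro cSup_least) (auto intro: interval_family_empty)

lemma variation_approx:
  assumes "\<epsilon> > 0"
  obtains D where "interval_family x y D" "variation F x y < var_sum F D + \<epsilon>"
  using variation_le[of x y F "variation F x y - \<epsilon>"] assms by force

lemma bounded_var_subset: "bounded_var F x y \<Longrightarrow> x \<le> x' \<Longrightarrow> y' \<le> y \<Longrightarrow> bounded_var F x' y'"
  unfolding bounded_var_def by (erule bdd_above_mono) (use interval_family_mono in blast)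

lemma bounded_var_trans:
  assumes xy: "bounded_var F x y" and yz: "bounded_var F y z" and le: "x \<le> y" "y \<le> z"
  shows "bounded_var F x z" "variation F x z \<le> variation F x y + variation F y z"
proof -
  have *: "var_sum F D \<le> variation F x y + variation F y z" if D: "interval_family x z D" for D
  proof -
    obtain D1 D2 where D12: "interval_family x y D1" "interval_family y z D2" "var_sum F D \<le> var_sum F D1 + var_sum F D2"
      using interval_family_split[OF D le] by blast
    show ?thesis using var_sum_le_variation[OF xy D12(1)] var_sum_le_variation[OF yz D12(2)] D12(3) by linarith
  qed
  then show "bounded_var F x z" unfolding bounded_var_def by (intro bdd_aboveI2) auto
  show "variation F x z \<le> variation F x y + variation F y z" using * by (rule variation_le)
qed

lemma variation_superadditive:
  assumes "bounded_var F x z" and le: "x \<le> y" "y \<le> z"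
  shows "variation F x y + variation F y z \<le> variation F x z"
proof (rule field_le_epsilon)
  fix e :: real assume "e > 0"
  then have "e / 2 > 0" by simp
  obtain D1 where D1: "interval_family x y D1" "variation F x y < var_sum F D1 + e / 2"
    using variation_approx[OF \<open>e / 2 > 0\<close>] .
  obtain D2 where D2: "interval_family y z D2" "variation F y z < var_sum F D2 + e / 2"
    using variation_approx[OF \<open>e / 2 > 0\<close>] .
  show "variation F x y + variation F y z \<le> variation F x z + e"
    using var_sum_le_variation[OF assms(1) interval_family_join(1)[OF D1(1) D2(1) le]]
      interval_family_join(2)[OF D1(1) D2(1) le, of F] D1 D2 by linarith
qed

lemma abs_diff_le_variation:
  assumes "bounded_var F x y" "x \<le> y"
  shows "\<bar>F y - F x\<bar> \<le> variation F x y"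
proof (cases "x = y")
  case True
  then show ?thesis using var_sum_le_variation[OF assms(1) interval_family_empty] by (simp add: var_sum_def)
next
  case False
  then show ?thesis using var_sum_le_variation[OF assms(1) interval_family_singleton[of x x y y]] assms(2)
    by (simp add: var_sum_def)
qed

text \<open>On an interval shorter than the \<open>\<delta>\<close> belonging to 1 every sum is at
  most 1, so the variation is bounded locally, and bisection extends this to the whole
  interval.\<close>

lemma abs_cont_on_bounded_var:
  assumes "abs_cont_on a b F" "a \<le> b"
  shows "bounded_var F a b"
proof -
  obtain \<delta> where \<delta>: "\<delta> > 0"
    "\<And>D. interval_family a b D \<Longrightarrow> (\<Sum>p\<in>D. snd p - fst p) < \<delta> \<Longrightarrow> var_sum F D < 1"
    using abs_cont_on_interval_family[OF assms(1), of 1] by auto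
  have "a \<le> a \<and> b \<le> b \<longrightarrow> bounded_var F a b"
    using assms(2)
  proof (rule Bolzano[where P = "\<lambda>x y. a \<le> x \<and> y \<le> b \<longrightarrow> bounded_var F x y"])
    show "a \<le> x \<and> z \<le> b \<longrightarrow> bounded_var F x z"
      if "a \<le> x \<and> y \<le> b \<longrightarrow> bounded_var F x y" "a \<le> y \<and> z \<le> b \<longrightarrow> bounded_var F y z" "x \<le> y" "y \<le> z" for x y z
      using bounded_var_trans(1)[of F x y z] that by auto
    fix x
    have "bounded_var F c d" if "c \<le> x \<and> x \<le> d \<and> d - c < \<delta>" "a \<le> c" "d \<le> b" for c d
      unfolding bounded_var_def
    proof (rule bdd_aboveI2)
      fix D assume "D \<in> {D. interval_family c d D}"
      then show "var_sum F D \<le> 1"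
        using interval_family_length_le[of c d D] \<delta>(2)[of D] interval_family_mono[of c d D a b] that by force
    qed
    then show "\<exists>\<delta>>0. \<forall>c d. c \<le> x \<and> x \<le> d \<and> d - c < \<delta> \<longrightarrow> a \<le> c \<and> d \<le> b \<longrightarrow> bounded_var F c d"
      using \<delta>(1) by blast
  qed
  then show ?thesis by simp
qed

text \<open>Replacing each interval by a nearly optimal family inside it does not increase the total
  length, so the \<open>\<delta>\<close> that works for \<open>F\<close> also works for its
  variation.\<close>

lemma abs_cont_on_variation:
  assumes F: "abs_cont_on a b F" and "a \<le> b" "\<epsilon> > 0"
  obtains \<delta> where "\<delta> > 0"
    "\<And>D. interval_family a b D \<Longrightarrow> (\<Sum>p\<in>D. snd p - fst p) < \<delta> \<Longrightarrow>
       (\<Sum>p\<in>D. variation F (fst p) (snd p)) \<le> \<epsilon>"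
proof -
  obtain \<delta> where \<delta>: "\<delta> > 0"
    "\<And>D. interval_family a b D \<Longrightarrow> (\<Sum>p\<in>D. snd p - fst p) < \<delta> \<Longrightarrow> var_sum F D < \<epsilon>"
    using abs_cont_on_interval_family[OF F \<open>\<epsilon> > 0\<close>] by auto
  have "(\<Sum>p\<in>E. variation F (fst p) (snd p)) \<le> \<epsilon>"
    if E: "interval_family a b E" and lenE: "(\<Sum>p\<in>E. snd p - fst p) < \<delta>" for E
  proof (rule field_le_epsilon)
    fix \<eta> :: real assume "\<eta> > 0"
    \<comment> \<open>The slack \<open>\<eta>\<close> is divided among the members of
      \<open>E\<close>; the added 1 covers the empty family.\<close>
    define c where "c = \<eta> / (card E + 1)"
    have "c > 0" using \<open>\<eta> > 0\<close> by (simp add: c_def)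
    have "\<forall>p. \<exists>D. interval_family (fst p) (snd p) D \<and> variation F (fst p) (snd p) < var_sum F D + c"
      using variation_approx[OF \<open>c > 0\<close>] by metis
    then obtain D where D: "\<And>p. interval_family (fst p) (snd p) (D p)"
      "\<And>p. variation F (fst p) (snd p) < var_sum F (D p) + c" by metis
    have "(\<Sum>p\<in>E. variation F (fst p) (snd p)) \<le> (\<Sum>p\<in>E. var_sum F (D p) + c)"
      using D(2) by (intro sum_mono) (auto intro: less_imp_le)
    also have "\<dots> = var_sum F (\<Union>p\<in>E. D p) + card E * c"
      using interval_family_UN(2)[OF E D(1)] by (simp add: var_sum_def sum.distrib)
    also have "var_sum F (\<Union>p\<in>E. D p) < \<epsilon>"
    proof (rule \<delta>(2)[OF interval_family_UN(1)[OF E D(1)]])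
      have "(\<Sum>q\<in>(\<Union>p\<in>E. D p). snd q - fst q) = (\<Sum>p\<in>E. \<Sum>q\<in>D p. snd q - fst q)"
        by (rule interval_family_UN(2)[OF E D(1)])
      also have "\<dots> \<le> (\<Sum>p\<in>E. snd p - fst p)"
        by (rule sum_mono) (use E D(1) interval_family_length_le in \<open>auto simp: interval_family_def less_imp_le\<close>)
      finally show "(\<Sum>q\<in>(\<Union>p\<in>E. D p). snd q - fst q) < \<delta>" using lenE by simp
    qed
    also have "card E * c \<le> \<eta>" using \<open>\<eta> > 0\<close> by (simp add: c_def field_simps)
    finally show "(\<Sum>p\<in>E. variation F (fst p) (snd p)) \<le> \<epsilon> + \<eta>" by simp
  qed
  then show thesis using \<delta>(1) that by blast
qed

section \<open>Absolutely continuous functions as indefinite integrals\<close>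

text \<open>Connects the nonoverlapping closed intervals delivered by \<open>covering_lemma\<close>,
  which may share endpoints, with families of disjoint open ones. \<open>Inf\<close> and
  \<open>Sup\<close> recover the endpoints.\<close>

lemma interval_family_of_intervals:
  fixes I :: "real set set"
  assumes "finite I" and I: "\<And>K. K \<in> I \<Longrightarrow> \<exists>c d. c < d \<and> K = {c..d}"
    and disj: "pairwise (\<lambda>A B. interior A \<inter> interior B = {}) I" and sub: "\<Union>I \<subseteq> {x..y}"
  shows "interval_family x y ((\<lambda>K. (Inf K, Sup K)) ` I)" "inj_on (\<lambda>K. (Inf K, Sup K)) I"
    "\<And>K. K \<in> I \<Longrightarrow> {Inf K<..<Sup K} \<subseteq> K"
proof -
  have K: "Inf K < Sup K \<and> {Inf K..Sup K} = K \<and> interior K = {Inf K<..<Sup K} \<and> x \<le> Inf K \<and> Sup K \<le> y"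
    if "K \<in> I" for K
  proof -
    obtain c d where cd: "c < d" "K = {c..d}" using I[OF \<open>K \<in> I\<close>] by blast
    moreover have "K \<subseteq> {x..y}" using sub \<open>K \<in> I\<close> by blast
    ultimately show ?thesis by simp
  qed
  show inj: "inj_on (\<lambda>K. (Inf K, Sup K)) I"
  proof (rule inj_onI)
    fix A B assume AB: "A \<in> I" "B \<in> I" "(Inf A, Sup A) = (Inf B, Sup B)"
    have "A = {Inf A..Sup A}" using K[OF AB(1)] by blast
    also have "\<dots> = {Inf B..Sup B}" using AB(3) by (metis prod.inject)
    also have "\<dots> = B" using K[OF AB(2)] by blast
    finally show "A = B" .
  qed
  show "\<And>K. K \<in> I \<Longrightarrow> {Inf K<..<Sup K} \<subseteq> K"
  proof -
    fix A assume "A \<in> I"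
    then have "interior A = {Inf A<..<Sup A}" using K by blast
    then show "{Inf A<..<Sup A} \<subseteq> A" using interior_subset[of A] by blast
  qed
  show "interval_family x y ((\<lambda>K. (Inf K, Sup K)) ` I)"
    unfolding interval_family_def
  proof (intro conjI)
    show "disjoint_family_on (\<lambda>p. {fst p<..<snd p}) ((\<lambda>K. (Inf K, Sup K)) ` I)"
      unfolding disjoint_family_on_def
    proof (intro ballI impI)
      fix p q assume "p \<in> (\<lambda>K. (Inf K, Sup K)) ` I" "q \<in> (\<lambda>K. (Inf K, Sup K)) ` I" "p \<noteq> q"
      then obtain A B where AB: "A \<in> I" "B \<in> I" "p = (Inf A, Sup A)" "q = (Inf B, Sup B)" "A \<noteq> B" by blast
      then have "interior A \<inter> interior B = {}" using disj unfolding pairwise_def by blast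
      moreover have "interior A = {fst p<..<snd p}" "interior B = {fst q<..<snd q}" using K AB by simp_all
      ultimately show "{fst p<..<snd p} \<inter> {fst q<..<snd q} = {}" by metis
    qed
    show "\<forall>p\<in>(\<lambda>K. (Inf K, Sup K)) ` I. x \<le> fst p \<and> fst p < snd p \<and> snd p \<le> y"
    proof
      fix p assume "p \<in> (\<lambda>K. (Inf K, Sup K)) ` I"
      then obtain A where "A \<in> I" "p = (Inf A, Sup A)" by blast
      then show "x \<le> fst p \<and> fst p < snd p \<and> snd p \<le> y" using K[OF \<open>A \<in> I\<close>] by simp
    qed
  qed (use \<open>finite I\<close> in blast)
qed

text \<open>The Stieltjes measure of \<open>G\<close> vanishes on Lebesgue null sets, and
  \<open>g\<close> is its Radon-Nikodym density. A null set has an open superset of small length;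
  nonoverlapping intervals inside it cover the null set, and absolute continuity bounds the
  increments over any finitely many of them.\<close>

lemma mono_abs_cont_has_density:
  fixes G :: "real \<Rightarrow> real"
  assumes "a \<le> b"
    and mono: "\<And>x y. a \<le> x \<Longrightarrow> x \<le> y \<Longrightarrow> y \<le> b \<Longrightarrow> G x \<le> G y"
    and ac: "\<And>\<epsilon>. \<epsilon> > 0 \<Longrightarrow> \<exists>\<delta>>0. \<forall>D. interval_family a b D \<longrightarrow> (\<Sum>p\<in>D. snd p - fst p) < \<delta> \<longrightarrow>
              (\<Sum>p\<in>D. G (snd p) - G (fst p)) \<le> \<epsilon>"
  obtains g where "set_integrable lborel {a..b} g"
    "\<And>s t. a \<le> s \<Longrightarrow> s \<le> t \<Longrightarrow> t \<le> b \<Longrightarrow> G t - G s = (LBINT x:{s..t}. g x)"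
proof -
  \<comment> \<open>Constant continuation beyond the endpoints, since the Stieltjes measure is built
    from a function on the whole line.\<close>
  define H where "H x = G (max a (min b x))" for x
  have H_G: "H x = G x" if "a \<le> x" "x \<le> b" for x using that by (simp add: H_def)
  have H_mono: "H x \<le> H y" if "x \<le> y" for x y
    unfolding H_def using that \<open>a \<le> b\<close> by (intro mono) auto
  have H_ac: "\<exists>\<delta>>0. \<forall>x y D. interval_family x y D \<longrightarrow> (\<Sum>p\<in>D. snd p - fst p) < \<delta> \<longrightarrow>
              (\<Sum>p\<in>D. H (snd p) - H (fst p)) \<le> \<epsilon>" if eps: "\<epsilon> > 0" for \<epsilon>
  proof -
    obtain \<delta> where \<delta>: "\<delta> > 0" "\<And>D. interval_family a b D \<Longrightarrow> (\<Sum>p\<in>D. snd p - fst p) < \<delta> \<Longrightarrow>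
              (\<Sum>p\<in>D. G (snd p) - G (fst p)) \<le> \<epsilon>" using ac[OF eps] by blast
    have "(\<Sum>p\<in>D. H (snd p) - H (fst p)) \<le> \<epsilon>"
      if D: "interval_family x y D" and len: "(\<Sum>p\<in>D. snd p - fst p) < \<delta>" for x y D
    proof -
      \<comment> \<open>Only intervals that meet (a, b) matter, and they are cut to [a, b]; over all
        others \<open>H\<close> has increment zero.\<close>
      let ?A = "{p \<in> D. max a (fst p) < min b (snd p)}"
      let ?f = "\<lambda>p. (max a (fst p), min b (snd p))"
      have D': "finite D" "\<And>p. p \<in> D \<Longrightarrow> fst p < snd p" using D by (auto simp: interval_family_def)
      have f: "a \<le> fst (?f p) \<and> fst (?f p) < snd (?f p) \<and> snd (?f p) \<le> b \<and>
              fst p \<le> fst (?f p) \<and> snd (?f p) \<le> snd p" if "p \<in> ?A" for p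
        using that by auto
      note sh = interval_family_shrink[OF D, where A = ?A and f = ?f and x' = a and y' = b]
      have fam: "interval_family a b (?f ` ?A)" by (rule sh(1)) (use f in blast)+
      have inj: "inj_on ?f ?A" by (rule sh(2)) (use f in blast)+
      have "(\<Sum>p\<in>D. H (snd p) - H (fst p)) = (\<Sum>p\<in>?A. H (snd p) - H (fst p))"
      proof (rule sum.mono_neutral_right)
        show "\<forall>i\<in>D - ?A. H (snd i) - H (fst i) = 0"
        proof
          fix p assume p: "p \<in> D - ?A"
          then have "fst p < snd p" "min b (snd p) \<le> max a (fst p)" using D'(2) by auto
          then have "max a (min b (snd p)) = max a (min b (fst p))" using \<open>a \<le> b\<close> by linarith
          then show "H (snd p) - H (fst p) = 0" by (simp add: H_def)
        qed
      qed (use D' in auto)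
      also have "\<dots> = (\<Sum>p\<in>?A. G (snd (?f p)) - G (fst (?f p)))"
      proof (rule sum.cong[OF refl])
        fix p assume "p \<in> ?A"
        then have "max a (min b (snd p)) = min b (snd p)" "max a (min b (fst p)) = max a (fst p)" by auto
        then show "H (snd p) - H (fst p) = G (snd (?f p)) - G (fst (?f p))" by (simp add: H_def)
      qed
      also have "\<dots> = (\<Sum>p\<in>?f ` ?A. G (snd p) - G (fst p))"
        by (subst sum.reindex[OF inj]) (simp add: comp_def)
      also have "\<dots> \<le> \<epsilon>"
      proof (rule \<delta>(2)[OF fam])
        have "(\<Sum>p\<in>?f ` ?A. snd p - fst p) = (\<Sum>p\<in>?A. snd (?f p) - fst (?f p))"
          by (subst sum.reindex[OF inj]) (simp add: comp_def)
        also have "\<dots> \<le> (\<Sum>p\<in>?A. snd p - fst p)"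
          using f by (intro sum_mono) (smt (verit))
        also have "\<dots> \<le> (\<Sum>p\<in>D. snd p - fst p)"
          by (rule sum_mono2) (use D' less_imp_le in force)+
        finally show "(\<Sum>p\<in>?f ` ?A. snd p - fst p) < \<delta>" using len by simp
      qed
      finally show ?thesis .
    qed
    then show ?thesis using \<delta>(1) by blast
  qed
  have H_cont: "continuous_on UNIV H"
    unfolding continuous_on_iff
  proof (intro ballI allI impI)
    fix x e :: real assume "e > 0"
    then have "e / 2 > 0" by simp
    from H_ac[OF this] obtain \<delta> where \<delta>: "\<delta> > 0" "\<forall>x y D. interval_family x y D \<longrightarrow> (\<Sum>p\<in>D. snd p - fst p) < \<delta> \<longrightarrow>
              (\<Sum>p\<in>D. H (snd p) - H (fst p)) \<le> e / 2" by (elim exE conjE)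
    have *: "H t - H s \<le> e / 2" if "s < t" "t - s < \<delta>" for s t
      using \<delta>(2)[rule_format, OF interval_family_singleton[of s s t t]] that by simp
    have "dist (H x') (H x) < e" if "dist x' x < \<delta>" for x'
      using *[of x x'] *[of x' x] H_mono[of x x'] H_mono[of x' x] that \<open>e > 0\<close>
      by (cases x x' rule: linorder_cases) (auto simp: dist_real_def)
    then show "\<exists>d>0. \<forall>x'\<in>UNIV. dist x' x < d \<longrightarrow> dist (H x') (H x) < e" using \<delta>(1) by blast
  qed
  define M where "M = interval_measure H"
  have M_Icc: "emeasure M {s..t} = ennreal (H t - H s)" if "s \<le> t" for s t
    unfolding M_def by (rule emeasure_interval_measure_Icc[OF that H_mono H_cont])
  have sets_M: "sets M = sets borel" by (simp add: M_def)
  have "N \<in> null_sets M" if N: "N \<in> null_sets lborel" for N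
  proof -
    \<comment> \<open>The covering lemma works inside a bounded box, hence the restriction to
      bounded pieces of \<open>N\<close>.\<close>
    have "emeasure M (N \<inter> {-real n..real n}) = 0" for n
    proof (rule ccontr)
      let ?S = "N \<inter> {-real n..real n}"
      assume ne: "emeasure M ?S \<noteq> 0"
      have Nb: "N \<in> sets borel" using N by auto
      obtain e where e: "e > 0" "ennreal e < emeasure M ?S"
      proof (cases "emeasure M ?S")
        case (real r)
        then have "r > 0" using ne by (cases "r = 0") auto
        with real show ?thesis by (intro that[of "r / 2"]) (auto simp: ennreal_less_iff)
      next
        case top
        then show ?thesis by (intro that[of 1]) auto
      qed
      from H_ac[OF e(1)] obtain \<delta> where \<delta>: "\<delta> > 0" "\<forall>x y D. interval_family x y D \<longrightarrow> (\<Sum>p\<in>D. snd p - fst p) < \<delta> \<longrightarrow>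
              (\<Sum>p\<in>D. H (snd p) - H (fst p)) \<le> e" by (elim exE conjE)
      obtain U where U: "open U" "N \<subseteq> U" "emeasure lebesgue (U - N) < ennreal \<delta>" "U - N \<in> lmeasurable"
        using sets_lebesgue_outer_open[of N \<delta>] Nb \<delta>(1) by auto
      have Nl: "N \<in> null_sets lebesgue" using N by (rule null_sets_completionI)
      have "emeasure lebesgue U = emeasure lebesgue (U - N)"
        using Nl U by (simp add: emeasure_Diff_null_set)
      then have eU: "emeasure lborel U < ennreal \<delta>" using U by simp
      then have U_fm: "U \<in> fmeasurable lborel" using U(1) by (auto simp: fmeasurable_def intro: order.strict_trans)
      then have mU: "measure lborel U < \<delta>"
        using eU \<delta>(1) by (simp add: emeasure_eq_measure2 ennreal_less_iff)
      \<comment> \<open>Each covering interval is tagged by a point of the null set, where the gauge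
        equals \<open>U\<close>; this forces the intervals to stay inside \<open>U\<close>.\<close>
      define \<gamma> where "\<gamma> x = (if x \<in> U then U else UNIV)" for x
      have "gauge \<gamma>" using U by (auto simp: gauge_def \<gamma>_def)
      have Ssub: "?S \<subseteq> cbox (-real (Suc n)) (real (Suc n))" by auto
      have box: "box (-real (Suc n)) (real (Suc n)) \<noteq> {}" by simp
      obtain \<D> where \<D>: "countable \<D>"
        "\<And>K. K \<in> \<D> \<Longrightarrow> interior K \<noteq> {} \<and> (\<exists>c d. K = cbox c d)"
        "pairwise (\<lambda>A B. interior A \<inter> interior B = {}) \<D>"
        "\<And>K. K \<in> \<D> \<Longrightarrow> \<exists>x \<in> ?S \<inter> K. K \<subseteq> \<gamma> x" "?S \<subseteq> \<Union>\<D>" "\<Union>\<D> \<subseteq> cbox (-real (Suc n)) (real (Suc n))"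
        using covering_lemma[OF Ssub box \<open>gauge \<gamma>\<close>] by metis
      have KU: "K \<subseteq> U" if "K \<in> \<D>" for K
        using \<D>(4)[OF that] U(2) by (auto simp: \<gamma>_def split: if_splits)
      have Kform: "K = {Inf K..Sup K} \<and> Inf K < Sup K" if KD: "K \<in> \<D>" for K
      proof -
        obtain c d where K: "K = {c..d}" "interior K \<noteq> {}" using \<D>(2)[OF KD] by (auto simp: cbox_interval)
        then have "c < d" by auto
        then show ?thesis using K by simp
      qed
      have K_fm: "K \<in> fmeasurable M" if "K \<in> \<D>" for K
      proof -
        have "Inf K \<le> Sup K" using Kform[OF that] by simp
        then have "{Inf K..Sup K} \<in> fmeasurable M" by (simp add: fmeasurable_def sets_M M_Icc)
        then show ?thesis by (subst Kform[OF that, THEN conjunct1])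
      qed
      have bd: "measure M (\<Union>I) \<le> e" if I: "I \<subseteq> \<D>" "finite I" for I
      proof -
        let ?p = "\<lambda>K. (Inf K, Sup K) :: real \<times> real"
        have I': "\<exists>c d. c < d \<and> K = {c..d}" if "K \<in> I" for K using Kform I(1) that by blast
        have "pairwise (\<lambda>A B. interior A \<inter> interior B = {}) I" using \<D>(3) I(1) pairwise_subset by blast
        moreover have "\<Union>I \<subseteq> {-real (Suc n)..real (Suc n)}" using \<D>(6) I(1) unfolding cbox_interval by blast
        ultimately have fam: "interval_family (-real (Suc n)) (real (Suc n)) (?p ` I)"
          and inj: "inj_on ?p I" and int: "\<And>K. K \<in> I \<Longrightarrow> {Inf K<..<Sup K} \<subseteq> K"
          using interval_family_of_intervals[OF I(2) I'] by auto
        have "measure M (\<Union>I) = measure M (\<Union>K\<in>I. K)" by simp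
        also have "\<dots> \<le> (\<Sum>K\<in>I. measure M K)"
          by (rule measure_UNION_le) (use I K_fm in \<open>auto simp: fmeasurable_def\<close>)
        also have "\<dots> = (\<Sum>K\<in>I. H (Sup K) - H (Inf K))"
        proof (rule sum.cong[OF refl])
          fix K assume "K \<in> I"
          then have "K \<in> \<D>" using I by auto
          have "measure M {Inf K..Sup K} = H (Sup K) - H (Inf K)"
            using Kform[OF \<open>K \<in> \<D>\<close>, THEN conjunct2] M_Icc[of "Inf K" "Sup K"] H_mono[of "Inf K" "Sup K"]
            by (simp add: measure_def)
          then show "measure M K = H (Sup K) - H (Inf K)"
            by (rule subst[where P = "\<lambda>A. measure M A = _", OF Kform[OF \<open>K \<in> \<D>\<close>, THEN conjunct1, symmetric]])
        qed
        also have "\<dots> = (\<Sum>p\<in>?p ` I. H (snd p) - H (fst p))"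
          by (subst sum.reindex[OF inj]) simp
        also have "\<dots> \<le> e"
        proof (rule \<delta>(2)[rule_format, OF fam])
          have "(\<Sum>p\<in>?p ` I. snd p - fst p) = measure lborel (\<Union>p\<in>?p ` I. {fst p<..<snd p})"
            by (rule sum_measure_interval_family[OF fam])
          also have "\<dots> \<le> measure lborel U"
          proof (rule measure_mono_fmeasurable)
            have "{Inf K<..<Sup K} \<subseteq> U" if "K \<in> I" for K
              using KU[of K] int[of K] that I by blast
            then show "(\<Union>p\<in>?p ` I. {fst p<..<snd p}) \<subseteq> U" by fastforce
            show "(\<Union>p\<in>?p ` I. {fst p<..<snd p}) \<in> sets lborel" by (simp add: open_UN)
          qed (rule U_fm)
          finally show "(\<Sum>p\<in>?p ` I. snd p - fst p) < \<delta>" using mU by simp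
        qed
        finally show ?thesis .
      qed
      have bd': "measure M (\<Union>K\<in>I. K) \<le> e" if "I \<subseteq> \<D>" "finite I" for I using bd[OF that] by simp
      have D_fm: "(\<Union>K\<in>\<D>. K) \<in> fmeasurable M" by (rule fmeasurable_UN_bound[OF \<D>(1) K_fm bd'])
      have "measure M (\<Union>K\<in>\<D>. K) \<le> e" by (rule measure_UN_bound[OF \<D>(1) K_fm bd'])
      then have "emeasure M (\<Union>K\<in>\<D>. K) \<le> ennreal e"
        unfolding emeasure_eq_measure2[OF D_fm] by (rule ennreal_leI)
      moreover have "emeasure M ?S \<le> emeasure M (\<Union>K\<in>\<D>. K)"
        using \<D>(5) D_fm by (intro emeasure_mono) auto
      ultimately have "emeasure M ?S \<le> ennreal e" by (rule order_trans[rotated])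
      then show False using e by simp
    qed
    moreover have "N = (\<Union>n. N \<inter> {-real n..real n})"
    proof -
      have "\<exists>n. x \<in> {-real n..real n}" for x
        using real_arch_simple[of "\<bar>x\<bar>"] by (simp add: abs_le_iff) (metis minus_le_iff)
      then show ?thesis by blast
    qed
    moreover have "N \<inter> {-real n..real n} \<in> sets M" for n using N by (auto simp: sets_M)
    ultimately have "(\<Union>n. N \<inter> {-real n..real n}) \<in> null_sets M"
      by (intro null_sets_UN) (auto simp: null_sets_def)
    then show ?thesis using \<open>N = (\<Union>n. N \<inter> {-real n..real n})\<close> by simp
  qed
  then have "absolutely_continuous lborel M" by (auto simp: absolutely_continuous_def)
  then obtain f where f: "f \<in> borel_measurable lborel" "density lborel f = M"
    using sigma_finite_measure.Radon_Nikodym[OF sigma_finite_lborel, of M] sets_M by auto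
  have [measurable]: "f \<in> borel_measurable borel" using f by simp
  have f_int: "(\<integral>\<^sup>+x. f x * indicator {s..t} x \<partial>lborel) = ennreal (H t - H s)" if "s \<le> t" for s t
    using M_Icc[OF that] emeasure_density[OF f(1), of "{s..t}"] f(2) by simp
  have fin: "AE x in lborel. f x * indicator {a..b} x \<noteq> \<infinity>"
    by (rule nn_integral_PInf_AE) (use f_int[OF \<open>a \<le> b\<close>] in auto)
  \<comment> \<open>The density may be infinite on a null subset of [a, b]; \<open>enn2real\<close>
    puts the value 0 there.\<close>
  define g where "g x = enn2real (f x)" for x
  have [measurable]: "g \<in> borel_measurable borel" unfolding g_def[abs_def] by measurable
  have ind: "(\<integral>\<^sup>+x. ennreal (indicator {s..t} x * g x) \<partial>lborel) = ennreal (H t - H s)"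
    if "a \<le> s" "s \<le> t" "t \<le> b" for s t
  proof -
    have "(\<integral>\<^sup>+x. ennreal (indicator {s..t} x * g x) \<partial>lborel) = (\<integral>\<^sup>+x. f x * indicator {s..t} x \<partial>lborel)"
      using fin by (intro nn_integral_cong_AE, eventually_elim)
        (use that in \<open>auto simp: g_def indicator_def less_top split: if_splits\<close>)
    then show ?thesis using f_int[OF that(2)] by simp
  qed
  have gi: "set_integrable lborel {a..b} g"
    unfolding set_integrable_def
    by (rule integrableI_nonneg) (use ind[OF order_refl \<open>a \<le> b\<close>] in \<open>auto simp: g_def\<close>)
  moreover have "G t - G s = (LBINT x:{s..t}. g x)" if "a \<le> s" "s \<le> t" "t \<le> b" for s t
  proof -
    have "(LBINT x:{s..t}. g x) = enn2real (\<integral>\<^sup>+x. ennreal (indicator {s..t} x * g x) \<partial>lborel)"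
      unfolding set_lebesgue_integral_def real_scaleR_def
      by (rule integral_eq_nn_integral) (auto simp: g_def)
    also have "\<dots> = H t - H s" using ind[OF that] H_mono[OF that(2)] by simp
    finally show ?thesis using H_G that by simp
  qed
  ultimately show thesis by (rule that)
qed

text \<open>Jordan decomposition: with V the variation from \<open>a\<close>, both V + F and V - F
  are nondecreasing, and their increments are at most twice the variation, so both are absolutely
  continuous. Half the difference of their densities is the density of \<open>F\<close>.\<close>

lemma abs_cont_on_has_density:
  fixes F :: "real \<Rightarrow> real"
  assumes F: "abs_cont_on a b F" and "a \<le> b"
  obtains g where "set_integrable lborel {a..b} g"
    "\<And>s t. a \<le> s \<Longrightarrow> s \<le> t \<Longrightarrow> t \<le> b \<Longrightarrow> F t - F s = (LBINT x:{s..t}. g x)"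
proof -
  note bv = abs_cont_on_bounded_var[OF F \<open>a \<le> b\<close>]
  define V where "V x = variation F a x" for x
  have V_le: "V t - V s \<le> variation F s t" and V_ge: "\<bar>F t - F s\<bar> \<le> V t - V s"
    if "a \<le> s" "s \<le> t" "t \<le> b" for s t
  proof -
    have b1: "bounded_var F a s" "bounded_var F s t" "bounded_var F a t"
      using bounded_var_subset[OF bv] that by auto
    show "V t - V s \<le> variation F s t"
      using bounded_var_trans(2)[OF b1(1,2) that(1,2)] by (simp add: V_def)
    show "\<bar>F t - F s\<bar> \<le> V t - V s"
      using variation_superadditive[OF b1(3) that(1,2)] abs_diff_le_variation[OF b1(2) that(2)]
      by (simp add: V_def)
  qed
  have dens: "\<exists>g. set_integrable lborel {a..b} g \<and> (\<forall>s t. a \<le> s \<longrightarrow> s \<le> t \<longrightarrow> t \<le> b \<longrightarrow>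
        (V t + c * F t) - (V s + c * F s) = (LBINT x:{s..t}. g x))" if c: "c = 1 \<or> c = -1" for c
  proof -
    obtain g where "set_integrable lborel {a..b} g"
      "\<And>s t. a \<le> s \<Longrightarrow> s \<le> t \<Longrightarrow> t \<le> b \<Longrightarrow> (V t + c * F t) - (V s + c * F s) = (LBINT x:{s..t}. g x)"
    proof (rule mono_abs_cont_has_density[OF \<open>a \<le> b\<close>, of "\<lambda>x. V x + c * F x"])
      fix x y assume "a \<le> x" "x \<le> y" "y \<le> b"
      then show "V x + c * F x \<le> V y + c * F y" using V_ge[of x y] c by auto
    next
      fix \<epsilon> :: real assume "\<epsilon> > 0"
      then have "\<epsilon> / 2 > 0" by simp
      then obtain \<delta> where \<delta>: "\<delta> > 0" "\<And>D. interval_family a b D \<Longrightarrow> (\<Sum>p\<in>D. snd p - fst p) < \<delta> \<Longrightarrow>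
        (\<Sum>p\<in>D. variation F (fst p) (snd p)) \<le> \<epsilon> / 2"
        using abs_cont_on_variation[OF F \<open>a \<le> b\<close>] by blast
      have "(\<Sum>p\<in>D. (V (snd p) + c * F (snd p)) - (V (fst p) + c * F (fst p))) \<le> \<epsilon>"
        if D: "interval_family a b D" "(\<Sum>p\<in>D. snd p - fst p) < \<delta>" for D
      proof -
        have "(\<Sum>p\<in>D. (V (snd p) + c * F (snd p)) - (V (fst p) + c * F (fst p))) \<le>
              (\<Sum>p\<in>D. 2 * variation F (fst p) (snd p))"
        proof (rule sum_mono)
          fix p assume "p \<in> D"
          then have "a \<le> fst p" "fst p \<le> snd p" "snd p \<le> b" using D by (auto simp: interval_family_def less_imp_le)
          then show "(V (snd p) + c * F (snd p)) - (V (fst p) + c * F (fst p)) \<le> 2 * variation F (fst p) (snd p)"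
            using V_le[of "fst p" "snd p"] V_ge[of "fst p" "snd p"] c by auto
        qed
        also have "\<dots> \<le> \<epsilon>" using \<delta>(2)[OF D] by (simp add: sum_distrib_left[symmetric])
        finally show ?thesis .
      qed
      then show "\<exists>\<delta>>0. \<forall>D. interval_family a b D \<longrightarrow> (\<Sum>p\<in>D. snd p - fst p) < \<delta> \<longrightarrow>
              (\<Sum>p\<in>D. (V (snd p) + c * F (snd p)) - (V (fst p) + c * F (fst p))) \<le> \<epsilon>"
        using \<delta>(1) by blast
    qed (rule that)
    then show ?thesis by blast
  qed
  obtain g1 where g1: "set_integrable lborel {a..b} g1"
    "\<And>s t. a \<le> s \<Longrightarrow> s \<le> t \<Longrightarrow> t \<le> b \<Longrightarrow> (V t + F t) - (V s + F s) = (LBINT x:{s..t}. g1 x)"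
    using dens[of 1] by auto
  obtain g2 where g2: "set_integrable lborel {a..b} g2"
    "\<And>s t. a \<le> s \<Longrightarrow> s \<le> t \<Longrightarrow> t \<le> b \<Longrightarrow> (V t - F t) - (V s - F s) = (LBINT x:{s..t}. g2 x)"
    using dens[of "-1"] by auto
  show thesis
  proof
    have i: "set_integrable lborel {s..t} (\<lambda>x. g1 x / 2)" "set_integrable lborel {s..t} (\<lambda>x. g2 x / 2)"
      if "a \<le> s" "t \<le> b" for s t
      using set_integrable_subset[OF g1(1), of "{s..t}"] set_integrable_subset[OF g2(1), of "{s..t}"] that by auto
    show "set_integrable lborel {a..b} (\<lambda>x. g1 x / 2 - g2 x / 2)"
      using i[of a b] by (intro set_integral_diff) auto
    show "F t - F s = (LBINT x:{s..t}. g1 x / 2 - g2 x / 2)" if "a \<le> s" "s \<le> t" "t \<le> b" for s t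
      using g1(2)[OF that] g2(2)[OF that] by (subst set_integral_diff(2)) (use i that in \<open>auto simp: field_simps\<close>)
  qed
qed

section \<open>Stability properties of absolute continuity\<close>

lemma abs_cont_on_diff_bound:
  assumes f: "abs_cont_on a b f" and g: "abs_cont_on a b g"
    and le: "\<And>s t. a \<le> s \<Longrightarrow> s \<le> t \<Longrightarrow> t \<le> b \<Longrightarrow> \<bar>h t - h s\<bar> \<le> M * (\<bar>f t - f s\<bar> + \<bar>g t - g s\<bar>)"
  shows "abs_cont_on a b h"
  unfolding abs_cont_on_def
proof (intro allI impI)
  fix \<epsilon> :: real assume "\<epsilon> > 0"
  \<comment> \<open>At least 1, so that dividing by it is legitimate whatever the sign of
    \<open>M\<close>.\<close>
  define M' where "M' = max M 1"
  define e where "e = \<epsilon> / (2 * M')"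
  have "M' > 0" by (simp add: M'_def)
  then have "e > 0" using \<open>\<epsilon> > 0\<close> by (simp add: e_def)
  from f[unfolded abs_cont_on_def, rule_format, OF this]
  obtain \<delta>1 where \<delta>1: "\<delta>1 > 0" and *: "\<forall>(m::nat) s t.
     (\<forall>i<m. a \<le> s i \<and> s i < t i \<and> t i \<le> b) \<and>
     disjoint_family_on (\<lambda>i. {s i <..< t i}) {..<m} \<and>
     (\<Sum>i<m. t i - s i) < \<delta>1 \<longrightarrow> (\<Sum>i<m. \<bar>f (t i) - f (s i)\<bar>) < e"
    by (elim exE conjE)
  from g[unfolded abs_cont_on_def, rule_format, OF \<open>e > 0\<close>]
  obtain \<delta>2 where \<delta>2: "\<delta>2 > 0" and **: "\<forall>(m::nat) s t.
     (\<forall>i<m. a \<le> s i \<and> s i < t i \<and> t i \<le> b) \<and>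
     disjoint_family_on (\<lambda>i. {s i <..< t i}) {..<m} \<and>
     (\<Sum>i<m. t i - s i) < \<delta>2 \<longrightarrow> (\<Sum>i<m. \<bar>g (t i) - g (s i)\<bar>) < e"
    by (elim exE conjE)
  show "\<exists>\<delta>>0. \<forall>(m::nat) s t.
     (\<forall>i<m. a \<le> s i \<and> s i < t i \<and> t i \<le> b) \<and>
     disjoint_family_on (\<lambda>i. {s i <..< t i}) {..<m} \<and>
     (\<Sum>i<m. t i - s i) < \<delta> \<longrightarrow> (\<Sum>i<m. \<bar>h (t i) - h (s i)\<bar>) < \<epsilon>"
  proof (rule exI[of _ "min \<delta>1 \<delta>2"], intro conjI allI impI)
    fix m :: nat and s t assume H: "(\<forall>i<m. a \<le> s i \<and> s i < t i \<and> t i \<le> b) \<and>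
     disjoint_family_on (\<lambda>i. {s i <..< t i}) {..<m} \<and> (\<Sum>i<m. t i - s i) < min \<delta>1 \<delta>2"
    have "(\<Sum>i<m. \<bar>h (t i) - h (s i)\<bar>) \<le> (\<Sum>i<m. M' * (\<bar>f (t i) - f (s i)\<bar> + \<bar>g (t i) - g (s i)\<bar>))"
    proof (rule sum_mono)
      fix i assume "i \<in> {..<m}"
      then have "\<bar>h (t i) - h (s i)\<bar> \<le> M * (\<bar>f (t i) - f (s i)\<bar> + \<bar>g (t i) - g (s i)\<bar>)"
        using H by (intro le) (auto simp: less_imp_le)
      also have "\<dots> \<le> M' * (\<bar>f (t i) - f (s i)\<bar> + \<bar>g (t i) - g (s i)\<bar>)"
        by (rule mult_right_mono) (auto simp: M'_def)
      finally show "\<bar>h (t i) - h (s i)\<bar> \<le> M' * (\<bar>f (t i) - f (s i)\<bar> + \<bar>g (t i) - g (s i)\<bar>)" .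
    qed
    also have "\<dots> = M' * ((\<Sum>i<m. \<bar>f (t i) - f (s i)\<bar>) + (\<Sum>i<m. \<bar>g (t i) - g (s i)\<bar>))"
      unfolding sum_distrib_left[symmetric] sum.distrib ..
    also have "\<dots> < M' * (e + e)"
      using *[rule_format, of m s t] **[rule_format, of m s t] H \<open>M' > 0\<close>
      by (intro mult_strict_left_mono add_strict_mono) auto
    also have "\<dots> = \<epsilon>" using \<open>M' > 0\<close> by (simp add: e_def field_simps)
    finally show "(\<Sum>i<m. \<bar>h (t i) - h (s i)\<bar>) < \<epsilon>" .
  qed (use \<delta>1 \<delta>2 in auto)
qed

lemma abs_cont_on_cong:
  assumes "\<And>x. a \<le> x \<Longrightarrow> x \<le> b \<Longrightarrow> f x = g x"
  shows "abs_cont_on a b f \<longleftrightarrow> abs_cont_on a b g"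
proof
  assume f: "abs_cont_on a b f"
  show "abs_cont_on a b g" by (rule abs_cont_on_diff_bound[OF f f, where M = 1]) (simp add: assms)
next
  assume g: "abs_cont_on a b g"
  show "abs_cont_on a b f" by (rule abs_cont_on_diff_bound[OF g g, where M = 1]) (simp add: assms)
qed

lemma abs_cont_on_ident: "abs_cont_on a b (\<lambda>x. x)"
  unfolding abs_cont_on_def
proof (intro allI impI)
  fix \<epsilon> :: real assume "\<epsilon> > 0"
  show "\<exists>\<delta>>0. \<forall>(m::nat) s t.
     (\<forall>i<m. a \<le> s i \<and> s i < t i \<and> t i \<le> b) \<and>
     disjoint_family_on (\<lambda>i. {s i <..< t i}) {..<m} \<and>
     (\<Sum>i<m. t i - s i) < \<delta> \<longrightarrow> (\<Sum>i<m. \<bar>t i - s i\<bar>) < \<epsilon>"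
  proof (rule exI[of _ \<epsilon>], intro conjI allI impI)
    fix m :: nat and s t :: "nat \<Rightarrow> real" assume H: "(\<forall>i<m. a \<le> s i \<and> s i < t i \<and> t i \<le> b) \<and>
     disjoint_family_on (\<lambda>i. {s i <..< t i}) {..<m} \<and> (\<Sum>i<m. t i - s i) < \<epsilon>"
    then have "(\<Sum>i<m. \<bar>t i - s i\<bar>) = (\<Sum>i<m. t i - s i)" by (intro sum.cong) auto
    then show "(\<Sum>i<m. \<bar>t i - s i\<bar>) < \<epsilon>" using H by simp
  qed (rule \<open>\<epsilon> > 0\<close>)
qed

lemma abs_cont_on_lipschitz:
  assumes "\<And>s t. a \<le> s \<Longrightarrow> s \<le> t \<Longrightarrow> t \<le> b \<Longrightarrow> \<bar>f t - f s\<bar> \<le> M * (t - s)"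
  shows "abs_cont_on a b f"
\<comment> \<open>The identity enters in both places, which doubles its increments; hence
  \<open>M / 2\<close>.\<close>
proof (rule abs_cont_on_diff_bound[OF abs_cont_on_ident abs_cont_on_ident, where M = "M / 2"])
  fix s t assume st: "a \<le> s" "s \<le> t" "t \<le> b"
  have "M / 2 * (\<bar>t - s\<bar> + \<bar>t - s\<bar>) = M * (t - s)" using st by simp
  then show "\<bar>f t - f s\<bar> \<le> M / 2 * (\<bar>t - s\<bar> + \<bar>t - s\<bar>)" using assms[OF st] by linarith
qed

lemma C1_imp_lipschitz:
  fixes f f' :: "real \<Rightarrow> real"
  assumes d: "\<And>x. a \<le> x \<Longrightarrow> x \<le> b \<Longrightarrow> (f has_real_derivative f' x) (at x)"
    and c: "continuous_on {a..b} f'"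
  obtains M where "M \<ge> 0" "\<And>s t. a \<le> s \<Longrightarrow> s \<le> t \<Longrightarrow> t \<le> b \<Longrightarrow> \<bar>f t - f s\<bar> \<le> M * (t - s)"
proof -
  have "bounded (f' ` {a..b})" by (intro compact_imp_bounded compact_continuous_image c) simp
  then obtain M where M: "M > 0" "\<And>x. x \<in> {a..b} \<Longrightarrow> \<bar>f' x\<bar> \<le> M" by (auto simp: bounded_pos)
  have "\<bar>f t - f s\<bar> \<le> M * (t - s)" if "a \<le> s" "s \<le> t" "t \<le> b" for s t
  proof (cases "s = t")
    case False
    then have "s < t" using that by simp
    have "\<exists>z. s < z \<and> z < t \<and> f t - f s = (t - s) * f' z"
      by (rule MVT2[OF \<open>s < t\<close>]) (use d that in auto)
    then obtain z where z: "s < z" "z < t" "f t - f s = (t - s) * f' z" by blast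
    then show ?thesis using M(2)[of z] that by (simp add: abs_mult mult.commute[of M] mult_left_mono)
  qed simp
  then show thesis using M(1) that[of M] by simp
qed

lemma abs_cont_on_C1:
  fixes f f' :: "real \<Rightarrow> real"
  assumes "\<And>x. a \<le> x \<Longrightarrow> x \<le> b \<Longrightarrow> (f has_real_derivative f' x) (at x)" "continuous_on {a..b} f'"
  shows "abs_cont_on a b f"
proof -
  obtain M where "\<And>s t. a \<le> s \<Longrightarrow> s \<le> t \<Longrightarrow> t \<le> b \<Longrightarrow> \<bar>f t - f s\<bar> \<le> M * (t - s)"
    using C1_imp_lipschitz[OF assms] by metis
  then show ?thesis by (rule abs_cont_on_lipschitz)
qed

lemma abs_cont_on_continuous:
  assumes "abs_cont_on a b f"
  shows "continuous_on {a..b} f"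
  unfolding continuous_on_iff
proof (intro ballI allI impI)
  fix x e :: real assume x: "x \<in> {a..b}" and "e > 0"
  obtain \<delta> where \<delta>: "\<delta> > 0" "\<And>D. interval_family a b D \<Longrightarrow> (\<Sum>p\<in>D. snd p - fst p) < \<delta> \<Longrightarrow> var_sum f D < e"
    using abs_cont_on_interval_family[OF assms \<open>e > 0\<close>] by metis
  have *: "\<bar>f t - f s\<bar> < e" if "a \<le> s" "s < t" "t \<le> b" "t - s < \<delta>" for s t
    using \<delta>(2)[OF interval_family_singleton[of a s t b]] that by (simp add: var_sum_def)
  have "dist (f x') (f x) < e" if "x' \<in> {a..b}" "dist x' x < \<delta>" for x'
    using *[of x x'] *[of x' x] x that \<open>e > 0\<close>
    by (cases x x' rule: linorder_cases) (auto simp: dist_real_def abs_minus_commute)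
  then show "\<exists>d>0. \<forall>x'\<in>{a..b}. dist x' x < d \<longrightarrow> dist (f x') (f x) < e" using \<delta>(1) by blast
qed

lemma abs_cont_on_mult:
  fixes f g :: "real \<Rightarrow> real"
  assumes f: "abs_cont_on a b f" and g: "abs_cont_on a b g"
  shows "abs_cont_on a b (\<lambda>x. f x * g x)"
proof -
  have "bounded (f ` {a..b})" "bounded (g ` {a..b})"
    by (intro compact_imp_bounded compact_continuous_image abs_cont_on_continuous f g compact_Icc)+
  then obtain A B where A: "A > 0" "\<And>x. x \<in> {a..b} \<Longrightarrow> \<bar>f x\<bar> \<le> A" and B: "B > 0" "\<And>x. x \<in> {a..b} \<Longrightarrow> \<bar>g x\<bar> \<le> B"
    by (auto simp: bounded_pos)
  show ?thesis
  proof (rule abs_cont_on_diff_bound[OF f g, where M = "A + B"])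
    fix s t assume st: "a \<le> s" "s \<le> t" "t \<le> b"
    have "f t * g t - f s * g s = f t * (g t - g s) + g s * (f t - f s)" by (simp add: algebra_simps)
    also have "\<bar>\<dots>\<bar> \<le> \<bar>f t\<bar> * \<bar>g t - g s\<bar> + \<bar>g s\<bar> * \<bar>f t - f s\<bar>"
      by (metis abs_mult abs_triangle_ineq)
    also have "\<dots> \<le> (A + B) * \<bar>g t - g s\<bar> + (A + B) * \<bar>f t - f s\<bar>"
      using A(2)[of t] B(2)[of s] A(1) B(1) st by (intro add_mono mult_right_mono) auto
    finally show "\<bar>f t * g t - f s * g s\<bar> \<le> (A + B) * (\<bar>f t - f s\<bar> + \<bar>g t - g s\<bar>)"
      by (simp add: algebra_simps)
  qed
qed

section \<open>Fundamental theorem of calculus and integration by parts\<close>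

lemma abs_cont_on_FTC:
  assumes F: "abs_cont_on a b F" and "a \<le> b"
  obtains g where "set_integrable lborel {a..b} g"
    "\<And>s t. a \<le> s \<Longrightarrow> s \<le> t \<Longrightarrow> t \<le> b \<Longrightarrow> F t - F s = (LBINT x:{s..t}. g x)"
    "AE x in lborel. x \<in> {a<..<b} \<longrightarrow> (F has_real_derivative g x) (at x)"
proof -
  obtain g where g: "set_integrable lborel {a..b} g"
    "\<And>s t. a \<le> s \<Longrightarrow> s \<le> t \<Longrightarrow> t \<le> b \<Longrightarrow> F t - F s = (LBINT x:{s..t}. g x)"
    using abs_cont_on_has_density[OF assms] by metis
  have "AE x in lborel. x \<in> {a<..<b} \<longrightarrow> (F has_real_derivative g x) (at x)"
    by (rule AE_has_derivative_indefinite_integral[OF g(1)]) (rule g(2))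
  then show thesis using that[of g] g by metis
qed

text \<open>Every point of \<open>Z\<close> is interior to an interval with rational endpoints
  contained in \<open>Z\<close>, and there are only countably many of these.\<close>

lemma AE_open_if_AE_intervals:
  fixes Z :: "real set"
  assumes "open Z" and int: "\<And>a b. a < b \<Longrightarrow> {a..b} \<subseteq> Z \<Longrightarrow> AE z in lborel. z \<in> {a<..<b} \<longrightarrow> Q z"
  shows "AE z in lborel. z \<in> Z \<longrightarrow> Q z"
proof -
  have "AE z in lborel. (of_rat p :: real) < of_rat q \<and> {of_rat p..of_rat q} \<subseteq> Z \<longrightarrow> z \<in> {of_rat p<..<of_rat q} \<longrightarrow> Q z"
    for p q :: rat
  proof (cases "(of_rat p :: real) < of_rat q \<and> {of_rat p..of_rat q} \<subseteq> Z")
    case True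
    then show ?thesis using int[of "of_rat p" "of_rat q"] by auto
  qed auto
  then have "AE z in lborel. \<forall>p. \<forall>q. (of_rat p :: real) < of_rat q \<and> {of_rat p..of_rat q} \<subseteq> Z \<longrightarrow>
      z \<in> {of_rat p<..<of_rat q} \<longrightarrow> Q z" unfolding AE_all_countable by blast
  then show ?thesis
  proof eventually_elim
    case (elim z)
    show ?case
    proof
      assume "z \<in> Z"
      then obtain e where e: "e > 0" "cball z e \<subseteq> Z" using \<open>open Z\<close> open_contains_cball by blast
      obtain p where p: "z - e < of_rat p" "of_rat p < z" using of_rat_dense[of "z - e" z] e by auto
      obtain q where q: "z < of_rat q" "of_rat q < z + e" using of_rat_dense[of z "z + e"] e by auto
      have "{of_rat p..of_rat q} \<subseteq> Z" using e(2) p q by (force simp: cball_eq_atLeastAtMost)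
      then show "Q z" using elim[rule_format, of p q] p q by simp
    qed
  qed
qed

lemma abs_cont_on_AE_differentiable:
  assumes f: "\<And>a b. a \<le> b \<Longrightarrow> {a..b} \<subseteq> Z \<Longrightarrow> abs_cont_on a b f" and "open Z"
  shows "AE z in lborel. z \<in> Z \<longrightarrow> (f has_real_derivative deriv f z) (at z)"
proof (rule AE_open_if_AE_intervals[OF \<open>open Z\<close>])
  fix a b :: real assume "a < b" "{a..b} \<subseteq> Z"
  then have "abs_cont_on a b f" "a \<le> b" using f by auto
  from abs_cont_on_FTC[OF this] obtain g where
    "AE x in lborel. x \<in> {a<..<b} \<longrightarrow> (f has_real_derivative g x) (at x)" .
  then show "AE z in lborel. z \<in> {a<..<b} \<longrightarrow> (f has_real_derivative deriv f z) (at z)"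
    by eventually_elim (metis DERIV_imp_deriv)
qed

text \<open>The product of \<open>f\<close> and \<open>\<psi>\<close>, extended by zero outside
  \<open>Z\<close>, has a density near every point of the line: it is absolutely continuous near
  points of \<open>Z\<close> and vanishes near points outside \<open>S\<close>. Bisection glues the
  local densities, and the total integral is 0 because the product vanishes at both ends of a large
  interval. The derivative is represented by some integrable \<open>g\<close>, since measurability
  of \<open>deriv f\<close> is not at hand.\<close>

lemma abs_cont_integration_by_parts:
  fixes f \<psi> \<psi>' :: "real \<Rightarrow> real"
  assumes "open Z" and f: "\<And>a b. a \<le> b \<Longrightarrow> {a..b} \<subseteq> Z \<Longrightarrow> abs_cont_on a b f"
    and \<psi>: "\<And>z. (\<psi> has_real_derivative \<psi>' z) (at z)" "continuous_on UNIV \<psi>'"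
    and S: "compact S" "S \<subseteq> Z" "\<And>z. z \<notin> S \<Longrightarrow> \<psi> z = 0"
  obtains g where "integrable lborel g" "(LBINT z. g z) = 0"
    "AE z in lborel. g z = (if z \<in> Z then deriv f z * \<psi> z + f z * \<psi>' z else 0)"
proof -
  define h where "h z = (if z \<in> Z then f z * \<psi> z else 0)" for z
  \<comment> \<open>A statement about one interval and not about all its subintervals, so that two
    adjacent instances combine by joining their densities at the common endpoint.\<close>
  define P where "P a b \<longleftrightarrow> (\<exists>g. set_integrable lborel {a..b} g \<and> h b - h a = (LBINT x:{a..b}. g x) \<and>
      (AE x in lborel. x \<in> {a<..<b} \<longrightarrow> (h has_real_derivative g x) (at x)))" for a b
  have P_AC: "P a b" if h: "abs_cont_on a b h" and "a \<le> b" for a b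
  proof -
    obtain g where "set_integrable lborel {a..b} g"
      "\<And>s t. a \<le> s \<Longrightarrow> s \<le> t \<Longrightarrow> t \<le> b \<Longrightarrow> h t - h s = (LBINT x:{s..t}. g x)"
      "AE x in lborel. x \<in> {a<..<b} \<longrightarrow> (h has_real_derivative g x) (at x)"
      by (rule abs_cont_on_FTC[OF h \<open>a \<le> b\<close>]) (rule that)
    then show ?thesis unfolding P_def using \<open>a \<le> b\<close> by blast
  qed
  obtain R where R: "R > 0" "S \<subseteq> {-R<..<R}"
  proof -
    obtain R where "R > 0" "\<forall>x\<in>S. norm x < R" using compact_imp_bounded[OF S(1)] by (auto simp: bounded_pos_less)
    then show thesis by (intro that[of R]) (auto simp: abs_less_iff)
  qed
  have "P (-R) R"
  proof (rule Bolzano[of "-R" R])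
    fix a b c assume "P a b" "P b c" "a \<le> b" "b \<le> c"
    then obtain g1 g2 where g1: "set_integrable lborel {a..b} g1" "h b - h a = (LBINT x:{a..b}. g1 x)"
      "AE x in lborel. x \<in> {a<..<b} \<longrightarrow> (h has_real_derivative g1 x) (at x)"
      and g2: "set_integrable lborel {b..c} g2" "h c - h b = (LBINT x:{b..c}. g2 x)"
      "AE x in lborel. x \<in> {b<..<c} \<longrightarrow> (h has_real_derivative g2 x) (at x)"
      unfolding P_def by blast
    define g where "g x = (if x \<le> b then g1 x else g2 x)" for x
    have i1: "set_integrable lborel {a..b} g"
      using g1(1) by (rule iffD1[OF set_integrable_cong, rotated -1]) (auto simp: g_def)
    have i2': "set_integrable lborel {b<..c} g2" by (rule set_integrable_subset[OF g2(1)]) auto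
    then have i2: "set_integrable lborel {b<..c} g"
      by (rule iffD1[OF set_integrable_cong, rotated -1]) (auto simp: g_def)
    have U: "{a..c} = {a..b} \<union> {b<..c}" using \<open>a \<le> b\<close> \<open>b \<le> c\<close> by auto
    have "(LBINT x:{a..c}. g x) = (LBINT x:{a..b}. g x) + (LBINT x:{b<..c}. g x)"
      unfolding U by (rule set_integral_Un[OF _ i1 i2]) auto
    also have "(LBINT x:{a..b}. g x) = h b - h a"
      unfolding g1(2) by (rule set_lebesgue_integral_cong) (auto simp: g_def)
    also have "(LBINT x:{b<..c}. g x) = (LBINT x:{b<..c}. g2 x)"
      by (rule set_lebesgue_integral_cong) (auto simp: g_def)
    also have "\<dots> = (LBINT x:{b..c}. g2 x)"
    proof -
      have b0: "AE x in lborel. x \<noteq> b" by (rule AE_lborel_singleton)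
      have m: "set_borel_measurable lborel {b..c} g2" "set_borel_measurable lborel {b<..c} g2"
        using i2' g2(1) unfolding set_integrable_def set_borel_measurable_def by auto
      show ?thesis
        by (rule set_integral_cong_set[OF m]) (use b0 in \<open>auto elim!: eventually_mono\<close>)
    qed
    also have "\<dots> = h c - h b" using g2(2) by simp
    finally have "h c - h a = (LBINT x:{a..c}. g x)" by simp
    moreover have "set_integrable lborel {a..c} g" unfolding U by (rule set_integrable_Un[OF i1 i2]) auto
    moreover have "AE x in lborel. x \<in> {a<..<c} \<longrightarrow> (h has_real_derivative g x) (at x)"
      using g1(3) g2(3) AE_lborel_singleton[of b] by eventually_elim (auto simp: g_def)
    ultimately show "P a c" unfolding P_def by blast
  next
    fix x :: real
    show "\<exists>d>0. \<forall>a b. a \<le> x \<and> x \<le> b \<and> b - a < d \<longrightarrow> P a b"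
    proof (cases "x \<in> Z")
      case True
      then obtain e where e: "e > 0" "ball x e \<subseteq> Z" using \<open>open Z\<close> openE by blast
      have "P a b" if "a \<le> x \<and> x \<le> b \<and> b - a < e" for a b
      proof (rule P_AC)
        have sub: "{a..b} \<subseteq> Z" using e(2) that by (force simp: dist_real_def)
        have "a \<le> b" using that by simp
        have "abs_cont_on a b \<psi>"
          by (rule abs_cont_on_C1[OF \<psi>(1)]) (use \<psi>(2) continuous_on_subset in blast)
        then have "abs_cont_on a b (\<lambda>z. f z * \<psi> z)" by (rule abs_cont_on_mult[OF f[OF \<open>a \<le> b\<close> sub]])
        then show "abs_cont_on a b h"
          by (rule iffD1[OF abs_cont_on_cong, rotated -1]) (use sub in \<open>auto simp: h_def\<close>)
      qed (use that in simp)
      then show ?thesis using e(1) by blast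
    next
      case False
      then have "x \<in> - S" using S by blast
      moreover have "open (- S)" using S(1) by (simp add: compact_imp_closed open_Compl)
      ultimately obtain e where e: "e > 0" "ball x e \<subseteq> - S" using openE by blast
      have "P a b" if "a \<le> x \<and> x \<le> b \<and> b - a < e" for a b
      proof (rule P_AC)
        have "{a..b} \<subseteq> - S" using e(2) that by (force simp: dist_real_def)
        then have "h z = 0" if "a \<le> z" "z \<le> b" for z using that S(3) by (force simp: h_def)
        then show "abs_cont_on a b h" by (intro abs_cont_on_lipschitz[where M = 0]) auto
      qed (use that in simp)
      then show ?thesis using e(1) by blast
    qed
  qed (use R in simp)
  then obtain g where g: "set_integrable lborel {-R..R} g" "h R - h (-R) = (LBINT x:{-R..R}. g x)"
    "AE x in lborel. x \<in> {-R<..<R} \<longrightarrow> (h has_real_derivative g x) (at x)" unfolding P_def by blast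
  define G where "G x = indicator {-R..R} x * g x" for x
  have "R \<notin> S" "- R \<notin> S" using R by auto
  then have "h R = 0" "h (-R) = 0" using S(3) by (auto simp: h_def)
  show thesis
  proof (rule that[of G])
    show "integrable lborel G" using g(1) by (simp add: G_def[abs_def] set_integrable_def)
    show "(LBINT x. G x) = 0" using g(2) \<open>h R = 0\<close> \<open>h (-R) = 0\<close>
      by (simp add: G_def[abs_def] set_lebesgue_integral_def)
    have \<psi>'0: "\<psi>' z = 0" if "z \<notin> S" for z
    proof -
      have "open (- S)" using S(1) by (simp add: compact_imp_closed open_Compl)
      have "((\<lambda>_. 0) has_real_derivative \<psi>' z) (at z)"
        by (rule has_field_derivative_transform_within_open[OF \<psi>(1) \<open>open (- S)\<close>]) (use that S(3) in auto)
      then show ?thesis using DERIV_unique[OF _ DERIV_const] by blast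
    qed
    have fd: "AE z in lborel. z \<in> Z \<longrightarrow> (f has_real_derivative deriv f z) (at z)"
      by (rule abs_cont_on_AE_differentiable[OF f \<open>open Z\<close>])
    show "AE z in lborel. G z = (if z \<in> Z then deriv f z * \<psi> z + f z * \<psi>' z else 0)"
      using g(3) fd AE_lborel_singleton[of R] AE_lborel_singleton[of "-R"]
    proof eventually_elim
      case (elim z)
      show ?case
      proof (cases "z \<in> {-R<..<R}")
        case False
        then have "G z = 0" using elim by (auto simp: G_def indicator_def)
        moreover have "\<psi> z = 0" "\<psi>' z = 0" using False R S(3) \<psi>'0 by blast+
        ultimately show ?thesis by simp
      next
        case True
        then have G: "G z = g z" and hz: "(h has_real_derivative g z) (at z)" using elim by (auto simp: G_def)
        show ?thesis
        proof (cases "z \<in> Z")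
          case zZ: True
          have "((\<lambda>z. f z * \<psi> z) has_real_derivative deriv f z * \<psi> z + \<psi>' z * f z) (at z)"
            using elim zZ by (intro DERIV_mult \<psi>) auto
          then have "(h has_real_derivative deriv f z * \<psi> z + \<psi>' z * f z) (at z)"
            by (rule has_field_derivative_transform_within_open[OF _ \<open>open Z\<close> zZ]) (simp add: h_def)
          then have "g z = deriv f z * \<psi> z + \<psi>' z * f z" using hz DERIV_unique by blast
          then show ?thesis using G zZ by simp
        next
          case zZ: False
          have "open (- S)" using S(1) by (simp add: compact_imp_closed open_Compl)
          have "((\<lambda>_. 0) has_real_derivative g z) (at z)"
            by (rule has_field_derivative_transform_within_open[OF hz \<open>open (- S)\<close>])
               (use zZ S in \<open>auto simp: h_def\<close>)
          then have "g z = 0" using DERIV_unique[OF _ DERIV_const] by blast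
          then show ?thesis using G zZ by simp
        qed
      qed
    qed
  qed
qed

section \<open>Functions whose increments are dominated by an integral\<close>

text \<open>Truncating \<open>g\<close> at a suitable height n loses at most
  \<open>\<epsilon> / 2\<close> of the integral, and the truncation contributes at most n times the
  measure of the set.\<close>

lemma nn_integral_absolutely_continuous:
  fixes g :: "'a \<Rightarrow> ennreal"
  assumes [measurable]: "g \<in> borel_measurable M" and fin: "(\<integral>\<^sup>+x. g x \<partial>M) < \<infinity>" and "\<epsilon> > 0"
  obtains \<delta> :: real where "\<delta> > 0"
    "\<And>A. A \<in> sets M \<Longrightarrow> emeasure M A \<le> ennreal \<delta> \<Longrightarrow> (\<integral>\<^sup>+x\<in>A. g x \<partial>M) \<le> ennreal \<epsilon>"
proof -
  have "(SUP n. min (g x) (of_nat n)) = g x" for x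
  proof (rule SUP_eqI)
    fix y assume y: "\<And>n. n \<in> UNIV \<Longrightarrow> min (g x) (of_nat n) \<le> y"
    show "g x \<le> y"
    proof (cases "g x")
      case (real r)
      obtain n :: nat where "r \<le> real n" using real_arch_simple by blast
      then have "g x \<le> of_nat n" using real by (simp add: ennreal_of_nat_eq_real_of_nat ennreal_leI)
      then show ?thesis using y[of n] by (simp add: min_def)
    next
      case top
      then have "of_nat n \<le> y" for n using y[of n] by simp
      then have "y = \<infinity>" by (metis ennreal_Ex_less_of_nat infinity_ennreal_def not_le top.not_eq_extremum)
      then show ?thesis by simp
    qed
  qed simp
  then have "(\<integral>\<^sup>+x. g x \<partial>M) = (\<integral>\<^sup>+x. (SUP n. min (g x) (of_nat n)) \<partial>M)" by simp
  also have "\<dots> = (SUP n. \<integral>\<^sup>+x. min (g x) (of_nat n) \<partial>M)"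
    by (rule nn_integral_monotone_convergence_SUP) (auto simp: incseq_def le_fun_def min.coboundedI2)
  finally have eq: "(\<integral>\<^sup>+x. g x \<partial>M) = (SUP n. \<integral>\<^sup>+x. min (g x) (of_nat n) \<partial>M)" .
  have "\<exists>n\<in>UNIV. (\<integral>\<^sup>+x. g x \<partial>M) < (\<integral>\<^sup>+x. min (g x) (of_nat n) \<partial>M) + ennreal (\<epsilon> / 2)"
    by (rule SUP_approx_ennreal[OF _ _ eq]) (use fin \<open>\<epsilon> > 0\<close> in auto)
  then obtain n where n: "(\<integral>\<^sup>+x. g x \<partial>M) < (\<integral>\<^sup>+x. min (g x) (of_nat n) \<partial>M) + ennreal (\<epsilon> / 2)" by blast
  define \<delta> where "\<delta> = \<epsilon> / (2 * (real n + 1))"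
  have "(\<integral>\<^sup>+x\<in>A. g x \<partial>M) \<le> ennreal \<epsilon>" if A[measurable]: "A \<in> sets M" and le: "emeasure M A \<le> ennreal \<delta>" for A
  proof -
    \<comment> \<open>Splitting along \<open>A\<close> localizes the loss by truncation: the
      contribution of the complement is finite and cancels.\<close>
    have dec: "(\<integral>\<^sup>+x. f x \<partial>M) = (\<integral>\<^sup>+x\<in>A. f x \<partial>M) + (\<integral>\<^sup>+x\<in>space M - A. f x \<partial>M)"
      if [measurable]: "f \<in> borel_measurable M" for f :: "'a \<Rightarrow> ennreal"
      by (subst nn_integral_add[symmetric]) (auto intro!: nn_integral_cong simp: indicator_def)
    let ?m = "\<lambda>x. min (g x) (of_nat n)"
    let ?B = "\<integral>\<^sup>+x\<in>space M - A. g x \<partial>M"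
    have "(\<integral>\<^sup>+x\<in>A. g x \<partial>M) + ?B \<le> (\<integral>\<^sup>+x\<in>A. ?m x \<partial>M) + (\<integral>\<^sup>+x\<in>space M - A. ?m x \<partial>M) + ennreal (\<epsilon> / 2)"
      using n dec[of g] dec[of ?m] by simp
    also have "\<dots> \<le> (\<integral>\<^sup>+x\<in>A. ?m x \<partial>M) + ?B + ennreal (\<epsilon> / 2)"
      by (intro add_mono order_refl nn_integral_mono mult_right_mono) auto
    finally have "?B + (\<integral>\<^sup>+x\<in>A. g x \<partial>M) \<le> ?B + ((\<integral>\<^sup>+x\<in>A. ?m x \<partial>M) + ennreal (\<epsilon> / 2))"
      by (simp add: ac_simps)
    moreover have "?B \<noteq> \<infinity>"
    proof -
      have "?B \<le> (\<integral>\<^sup>+x. g x \<partial>M)" using dec[of g] by simp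
      then show ?thesis using fin by (auto simp: top_unique)
    qed
    ultimately have "(\<integral>\<^sup>+x\<in>A. g x \<partial>M) \<le> (\<integral>\<^sup>+x\<in>A. ?m x \<partial>M) + ennreal (\<epsilon> / 2)"
      by (simp add: ennreal_add_left_cancel_le)
    also have "(\<integral>\<^sup>+x\<in>A. ?m x \<partial>M) \<le> (\<integral>\<^sup>+x\<in>A. of_nat n \<partial>M)"
      by (intro nn_integral_mono mult_right_mono) auto
    also have "\<dots> = of_nat n * emeasure M A" by (rule nn_integral_cmult_indicator) simp
    also have "\<dots> \<le> of_nat n * ennreal \<delta>" using le by (rule mult_left_mono) simp
    also have "\<dots> = ennreal (real n * \<delta>)"
      using \<open>\<epsilon> > 0\<close> by (simp add: ennreal_of_nat_eq_real_of_nat ennreal_mult[symmetric] \<delta>_def)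
    also have "\<dots> \<le> ennreal (\<epsilon> / 2)"
      using \<open>\<epsilon> > 0\<close> by (intro ennreal_leI) (simp add: \<delta>_def field_simps)
    finally have "(\<integral>\<^sup>+x\<in>A. g x \<partial>M) \<le> ennreal (\<epsilon> / 2) + ennreal (\<epsilon> / 2)" by (simp add: add_mono)
    also have "\<dots> = ennreal \<epsilon>" using \<open>\<epsilon> > 0\<close> by (simp add: ennreal_plus[symmetric] del: ennreal_plus)
    finally show ?thesis .
  qed
  moreover have "\<delta> > 0" using \<open>\<epsilon> > 0\<close> by (simp add: \<delta>_def)
  ultimately show thesis using that by blast
qed

text \<open>Removing endpoints does not change the integrals, and over disjoint open intervals they
  add up to one integral over a set of small measure.\<close>

lemma abs_cont_on_dominated:
  fixes F :: "real \<Rightarrow> real" and g :: "real \<Rightarrow> ennreal"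
  assumes g[measurable]: "g \<in> borel_measurable lborel" and fin: "(\<integral>\<^sup>+x. g x \<partial>lborel) < \<infinity>"
    and le: "\<And>s t. a \<le> s \<Longrightarrow> s \<le> t \<Longrightarrow> t \<le> b \<Longrightarrow> ennreal \<bar>F t - F s\<bar> \<le> (\<integral>\<^sup>+x\<in>{s..t}. g x \<partial>lborel)"
  shows "abs_cont_on a b F"
  unfolding abs_cont_on_def
proof (intro allI impI)
  fix \<epsilon> :: real assume "\<epsilon> > 0"
  then have "\<epsilon> / 2 > 0" by simp
  obtain \<delta> :: real where \<delta>: "\<delta> > 0"
    "\<And>A. A \<in> sets lborel \<Longrightarrow> emeasure lborel A \<le> ennreal \<delta> \<Longrightarrow> (\<integral>\<^sup>+x\<in>A. g x \<partial>lborel) \<le> ennreal (\<epsilon> / 2)"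
    by (rule nn_integral_absolutely_continuous[OF g fin \<open>\<epsilon> / 2 > 0\<close>]) (rule that)
  show "\<exists>\<delta>>0. \<forall>(m::nat) s t.
     (\<forall>i<m. a \<le> s i \<and> s i < t i \<and> t i \<le> b) \<and>
     disjoint_family_on (\<lambda>i. {s i <..< t i}) {..<m} \<and>
     (\<Sum>i<m. t i - s i) < \<delta> \<longrightarrow> (\<Sum>i<m. \<bar>F (t i) - F (s i)\<bar>) < \<epsilon>"
  proof (rule exI[of _ \<delta>], intro conjI allI impI)
    fix m :: nat and s t assume "(\<forall>i<m. a \<le> s i \<and> s i < t i \<and> t i \<le> b) \<and>
     disjoint_family_on (\<lambda>i. {s i <..< t i}) {..<m} \<and> (\<Sum>i<m. t i - s i) < \<delta>"
    then have st: "\<And>i. i < m \<Longrightarrow> a \<le> s i \<and> s i < t i \<and> t i \<le> b"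
      and disj: "disjoint_family_on (\<lambda>i. {s i <..< t i}) {..<m}" and len: "(\<Sum>i<m. t i - s i) < \<delta>" by auto
    let ?A = "\<Union>i<m. {s i<..<t i}"
    have "ennreal (\<Sum>i<m. \<bar>F (t i) - F (s i)\<bar>) = (\<Sum>i<m. ennreal \<bar>F (t i) - F (s i)\<bar>)" by simp
    also have "\<dots> \<le> (\<Sum>i<m. \<integral>\<^sup>+x\<in>{s i..t i}. g x \<partial>lborel)"
      by (rule sum_mono) (use st in \<open>auto intro!: le simp: less_imp_le\<close>)
    also have "\<dots> = (\<Sum>i<m. \<integral>\<^sup>+x\<in>{s i<..<t i}. g x \<partial>lborel)"
    proof (rule sum.cong[OF refl], rule nn_integral_cong_AE)
      fix i
      show "AE x in lborel. g x * indicator {s i..t i} x = g x * indicator {s i<..<t i} x"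
        using AE_lborel_singleton[of "s i"] AE_lborel_singleton[of "t i"]
        by eventually_elim (auto simp: indicator_def)
    qed
    also have "\<dots> = (\<integral>\<^sup>+x. (\<Sum>i<m. g x * indicator {s i<..<t i} x) \<partial>lborel)"
      by (rule nn_integral_sum[symmetric]) simp
    also have "\<dots> = (\<integral>\<^sup>+x\<in>?A. g x \<partial>lborel)"
      by (intro nn_integral_cong)
         (subst indicator_UN_disjoint[OF _ disj], simp_all add: sum_distrib_left)
    also have "\<dots> \<le> ennreal (\<epsilon> / 2)"
    proof (rule \<delta>(2))
      have "emeasure lborel ?A \<le> (\<Sum>i<m. emeasure lborel {s i<..<t i})"
        by (rule emeasure_subadditive_finite) auto
      also have "\<dots> = (\<Sum>i<m. ennreal (t i - s i))"
        by (rule sum.cong) (use st in \<open>auto simp: less_imp_le\<close>)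
      also have "\<dots> = ennreal (\<Sum>i<m. t i - s i)" by (rule sum_ennreal) (use st in \<open>auto simp: less_imp_le\<close>)
      also have "\<dots> \<le> ennreal \<delta>" using len by (intro ennreal_leI) simp
      finally show "emeasure lborel ?A \<le> ennreal \<delta>" .
    qed (simp add: open_UN)
    finally have "(\<Sum>i<m. \<bar>F (t i) - F (s i)\<bar>) \<le> \<epsilon> / 2" using \<open>\<epsilon> > 0\<close> by (simp del: sum_ennreal)
    then show "(\<Sum>i<m. \<bar>F (t i) - F (s i)\<bar>) < \<epsilon>" using \<open>\<epsilon> > 0\<close> by simp
  qed (rule \<delta>(1))
qed

text \<open>Difference quotients of \<open>F\<close> are bounded by averages of \<open>g\<close>,
  and almost everywhere these converge to the value of \<open>g\<close>, once \<open>g\<close> is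
  replaced by the real function \<open>G\<close> that agrees with it almost everywhere on
  [a, b].\<close>

lemma AE_derivative_le_dominated:
  fixes F :: "real \<Rightarrow> real" and g :: "real \<Rightarrow> ennreal"
  assumes g[measurable]: "g \<in> borel_measurable lborel" and fin: "(\<integral>\<^sup>+x\<in>{a..b}. g x \<partial>lborel) < \<infinity>"
    and le: "\<And>s t. a \<le> s \<Longrightarrow> s \<le> t \<Longrightarrow> t \<le> b \<Longrightarrow> ennreal \<bar>F t - F s\<bar> \<le> (\<integral>\<^sup>+x\<in>{s..t}. g x \<partial>lborel)"
  shows "AE x in lborel. x \<in> {a<..<b} \<longrightarrow> (F has_real_derivative D x) (at x) \<longrightarrow> ennreal \<bar>D x\<bar> \<le> g x"
proof -
  define G where "G x = enn2real (g x * indicator {a..b} x)" for x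
  have [measurable]: "G \<in> borel_measurable borel" unfolding G_def[abs_def] by measurable
  have ae: "AE x in lborel. ennreal (G x) = g x * indicator {a..b} x"
    using nn_integral_PInf_AE[OF _ less_imp_neq[OF fin]] by (auto simp: G_def less_top elim!: eventually_mono)
  have "(\<integral>\<^sup>+x. ennreal (G x) \<partial>lborel) = (\<integral>\<^sup>+x\<in>{a..b}. g x \<partial>lborel)" by (rule nn_integral_cong_AE[OF ae])
  then have G_int: "integrable lborel G" using fin by (intro integrableI_nonneg) (auto simp: G_def)
  have le': "\<bar>F t - F s\<bar> \<le> (LBINT x:{s..t}. G x)" if "a \<le> s" "s \<le> t" "t \<le> b" for s t
  proof -
    have "ennreal \<bar>F t - F s\<bar> \<le> (\<integral>\<^sup>+x\<in>{s..t}. g x \<partial>lborel)" by (rule le[OF that])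
    also have "\<dots> = (\<integral>\<^sup>+x. ennreal (indicator {s..t} x * G x) \<partial>lborel)"
      using ae by (intro nn_integral_cong_AE, eventually_elim) (use that in \<open>auto simp: indicator_def\<close>)
    also have "\<dots> = ennreal (LBINT x:{s..t}. G x)"
      unfolding set_lebesgue_integral_def real_scaleR_def
      using integrable_mult_indicator[OF _ G_int, of "{s..t}"]
      by (intro nn_integral_eq_integral) (auto simp: G_def)
    finally show ?thesis
      by (subst (asm) ennreal_le_iff) (auto simp: set_lebesgue_integral_def G_def intro!: Bochner_Integration.integral_nonneg)
  qed
  show ?thesis using AE_lebesgue_differentiation[OF G_int] ae
  proof eventually_elim
    case (elim x)
    show ?case
    proof (intro impI)
      assume x: "x \<in> {a<..<b}" and D: "(F has_real_derivative D x) (at x)"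
      have "\<bar>D x\<bar> \<le> G x"
      proof (rule field_le_epsilon)
        fix e :: real assume "e > 0"
        then have e2: "e / 2 > 0" by simp
        obtain d1 where d1: "d1 > 0" "\<And>a b. a \<le> x \<Longrightarrow> x \<le> b \<Longrightarrow> a < b \<Longrightarrow> b - a < d1 \<Longrightarrow>
           \<bar>(LBINT t:{a..b}. G t) - G x * (b - a)\<bar> \<le> e / 2 * (b - a)" using elim(1) e2 by meson
        obtain d2 where d2: "d2 > 0" "\<And>y. norm (y - x) < d2 \<Longrightarrow> norm (F y - F x - D x * (y - x)) \<le> e / 2 * norm (y - x)"
          using D e2 unfolding has_field_derivative_def has_derivative_at_alt by meson
        define h where "h = min (b - x) (min d1 d2) / 2"
        have h: "h > 0" "h < b - x" "h < d1" "h < d2" using d1 d2 x by (auto simp: h_def min_def)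
        have "\<bar>D x\<bar> * h = \<bar>D x * h\<bar>" using h by (simp add: abs_mult)
        also have "\<dots> \<le> \<bar>F (x + h) - F x\<bar> + e / 2 * h" 
        proof -
          have "\<bar>F (x + h) - F x - D x * h\<bar> \<le> e / 2 * h" using d2(2)[of "x + h"] h by simp
          then show ?thesis by linarith
        qed
        also have "\<bar>F (x + h) - F x\<bar> \<le> (LBINT t:{x..x + h}. G t)" using le'[of x "x + h"] x h by simp
        also have "\<dots> \<le> G x * h + e / 2 * h" 
        proof -
          have "\<bar>(LBINT t:{x..x + h}. G t) - G x * h\<bar> \<le> e / 2 * h" using d1(2)[of x "x + h"] h by simp
          then show ?thesis by linarith
        qed
        finally have "\<bar>D x\<bar> * h \<le> (G x + e) * h" by (simp add: algebra_simps)
        then show "\<bar>D x\<bar> \<le> G x + e" using h(1) by simp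
      qed
      then have "ennreal \<bar>D x\<bar> \<le> ennreal (G x)" by (rule ennreal_leI)
      then show "ennreal \<bar>D x\<bar> \<le> g x" using elim(2) x by simp
    qed
  qed
qed

section \<open>Fubini on lines parallel to a coordinate axis\<close>

abbreviation lines_measure :: "'n::finite \<Rightarrow> ('n \<Rightarrow> real) measure" where
  "lines_measure k \<equiv> PiM (UNIV - {k}) (\<lambda>_. lborel)"

interpretation lborel_lines: product_sigma_finite "\<lambda>_::'n::finite. lborel :: real measure"
  by unfold_locales

lemma sigma_finite_lines_measure: "sigma_finite_measure (lines_measure k)"
  by (rule lborel_lines.sigma_finite) simp

lemma pair_sigma_finite_lines: "pair_sigma_finite (lines_measure k) (lborel :: real measure)"
  by (intro pair_sigma_finite.intro sigma_finite_lines_measure sigma_finite_lborel)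

lemma insert_coord_nth [simp]: "insert_coord k y z $ i = (if i = k then z else y i)"
  by (simp add: insert_coord_def)

lemma inner_axis_1: "(x :: real ^ 'n) \<bullet> axis i 1 = x $ i"
  by (simp add: inner_axis)

lemma Basis_vec_real: "(Basis :: (real ^ 'n::finite) set) = (\<lambda>i. axis i 1) ` UNIV"
  by (auto simp: Basis_vec_def)

lemma inj_axis_1: "inj (\<lambda>i::'n::finite. axis i (1::real))"
  by (auto simp: inj_on_def axis_eq_axis)

lemma measurable_insert_coord [measurable]:
  "(\<lambda>p. insert_coord k (fst p) (snd p)) \<in> lines_measure k \<Otimes>\<^sub>M (lborel :: real measure) \<rightarrow>\<^sub>M borel"
proof (subst borel_measurable_euclidean_space, safe)
  fix b :: "real ^ 'a" assume "b \<in> Basis"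
  then obtain i where i: "b = axis i 1" by (auto simp: Basis_vec_real)
  show "(\<lambda>p. insert_coord k (fst p) (snd p) \<bullet> b) \<in> borel_measurable (lines_measure k \<Otimes>\<^sub>M lborel)"
  proof (cases "i = k")
    case True
    then show ?thesis by (simp add: i inner_axis_1)
  next
    case False
    then have "(\<lambda>y. y i) \<in> lines_measure k \<rightarrow>\<^sub>M (lborel :: real measure)"
      by (intro measurable_component_singleton) simp
    from measurable_compose[OF measurable_fst this]
    have "(\<lambda>p::('a \<Rightarrow> real) \<times> real. fst p i) \<in> borel_measurable (lines_measure k \<Otimes>\<^sub>M lborel)"
      by simp
    then show ?thesis using False by (simp add: i inner_axis_1)
  qed
qed

text \<open>Both measures give an open box the product of its side lengths, which characterizes
  Lebesgue measure.\<close>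

lemma lborel_eq_distr_lines:
  "(lborel :: (real ^ 'n::finite) measure) =
     distr (lines_measure k \<Otimes>\<^sub>M lborel) borel (\<lambda>p. insert_coord k (fst p) (snd p))"
proof (rule lborel_eqI)
  fix l u :: "real ^ 'n" assume le: "\<And>b. b \<in> Basis \<Longrightarrow> l \<bullet> b \<le> u \<bullet> b"
  have lu: "l $ i \<le> u $ i" for i using le[of "axis i 1"] by (simp add: inner_axis_1)
  let ?A = "PiE (UNIV - {k}) (\<lambda>i. {l $ i<..<u $ i})"
  let ?T = "\<lambda>p. insert_coord k (fst p) (snd p)"
  have pre: "?T -` box l u \<inter> space (lines_measure k \<Otimes>\<^sub>M lborel) = ?A \<times> {l $ k<..<u $ k}"
  proof (rule set_eqI, rule prod.induct)
    fix y z
    have "(\<forall>i. l $ i < ?T (y, z) $ i \<and> ?T (y, z) $ i < u $ i) \<longleftrightarrow>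
        (\<forall>i\<in>UNIV - {k}. l $ i < y i \<and> y i < u $ i) \<and> l $ k < z \<and> z < u $ k"
      by (metis Diff_iff UNIV_I fst_conv insert_coord_nth singletonD singletonI snd_conv)
    then show "(y, z) \<in> ?T -` box l u \<inter> space (lines_measure k \<Otimes>\<^sub>M lborel) \<longleftrightarrow> (y, z) \<in> ?A \<times> {l $ k<..<u $ k}"
      unfolding vimage_eq Int_iff mem_box_cart space_pair_measure space_PiM mem_Sigma_iff PiE_iff greaterThanLessThan_iff
      by simp blast
  qed
  have "emeasure (distr (lines_measure k \<Otimes>\<^sub>M lborel) borel ?T) (box l u) =
      emeasure (lines_measure k \<Otimes>\<^sub>M lborel) (?A \<times> {l $ k<..<u $ k})"
    unfolding pre[symmetric] by (rule emeasure_distr[OF measurable_insert_coord]) simp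
  also have "\<dots> = emeasure (lines_measure k) ?A * emeasure lborel {l $ k<..<u $ k}"
    by (rule sigma_finite_measure.emeasure_pair_measure_Times[OF sigma_finite_lborel]) auto
  also have "emeasure (lines_measure k) ?A = (\<Prod>i\<in>UNIV - {k}. emeasure lborel {l $ i<..<u $ i})"
    by (rule lborel_lines.emeasure_PiM) auto
  also have "\<dots> * emeasure lborel {l $ k<..<u $ k} = (\<Prod>i\<in>UNIV. emeasure lborel {l $ i<..<u $ i})"
    by (subst prod.remove[of UNIV k]) (auto simp: mult.commute)
  also have "\<dots> = (\<Prod>i\<in>UNIV. ennreal (u $ i - l $ i))" using lu by simp
  also have "\<dots> = ennreal (\<Prod>i\<in>UNIV. u $ i - l $ i)" by (rule prod_ennreal) (use lu in auto)
  also have "(\<Prod>i\<in>UNIV. u $ i - l $ i) = (\<Prod>b\<in>Basis. (u - l) \<bullet> b)"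
    unfolding Basis_vec_real by (subst prod.reindex[OF inj_axis_1]) (simp add: inner_axis_1)
  finally show "emeasure (distr (lines_measure k \<Otimes>\<^sub>M lborel) borel (\<lambda>p. insert_coord k (fst p) (snd p))) (box l u) =
      (\<Prod>b\<in>Basis. (u - l) \<bullet> b)" .
qed simp

lemma nn_integral_lines:
  fixes f :: "real ^ 'n::finite \<Rightarrow> ennreal"
  assumes [measurable]: "f \<in> borel_measurable borel"
  shows "(\<integral>\<^sup>+x. f x \<partial>lborel) = (\<integral>\<^sup>+y. \<integral>\<^sup>+z. f (insert_coord k y z) \<partial>lborel \<partial>lines_measure k)"
proof -
  have "(\<integral>\<^sup>+x. f x \<partial>lborel) = (\<integral>\<^sup>+p. f (insert_coord k (fst p) (snd p)) \<partial>(lines_measure k \<Otimes>\<^sub>M lborel))"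
    by (subst lborel_eq_distr_lines[of k]) (rule nn_integral_distr, auto)
  also have "\<dots> = (\<integral>\<^sup>+y. \<integral>\<^sup>+z. f (insert_coord k y z) \<partial>lborel \<partial>lines_measure k)"
    by (subst sigma_finite_measure.nn_integral_fst[OF sigma_finite_lborel, symmetric]) simp_all
  finally show ?thesis .
qed

lemma measurable_nn_integral_lines [measurable]:
  assumes [measurable]: "f \<in> borel_measurable borel"
  shows "(\<lambda>y. \<integral>\<^sup>+z. f (insert_coord k y z) \<partial>lborel) \<in> borel_measurable (lines_measure k)"
proof -
  have "(\<lambda>p. f (insert_coord k (fst p) (snd p))) \<in> borel_measurable (lines_measure k \<Otimes>\<^sub>M lborel)" by measurable
  from sigma_finite_measure.borel_measurable_nn_integral_fst[OF sigma_finite_lborel this] show ?thesis by simp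
qed

lemma AE_lines:
  fixes P :: "real ^ 'n::finite \<Rightarrow> bool"
  assumes "AE x in lborel. P x"
  shows "AE y in lines_measure k. AE z in lborel. P (insert_coord k y z)"
proof -
  have "AE p in lines_measure k \<Otimes>\<^sub>M lborel. P (insert_coord k (fst p) (snd p))"
    using assms by (subst (asm) lborel_eq_distr_lines[of k]) (erule AE_distrD[rotated], measurable)
  from pair_sigma_finite.AE_pair[OF pair_sigma_finite_lines this] show ?thesis by simp
qed

text \<open>Sections of a Lebesgue measurable set need not be Borel, so Fubini's theorem is applied
  to a Borel subset of the same measure.\<close>

lemma null_set_if_null_on_lines:
  fixes A :: "(real ^ 'n::finite) set"
  assumes A: "A \<in> sets lebesgue"
    and lines: "AE y in lines_measure k. AE z in lborel. insert_coord k y z \<notin> A"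
  shows "A \<in> null_sets lebesgue"
proof -
  let ?B = "main_part lborel A"
  have B[measurable]: "?B \<in> sets borel" using A main_part_sets[of A lborel] by simp
  have "?B \<subseteq> A" using main_part_null_part_Un[OF A] by blast
  have "emeasure lborel ?B = (\<integral>\<^sup>+x. indicator ?B x \<partial>lborel)" by simp
  also have "\<dots> = (\<integral>\<^sup>+y. \<integral>\<^sup>+z. indicator ?B (insert_coord k y z) \<partial>lborel \<partial>lines_measure k)"
    by (rule nn_integral_lines) measurable
  also have "\<dots> = (\<integral>\<^sup>+y. 0 \<partial>lines_measure k)"
  proof (rule nn_integral_cong_AE)
    show "AE y in lines_measure k. (\<integral>\<^sup>+z. indicator ?B (insert_coord k y z) \<partial>lborel) = (0::ennreal)"
      using lines
    proof eventually_elim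
      case (elim y)
      have "(\<integral>\<^sup>+z. indicator ?B (insert_coord k y z) \<partial>lborel) = (\<integral>\<^sup>+(z::real). 0 \<partial>lborel)"
        using elim by (intro nn_integral_cong_AE, eventually_elim) (use \<open>?B \<subseteq> A\<close> in \<open>auto simp: indicator_def\<close>)
      then show ?case by simp
    qed
  qed
  finally have "emeasure lborel ?B = 0" by simp
  then have "emeasure lebesgue A = 0" by (simp add: emeasure_completion[OF A])
  then show ?thesis using A by auto
qed

text \<open>A Borel representative agrees with \<open>F\<close> almost everywhere on almost every
  line, so its integral over such a line is that of \<open>g\<close>, which is 0.\<close>

lemma lebesgue_integral_eq_0_if_on_lines:
  fixes F :: "real ^ 'n::finite \<Rightarrow> real"
  assumes F: "integrable lebesgue F"
    and lines: "AE y in lines_measure k. \<exists>g. integrable lborel g \<and> (LBINT z. g z) = 0 \<and>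
       (AE z in lborel. F (insert_coord k y z) = g z)"
  shows "(\<integral>x. F x \<partial>lebesgue) = 0"
proof -
  obtain F' where F'[measurable]: "F' \<in> borel_measurable lborel" and ae: "AE x in lborel. F x = F' x"
    using completion_ex_borel_measurable_real[of F lborel] F by auto
  have "integrable lebesgue F'"
    by (rule integrable_cong_AE[THEN iffD1, OF _ _ AE_completion[OF ae] F])
       (use F in \<open>auto intro: measurable_completion\<close>)
  then have iF': "integrable lborel F'" by (subst (asm) integrable_completion) auto
  let ?f = "\<lambda>p. F' (insert_coord k (fst p) (snd p))"
  have ip: "integrable (lines_measure k \<Otimes>\<^sub>M lborel) ?f"
    using iF' by (subst (asm) lborel_eq_distr_lines[of k]) (erule integrable_distr[rotated], measurable)
  have "(\<integral>x. F x \<partial>lebesgue) = (\<integral>x. F' x \<partial>lebesgue)"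
    using F AE_completion[OF ae] by (intro integral_cong_AE) (auto intro: measurable_completion)
  also have "\<dots> = (\<integral>x. F' x \<partial>lborel)" by (rule integral_completion) simp
  also have "\<dots> = (\<integral>p. ?f p \<partial>(lines_measure k \<Otimes>\<^sub>M lborel))"
    by (subst lborel_eq_distr_lines[of k]) (rule integral_distr, auto)
  also have "\<dots> = (\<integral>y. (\<integral>z. ?f (y, z) \<partial>lborel) \<partial>lines_measure k)"
    by (rule pair_sigma_finite.integral_fst'[OF pair_sigma_finite_lines ip, symmetric])
  also have "\<dots> = (\<integral>y. 0 \<partial>lines_measure k)"
  proof (rule integral_cong_AE)
    show "(\<lambda>y. \<integral>z. ?f (y, z) \<partial>lborel) \<in> borel_measurable (lines_measure k)"
      using pair_sigma_finite.integrable_fst'[OF pair_sigma_finite_lines ip] by auto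
    show "AE y in lines_measure k. (\<integral>z. ?f (y, z) \<partial>lborel) = 0"
      using lines AE_lines[OF ae, of k] pair_sigma_finite.AE_integrable_fst'[OF pair_sigma_finite_lines ip]
    proof eventually_elim
      case (elim y)
      from elim(1) obtain g where g: "integrable lborel g" "(LBINT z. g z) = 0"
        "AE z in lborel. F (insert_coord k y z) = g z" by blast
      have "(\<integral>z. ?f (y, z) \<partial>lborel) = (LBINT z. g z)"
        using g(1) elim(3) g(3) elim(2) by (intro integral_cong_AE) auto
      then show ?case using g(2) by simp
    qed
  qed simp
  finally show ?thesis by simp
qed

section \<open>Test functions and uniqueness of weak derivatives\<close>

lemma poly_times_exp_minus_tendsto_0: "((\<lambda>s. poly p s * exp (- s)) \<longlongrightarrow> (0::real)) at_top"
proof -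
  have "((\<lambda>s. \<Sum>i\<le>degree p. coeff p i * (s ^ i / exp s)) \<longlongrightarrow> (\<Sum>i\<le>degree p. coeff p i * 0)) at_top"
    by (intro tendsto_intros tendsto_power_div_exp_0)
  moreover have "(\<lambda>s. poly p s * exp (- s)) = (\<lambda>s. \<Sum>i\<le>degree p. coeff p i * (s ^ i / exp s))"
    by (simp add: poly_altdef sum_distrib_right exp_minus divide_inverse mult.assoc)
  moreover have "(\<Sum>i\<le>degree p. coeff p i * 0) = 0" by simp
  ultimately show ?thesis by (simp only:)
qed

text \<open>The polynomial factors make the class of these functions closed under differentiation.\<close>

definition flat :: "real poly \<Rightarrow> real \<Rightarrow> real" where
  "flat p t = (if t \<le> 0 then 0 else poly p (1 / t) * exp (- (1 / t)))"

text \<open>With s = 1 / t, the derivative of p(s) * exp(-s) with respect to t is s^2 * (p - p')(s)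
  * exp(-s); the polynomial \<open>[:0, 0, 1:]\<close> is the factor s^2. At 0 the right difference
  quotient is s * p(s) * exp(-s), which tends to 0 as s grows.\<close>

lemma flat_has_derivative:
  "(flat p has_real_derivative flat ([:0, 0, 1:] * (p - pderiv p)) t) (at t)"
proof -
  consider "t < 0" | "t = 0" | "t > 0" by linarith
  then show ?thesis
  proof cases
    case 1
    have "((\<lambda>_. 0) has_real_derivative 0) (at t)" by simp
    then have "(flat p has_real_derivative 0) (at t)"
      by (rule has_field_derivative_transform_within_open[of _ _ _ "{..<0}"]) (use 1 in \<open>auto simp: flat_def\<close>)
    then show ?thesis using 1 by (simp add: flat_def)
  next
    case 3
    have "((\<lambda>t. poly p (1 / t) * exp (- (1 / t))) has_real_derivative
        poly (pderiv p) (1 / t) * (- 1 / t\<^sup>2) * exp (- (1 / t)) + exp (- (1 / t)) * (1 / t\<^sup>2) * poly p (1 / t)) (at t)"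
      using 3 by (auto intro!: derivative_eq_intros simp: power2_eq_square field_simps)
    then have "(flat p has_real_derivative
        poly (pderiv p) (1 / t) * (- 1 / t\<^sup>2) * exp (- (1 / t)) + exp (- (1 / t)) * (1 / t\<^sup>2) * poly p (1 / t)) (at t)"
      by (rule has_field_derivative_transform_within_open[of _ _ _ "{0<..}"]) (use 3 in \<open>auto simp: flat_def\<close>)
    moreover have "poly (pderiv p) (1 / t) * (- 1 / t\<^sup>2) * exp (- (1 / t)) + exp (- (1 / t)) * (1 / t\<^sup>2) * poly p (1 / t)
        = flat ([:0, 0, 1:] * (p - pderiv p)) t"
      using 3 by (simp add: flat_def power2_eq_square field_simps)
    ultimately show ?thesis by simp
  next
    case 2
    have "((\<lambda>h. (flat p (0 + h) - flat p 0) / h) \<longlongrightarrow> 0) (at 0)"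
    proof (rule filterlim_split_at)
      have "eventually (\<lambda>h. 0 = (flat p (0 + h) - flat p 0) / h) (at_left 0)"
        by (auto simp: eventually_at_filter flat_def)
      then show "((\<lambda>h. (flat p (0 + h) - flat p 0) / h) \<longlongrightarrow> 0) (at_left 0)"
        by (rule Lim_transform_eventually[OF tendsto_const])
      have "((\<lambda>h. poly (pCons 0 p) (inverse h) * exp (- inverse h)) \<longlongrightarrow> (0::real)) (at_right 0)"
        by (rule filterlim_compose[OF poly_times_exp_minus_tendsto_0 filterlim_inverse_at_top_right])
      moreover have "eventually (\<lambda>h. poly (pCons 0 p) (inverse h) * exp (- inverse h) = (flat p (0 + h) - flat p 0) / h) (at_right 0)"
        by (auto simp: eventually_at_filter flat_def field_simps)
      ultimately show "((\<lambda>h. (flat p (0 + h) - flat p 0) / h) \<longlongrightarrow> 0) (at_right 0)"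
        by (rule Lim_transform_eventually)
    qed
    then have "(flat p has_real_derivative 0) (at 0)" by (simp add: DERIV_def)
    then show ?thesis using 2 by (simp add: flat_def)
  qed
qed

lemma continuous_flat: "continuous_on UNIV (flat p)"
  by (rule DERIV_continuous_on) (rule has_field_derivative_at_within[OF flat_has_derivative])

lemma Ck_on_Suc_imp: "Ck_on (Suc m) S f \<Longrightarrow> Ck_on m S f"
proof (induction m arbitrary: f)
  case 0
  then obtain f' where "\<forall>x\<in>S. (f has_derivative f' x) (at x)" by auto
  then have "\<forall>x\<in>S. isCont f x" using has_derivative_continuous by blast
  then show ?case by (simp add: continuous_at_imp_continuous_on)
next
  case (Suc m)
  then obtain f' where f': "\<forall>x\<in>S. (f has_derivative f' x) (at x)" "\<forall>k. Ck_on (Suc m) S (\<lambda>x. f' x (axis k 1))"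
    by (auto simp del: Ck_on.simps simp: Ck_on.simps(2)[of "Suc m"])
  then have "\<forall>k. Ck_on m S (\<lambda>x. f' x (axis k 1))" using Suc.IH by blast
  then show ?case using f' by auto
qed

lemma Ck_on_add: "Ck_on m S f \<Longrightarrow> Ck_on m S g \<Longrightarrow> Ck_on m S (\<lambda>x. f x + g x)"
proof (induction m arbitrary: f g)
  case (Suc m)
  then obtain f' g' where f': "\<forall>x\<in>S. (f has_derivative f' x) (at x)" "\<forall>k. Ck_on m S (\<lambda>x. f' x (axis k 1))"
    and g': "\<forall>x\<in>S. (g has_derivative g' x) (at x)" "\<forall>k. Ck_on m S (\<lambda>x. g' x (axis k 1))" by auto
  show ?case unfolding Ck_on.simps
    by (rule exI[of _ "\<lambda>x h. f' x h + g' x h"]) (use f' g' Suc.IH in \<open>auto intro: has_derivative_add\<close>)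
qed (auto intro: continuous_on_add)

lemma Ck_on_mult: "Ck_on m S f \<Longrightarrow> Ck_on m S g \<Longrightarrow> Ck_on m S (\<lambda>x. f x * g x)"
proof (induction m arbitrary: f g)
  case (Suc m)
  then obtain f' g' where f': "\<forall>x\<in>S. (f has_derivative f' x) (at x)" "\<forall>k. Ck_on m S (\<lambda>x. f' x (axis k 1))"
    and g': "\<forall>x\<in>S. (g has_derivative g' x) (at x)" "\<forall>k. Ck_on m S (\<lambda>x. g' x (axis k 1))" by auto
  have fg: "Ck_on m S f" "Ck_on m S g" using Suc.prems Ck_on_Suc_imp by blast+
  show ?case unfolding Ck_on.simps
    by (rule exI[of _ "\<lambda>x h. f x * g' x h + f' x h * g x"])
       (use f' g' fg Suc.IH in \<open>auto intro!: has_derivative_mult Ck_on_add\<close>)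
qed (auto intro: continuous_on_mult)

lemma Ck_on_const: "Ck_on m S (\<lambda>x. c)"
proof (induction m arbitrary: c)
  case (Suc m)
  show ?case unfolding Ck_on.simps
    by (rule exI[of _ "\<lambda>x h. 0"]) (use Suc in auto)
qed simp

lemma Ck_on_prod: "finite I \<Longrightarrow> (\<And>i. i \<in> I \<Longrightarrow> Ck_on m S (f i)) \<Longrightarrow> Ck_on m S (\<lambda>x. \<Prod>i\<in>I. f i x)"
  by (induction I rule: finite_induct) (auto intro: Ck_on_const Ck_on_mult)

text \<open>Each differentiation changes both the constant and the polynomial, so the induction
  keeps \<open>c\<close> and \<open>p\<close> arbitrary.\<close>

lemma Ck_on_flat_coordinate: "Ck_on m UNIV (\<lambda>x. c * flat p (s * (x $ i) + r))"
proof (induction m arbitrary: c p)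
  case 0
  show ?case by (auto intro!: continuous_intros continuous_on_compose2[OF continuous_flat])
next
  case (Suc m)
  let ?q = "[:0, 0, 1:] * (p - pderiv p)"
  have "((\<lambda>x. c * flat p (s * (x $ i) + r)) has_derivative (\<lambda>h. c * (s * (h $ i) * flat ?q (s * (x $ i) + r)))) (at x)" for x
  proof -
    have "((\<lambda>x. s * (x $ i) + r) has_derivative (\<lambda>h. s * (h $ i))) (at x)"
      by (auto intro!: derivative_eq_intros bounded_linear_imp_has_derivative bounded_linear_vec_nth)
    moreover have "(flat p has_derivative (\<lambda>h. h * flat ?q (s * (x $ i) + r))) (at (s * (x $ i) + r))"
      using flat_has_derivative[of p "s * (x $ i) + r"]
      by (simp add: has_field_derivative_def mult_commute_abs)
    ultimately have "((\<lambda>x. flat p (s * (x $ i) + r)) has_derivative (\<lambda>h. s * (h $ i) * flat ?q (s * (x $ i) + r))) (at x)"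
      by (rule has_derivative_compose)
    then show ?thesis by (rule has_derivative_mult_right)
  qed
  then have D: "\<forall>x\<in>UNIV. ((\<lambda>x. c * flat p (s * (x $ i) + r)) has_derivative
      (\<lambda>x h. c * (s * (h $ i) * flat ?q (s * (x $ i) + r))) x) (at x)" by simp
  have "Ck_on m UNIV (\<lambda>x. c * (s * (axis j 1 $ i) * flat ?q (s * (x $ i) + r)))" for j
    using Suc[of "c * (s * (axis j 1 $ i))" ?q] by (simp add: mult.assoc)
  then show ?case unfolding Ck_on.simps
    by (intro exI[of _ "\<lambda>x h. c * (s * (h $ i) * flat ?q (s * (x $ i) + r))"] conjI allI D)
qed

text \<open>The trivial factors \<open>1\<close> bring the terms into the shape \<open>c * flat p (s * x $ i + r)\<close>, which is
  stable under partial differentiation.\<close>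

definition bump :: "real ^ 'n \<Rightarrow> real ^ 'n \<Rightarrow> nat \<Rightarrow> real ^ 'n \<Rightarrow> real" where
  "bump a b n x = (\<Prod>i\<in>UNIV. (1 * flat 1 (real (Suc n) * (x $ i) + (- real (Suc n) * (a $ i)))) *
                           (1 * flat 1 (- real (Suc n) * (x $ i) + real (Suc n) * (b $ i))))"

lemma Ck_on_bump: "Ck_on m UNIV (bump a b n)"
  unfolding bump_def[abs_def] by (intro Ck_on_prod Ck_on_mult Ck_on_flat_coordinate) simp

lemma flat_1_bounds: "0 \<le> flat 1 t" "flat 1 t \<le> 1" "flat 1 t \<noteq> 0 \<longleftrightarrow> t > 0"
  by (auto simp: flat_def)

lemma bump_arg: "real (Suc n) * x + (- real (Suc n) * a) = real (Suc n) * (x - a)"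
  "- real (Suc n) * x + real (Suc n) * b = real (Suc n) * (b - x)"
  by (auto simp: algebra_simps)

lemma bump_nonzero_iff: "bump a b n x \<noteq> 0 \<longleftrightarrow> x \<in> box a b"
  unfolding bump_def bump_arg by (simp add: flat_1_bounds mem_box_cart zero_less_mult_iff)

lemma bump_bounds: "\<bar>bump a b n x\<bar> \<le> 1"
  unfolding bump_def abs_prod abs_mult
  by (intro prod_le_1 conjI mult_le_one mult_nonneg_nonneg) (auto simp: flat_1_bounds)

lemma flat_1_scaled_tendsto: "t > 0 \<Longrightarrow> (\<lambda>n. flat 1 (real (Suc n) * t)) \<longlonglongrightarrow> 1"
proof -
  assume t: "t > 0"
  have "(\<lambda>n. exp (- (inverse (real (Suc n)) * (1 / t)))) \<longlonglongrightarrow> exp (- (0 * (1 / t)))"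
    by (intro tendsto_intros LIMSEQ_inverse_real_of_nat)
  moreover have "exp (- (inverse (real (Suc n)) * (1 / t))) = flat 1 (real (Suc n) * t)" for n
  proof -
    have "real (Suc n) * t > 0" using t by simp
    then show ?thesis by (simp add: flat_def inverse_eq_divide del: of_nat_Suc)
  qed
  ultimately show ?thesis by simp
qed

text \<open>Inside the open box the factor \<open>Suc n\<close> drives every argument to infinity,
  where \<open>flat 1\<close> tends to 1; outside it the product is 0 for every n.\<close>

lemma bump_tendsto: "(\<lambda>n. bump a b n x) \<longlonglongrightarrow> indicator (box a b) x"
proof (cases "x \<in> box a b")
  case True
  have "(\<lambda>n. bump a b n x) \<longlonglongrightarrow> (\<Prod>i\<in>(UNIV::'a set). (1 * 1) * (1 * 1))"
    unfolding bump_def bump_arg using True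
    by (intro tendsto_prod tendsto_mult tendsto_const flat_1_scaled_tendsto) (auto simp: mem_box_cart)
  then show ?thesis using True by simp
next
  case False
  then have "bump a b n x = 0" for n using bump_nonzero_iff by blast
  then show ?thesis using False by simp
qed

lemma bump_test_function:
  assumes "cbox a b \<subseteq> \<Omega>"
  shows "bump a b n \<in> test_functions \<Omega>"
proof -
  have "{x. bump a b n x \<noteq> 0} = box a b" using bump_nonzero_iff by blast
  moreover have "closure (box a b) \<subseteq> cbox a b" by (intro closure_minimal box_subset_cbox closed_cbox)
  ultimately show ?thesis
    unfolding test_functions_def using assms Ck_on_bump
    by (auto simp: compact_closure bounded_box)
qed

lemma test_function_props:
  assumes "\<psi> \<in> test_functions \<Omega>"
  shows "continuous_on UNIV \<psi>" "compact (closure {x. \<psi> x \<noteq> 0})" "closure {x. \<psi> x \<noteq> 0} \<subseteq> \<Omega>"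
    "\<And>x. x \<notin> closure {x. \<psi> x \<noteq> 0} \<Longrightarrow> \<psi> x = 0"
proof -
  have "Ck_on 0 UNIV \<psi>" using assms by (auto simp: test_functions_def simp del: Ck_on.simps)
  then show "continuous_on UNIV \<psi>" by simp
  show "\<And>x. x \<notin> closure {x. \<psi> x \<noteq> 0} \<Longrightarrow> \<psi> x = 0" using closure_subset[of "{x. \<psi> x \<noteq> 0}"] by blast
qed (use assms in \<open>auto simp: test_functions_def\<close>)

lemma integrable_compact_support_mult:
  fixes g \<psi> :: "real ^ 'n \<Rightarrow> real"
  assumes "open \<Omega>" and g: "locally_integrable \<Omega> g" and \<psi>: "continuous_on UNIV \<psi>"
    and K: "compact K" "K \<subseteq> \<Omega>" "\<And>x. x \<notin> K \<Longrightarrow> \<psi> x = 0"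
  shows "integrable (lebesgue_on \<Omega>) (\<lambda>x. g x * \<psi> x)" "integrable lebesgue (\<lambda>x. indicator K x * g x * \<psi> x)"
proof -
  have Km: "K \<in> sets lebesgue" using K(1) by (simp add: compact_imp_closed borel_closed)
  have Om: "\<Omega> \<in> sets lebesgue" using \<open>open \<Omega>\<close> by simp
  have "integrable (lebesgue_on K) g" using g K by (simp add: locally_integrable_def)
  then have gK: "integrable lebesgue (\<lambda>x. indicator K x * g x)"
    using Km by (simp add: integrable_restrict_space)
  have "bounded (\<psi> ` K)" by (intro compact_imp_bounded compact_continuous_image continuous_on_subset[OF \<psi>] K) auto
  then obtain B where B: "\<And>x. x \<in> K \<Longrightarrow> \<bar>\<psi> x\<bar> \<le> B" "B > 0" by (auto simp: bounded_pos)
  have \<psi>m: "\<psi> \<in> borel_measurable lebesgue"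
    using \<psi> by (auto intro!: measurable_completion borel_measurable_continuous_onI)
  have bnd: "integrable lebesgue (\<lambda>x. B * (indicator K x * g x))" using gK by simp
  show i: "integrable lebesgue (\<lambda>x. indicator K x * g x * \<psi> x)"
  proof (rule Bochner_Integration.integrable_bound[OF bnd])
    show "(\<lambda>x. indicator K x * g x * \<psi> x) \<in> borel_measurable lebesgue" using gK \<psi>m by measurable
    show "AE x in lebesgue. norm (indicator K x * g x * \<psi> x) \<le> norm (B * (indicator K x * g x))"
      using B by (intro AE_I2) (auto simp: indicator_def abs_mult mult.commute intro!: mult_right_mono)
  qed
  have "(\<lambda>x. indicator \<Omega> x * (g x * \<psi> x)) = (\<lambda>x. indicator K x * g x * \<psi> x)"
    using K by (fastforce simp: indicator_def fun_eq_iff)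
  then show "integrable (lebesgue_on \<Omega>) (\<lambda>x. g x * \<psi> x)"
    using i Om by (simp add: integrable_restrict_space)
qed

section \<open>The fundamental lemma of the calculus of variations\<close>

lemma indicator_box_borel_lebesgue: "indicat_real (box a b) \<in> borel_measurable lebesgue"
  by (intro borel_measurable_indicator) simp

text \<open>Since \<open>ennreal\<close> cuts negative numbers to 0, the two densities are the
  positive and the negative part of a Borel representative. The measures agree on open boxes, an
  intersection-stable generator, hence everywhere; a function whose positive and negative parts
  agree is 0.\<close>

lemma AE_zero_if_box_integrals_zero:
  fixes h :: "real ^ 'n \<Rightarrow> real"
  assumes h: "integrable lebesgue h" and box: "\<And>a b. (\<integral>x. indicator (box a b) x * h x \<partial>lebesgue) = 0"
  shows "AE x in lebesgue. h x = 0"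
proof -
  obtain f where f[measurable]: "f \<in> borel_measurable lborel" and ae: "AE x in lborel. h x = f x"
    using completion_ex_borel_measurable_real[of h lborel] h by auto
  have fl: "f \<in> borel_measurable lebesgue" using f by (rule measurable_completion)
  have "integrable lebesgue f"
    by (rule integrable_cong_AE[THEN iffD1, OF _ fl AE_completion[OF ae] h]) (use h in auto)
  then have fi: "integrable lborel f" by (subst (asm) integrable_completion) auto
  have fbox: "(\<integral>x. indicator (box a b) x * f x \<partial>lborel) = 0" for a b
  proof -
    have "(\<integral>x. indicator (box a b) x * f x \<partial>lborel) = (\<integral>x. indicator (box a b) x * f x \<partial>lebesgue)"
      by (rule integral_completion[symmetric]) measurable
    also have "\<dots> = (\<integral>x. indicator (box a b) x * h x \<partial>lebesgue)"
    proof (rule integral_cong_AE)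
      show "AE x in lebesgue. indicator (box a b) x * f x = indicator (box a b) x * h x"
        using AE_completion[OF ae] by eventually_elim simp
    qed (use fl h indicator_box_borel_lebesgue in \<open>auto intro!: borel_measurable_times\<close>)
    finally show ?thesis using box by simp
  qed
  let ?P = "density lborel (\<lambda>x. ennreal (f x))" and ?N = "density lborel (\<lambda>x. ennreal (- f x))"
  have "?P = ?N"
  proof (rule measure_eqI_generator_eq[where A = "\<lambda>n. box (- (real n *\<^sub>R One)) (real n *\<^sub>R One)"])
    let ?E = "range (\<lambda>(a, b). box a b :: (real ^ 'n) set)"
    show "Int_stable ?E" by (auto simp: Int_stable_def box_Int_box)
    show "?E \<subseteq> Pow UNIV" by simp
    show "range (\<lambda>n. box (- (real n *\<^sub>R One)) (real n *\<^sub>R One)) \<subseteq> ?E" by auto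
    show "(\<Union>n. box (- (real n *\<^sub>R One)) (real n *\<^sub>R One)) = (UNIV :: (real ^ 'n) set)"
      by (rule UN_box_eq_UNIV)
    show "sets ?P = sigma_sets UNIV ?E" "sets ?N = sigma_sets UNIV ?E"
      by (simp_all add: borel_eq_box sets_measure_of)
    fix X assume "X \<in> ?E"
    then obtain a b where X: "X = box a b" by auto
    have i: "integrable lborel (\<lambda>x. indicator X x * f x)"
      using integrable_mult_indicator[OF _ fi, of X] X by simp
    have "(\<integral>x. max 0 (indicator X x * f x) \<partial>lborel) - (\<integral>x. max 0 (- (indicator X x * f x)) \<partial>lborel) = 0"
    proof (subst Bochner_Integration.integral_diff[symmetric])
      have "max 0 y - max 0 (- y) = y" for y :: real by simp
      then show "(\<integral>x. max 0 (indicator X x * f x) - max 0 (- (indicator X x * f x)) \<partial>lborel) = 0"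
        using fbox[of a b] X by simp
    qed (use i in \<open>auto intro!: Bochner_Integration.integrable_max\<close>)
    then have eq: "(\<integral>x. max 0 (indicator X x * f x) \<partial>lborel) = (\<integral>x. max 0 (- (indicator X x * f x)) \<partial>lborel)" by simp
    have "emeasure ?P X = (\<integral>\<^sup>+x. ennreal (max 0 (indicator X x * f x)) \<partial>lborel)"
      using X by (subst emeasure_density) (auto intro!: nn_integral_cong simp: indicator_def max_def ennreal_neg)
    also have "\<dots> = ennreal (\<integral>x. max 0 (indicator X x * f x) \<partial>lborel)"
      using i by (intro nn_integral_eq_integral) auto
    also have "\<dots> = (\<integral>\<^sup>+x. ennreal (max 0 (- (indicator X x * f x))) \<partial>lborel)"
      unfolding eq using i by (intro nn_integral_eq_integral[symmetric]) auto
    also have "\<dots> = emeasure ?N X"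
      using X by (subst emeasure_density) (auto intro!: nn_integral_cong simp: indicator_def max_def ennreal_neg)
    finally show "emeasure ?P X = emeasure ?N X" .
  next
    fix n
    have "emeasure ?P (box (- (real n *\<^sub>R One)) (real n *\<^sub>R One)) \<le> emeasure ?P UNIV" by (rule emeasure_mono) auto
    also have "\<dots> = (\<integral>\<^sup>+x. ennreal (f x) \<partial>lborel)" by (subst emeasure_density) auto
    also have "\<dots> \<le> (\<integral>\<^sup>+x. ennreal (norm (f x)) \<partial>lborel)" by (intro nn_integral_mono ennreal_leI) auto
    also have "\<dots> < \<infinity>" using fi by (simp add: integrable_iff_bounded)
    finally show "emeasure ?P (box (- (real n *\<^sub>R One)) (real n *\<^sub>R One)) \<noteq> \<infinity>" by simp
  qed
  then have "AE x in lborel. ennreal (f x) = ennreal (- f x)"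
    by (intro sigma_finite_measure.density_unique[OF sigma_finite_lborel]) auto
  then have "AE x in lborel. h x = 0"
    using ae
  proof eventually_elim
    case (elim x)
    then show ?case by (cases "f x" "0 :: real" rule: linorder_cases) (auto simp: ennreal_neg)
  qed
  then show ?thesis by (rule AE_completion)
qed

text \<open>Bumps converge boundedly to the indicator of a box, so dominated convergence turns
  vanishing test integrals into vanishing box integrals. The function is only locally integrable, so
  the conclusion is drawn on closed boxes, countably many of which fill
  \<open>\<Omega>\<close>.\<close>

lemma AE_zero_if_test_integrals_zero:
  fixes h :: "real ^ 'n \<Rightarrow> real"
  assumes "open \<Omega>" and h: "locally_integrable \<Omega> h"
    and test: "\<And>\<psi>. \<psi> \<in> test_functions \<Omega> \<Longrightarrow> (\<integral>x. h x * \<psi> x \<partial>lebesgue_on \<Omega>) = 0"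
  shows "AE x in lebesgue_on \<Omega>. h x = 0"
proof -
  have Om: "\<Omega> \<in> sets lebesgue" using \<open>open \<Omega>\<close> by simp
  have hK: "integrable lebesgue (\<lambda>x. indicator (cbox c d) x * h x)" if "cbox c d \<subseteq> \<Omega>" for c d
  proof -
    have "integrable (lebesgue_on (cbox c d)) h" using h that by (simp add: locally_integrable_def)
    then show ?thesis by (simp add: integrable_restrict_space)
  qed
  have zero: "(\<integral>x. indicator (box a b) x * h x \<partial>lebesgue) = 0" if ab: "cbox a b \<subseteq> \<Omega>" for a b
  proof -
    let ?s = "\<lambda>n x. indicator (cbox a b) x * h x * bump a b n x"
    have ind: "indicator (box a b) x * h x = indicator (cbox a b) x * h x * indicator (box a b) x" for x
      using box_subset_cbox by (auto simp: indicator_def)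
    have c: "continuous_on UNIV (bump a b n)" and z: "\<And>x. x \<notin> cbox a b \<Longrightarrow> bump a b n x = 0" for n
      using test_function_props(1)[OF bump_test_function[OF ab]] bump_nonzero_iff[of a b n] box_subset_cbox by blast+
    have si: "integrable lebesgue (?s n)" for n
      by (rule integrable_compact_support_mult(2)[OF \<open>open \<Omega>\<close> h c compact_cbox ab z])
    have hb: "(\<lambda>x. indicator (box a b) x * h x) \<in> borel_measurable lebesgue"
      unfolding ind
      by (rule borel_measurable_times[OF borel_measurable_integrable[OF hK[OF ab]] indicator_box_borel_lebesgue])
    have lim: "(\<lambda>n. \<integral>x. ?s n x \<partial>lebesgue) \<longlonglongrightarrow> (\<integral>x. indicator (box a b) x * h x \<partial>lebesgue)"
    proof (rule integral_dominated_convergence[where w = "\<lambda>x. \<bar>indicator (cbox a b) x * h x\<bar>"])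
      show "integrable lebesgue (\<lambda>x. \<bar>indicator (cbox a b) x * h x\<bar>)" using hK[OF ab] by (rule integrable_abs)
      show "AE x in lebesgue. (\<lambda>n. ?s n x) \<longlonglongrightarrow> indicator (box a b) x * h x"
        unfolding ind by (intro AE_I2 tendsto_mult tendsto_const bump_tendsto)
      show "AE x in lebesgue. norm (?s n x) \<le> \<bar>indicator (cbox a b) x * h x\<bar>" for n
        by (rule AE_I2) (simp add: abs_mult mult_left_le bump_bounds)
      show "?s n \<in> borel_measurable lebesgue" for n using si by auto
    qed (rule hb)
    moreover have "(\<integral>x. ?s n x \<partial>lebesgue) = 0" for n
    proof -
      have "(\<lambda>x. indicator \<Omega> x * (h x * bump a b n x)) = ?s n"
        using ab z by (fastforce simp: indicator_def fun_eq_iff)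
      then have "(\<integral>x. ?s n x \<partial>lebesgue) = (\<integral>x. h x * bump a b n x \<partial>lebesgue_on \<Omega>)"
        using Om by (simp add: integral_restrict_space)
      then show ?thesis using test[OF bump_test_function[OF ab]] by simp
    qed
    ultimately show ?thesis using LIMSEQ_unique[OF _ tendsto_const] by fastforce
  qed
  \<comment> \<open>Cut to a closed box, \<open>h\<close> is integrable on the whole space; an
    arbitrary open box meets the given one in a box up to faces of measure zero, where
    \<open>zero\<close> applies.\<close>
  have cb: "AE x in lebesgue. x \<in> cbox c d \<longrightarrow> h x = 0" if cd: "cbox c d \<subseteq> \<Omega>" for c d
  proof -
    have nf: "AE x in lebesgue. x \<notin> cbox c d - box c d"
      by (intro AE_not_in) (use negligible_frontier_interval negligible_iff_null_sets in blast)
    have "AE x in lebesgue. indicator (cbox c d) x * h x = 0"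
    proof (rule AE_zero_if_box_integrals_zero[OF hK[OF cd]])
      fix a b
      have hm: "(\<lambda>x. indicator (box p q) x * (indicator (cbox c d) x * h x)) \<in> borel_measurable lebesgue" for p q
        by (rule borel_measurable_times[OF indicator_box_borel_lebesgue borel_measurable_integrable[OF hK[OF cd]]])
      obtain a' b' where ab': "box a b \<inter> box c d = box a' b'"
        using box_Int_box[of a b c d] by blast
      then have mem: "x \<in> box a' b' \<longleftrightarrow> x \<in> box a b \<and> x \<in> box c d" for x by blast
      show "(\<integral>x. indicator (box a b) x * (indicator (cbox c d) x * h x) \<partial>lebesgue) = 0"
      proof (cases "box a' b' = {}")
        case True
        have "(\<integral>x. indicator (box a b) x * (indicator (cbox c d) x * h x) \<partial>lebesgue) = (\<integral>x. 0 \<partial>(lebesgue :: (real ^ 'n) measure))"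
        proof (rule integral_cong_AE)
          show "AE x in lebesgue. indicator (box a b) x * (indicator (cbox c d) x * h x) = 0"
            using nf by eventually_elim (use mem True in \<open>auto simp: indicator_def\<close>)
        qed (use hm in auto)
        then show ?thesis by simp
      next
        case False
        have "box a' b' \<subseteq> box c d" using ab' by blast
        then have "cbox a' b' \<subseteq> cbox c d" using False
          by (metis closure_box closure_minimal box_subset_cbox closed_cbox order_trans)
        then have "cbox a' b' \<subseteq> \<Omega>" using cd by blast
        then have "(\<integral>x. indicator (box a' b') x * h x \<partial>lebesgue) = 0" by (rule zero)
        moreover have "(\<integral>x. indicator (box a b) x * (indicator (cbox c d) x * h x) \<partial>lebesgue) =
            (\<integral>x. indicator (box a' b') x * (indicator (cbox c d) x * h x) \<partial>lebesgue)"
        proof (rule integral_cong_AE)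
          show "AE x in lebesgue. indicator (box a b) x * (indicator (cbox c d) x * h x) =
              indicator (box a' b') x * (indicator (cbox c d) x * h x)"
            using nf by eventually_elim (auto simp: indicator_def mem)
        qed (use hm in auto)
        moreover have "indicator (box a' b') x * (indicator (cbox c d) x * h x) = indicator (box a' b') x * h x" for x
          using \<open>box a' b' \<subseteq> box c d\<close> box_subset_cbox by (auto simp: indicator_def)
        ultimately show ?thesis by simp
      qed
    qed
    then show ?thesis by eventually_elim (auto simp: indicator_def)
  qed
  obtain \<D> where \<D>: "countable \<D>" "\<D> \<subseteq> Pow \<Omega>" "\<And>X. X \<in> \<D> \<Longrightarrow> \<exists>a b. X = cbox a b" "\<Union>\<D> = \<Omega>"
    using open_countable_Union_open_cbox[OF \<open>open \<Omega>\<close>] by blast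
  have "AE x in lebesgue. x \<in> X \<longrightarrow> h x = 0" if "X \<in> \<D>" for X
    using \<D>(2) \<D>(3)[OF that] that cb by blast
  then have "AE x in lebesgue. \<forall>X\<in>\<D>. x \<in> X \<longrightarrow> h x = 0"
    unfolding AE_ball_countable[OF \<D>(1)] by blast
  then have "AE x in lebesgue. x \<in> \<Omega> \<longrightarrow> h x = 0"
    by eventually_elim (use \<D>(4) in blast)
  then show ?thesis using Om by (simp add: AE_restrict_space_iff)
qed

lemma weak_partial_unique:
  assumes "open \<Omega>" and g1: "has_weak_partial \<Omega> k u g1" and g2: "has_weak_partial \<Omega> k u g2"
  shows "AE x in lebesgue_on \<Omega>. g1 x = g2 x"
proof -
  have li: "locally_integrable \<Omega> g1" "locally_integrable \<Omega> g2" using g1 g2 by (auto simp: has_weak_partial_def)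
  have "AE x in lebesgue_on \<Omega>. g1 x - g2 x = 0"
  proof (rule AE_zero_if_test_integrals_zero[OF \<open>open \<Omega>\<close>])
    show "locally_integrable \<Omega> (\<lambda>x. g1 x - g2 x)"
      using li unfolding locally_integrable_def by auto
    fix \<psi> assume \<psi>: "\<psi> \<in> test_functions \<Omega>"
    note i = integrable_compact_support_mult(1)[OF \<open>open \<Omega>\<close> _ test_function_props[OF \<psi>]]
    have "(\<integral>x. g1 x * \<psi> x \<partial>lebesgue_on \<Omega>) = (\<integral>x. g2 x * \<psi> x \<partial>lebesgue_on \<Omega>)"
      using g1 g2 \<psi> unfolding has_weak_partial_def by (metis neg_equal_iff_equal)
    then show "(\<integral>x. (g1 x - g2 x) * \<psi> x \<partial>lebesgue_on \<Omega>) = 0"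
      using i[OF li(1)] i[OF li(2)] by (simp add: left_diff_distrib)
  qed
  then show ?thesis by simp
qed

section \<open>Modulars of weak Phi-functions\<close>

lemma ennreal_two_power: "(2 :: ennreal) ^ n = ennreal (2 ^ n)"
  by (metis ennreal_numeral ennreal_power zero_le_numeral)

text \<open>The existentially quantified constants of the theorem become the parameters
  \<open>L\<close> and \<open>\<beta>\<close>, so that estimates can depend on them
  explicitly.\<close>

locale weak_Phi_space =
  fixes \<Omega> :: "(real ^ 'n) set" and \<phi> :: "real ^ 'n \<Rightarrow> real \<Rightarrow> ennreal" and L \<beta> :: real
  assumes open_\<Omega>: "open \<Omega>"
    and measurable_Phi_abs: "\<And>f :: real ^ 'n \<Rightarrow> ereal. f \<in> borel_measurable (lebesgue_on \<Omega>) \<Longrightarrow>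
        (\<lambda>x. Phi_ext \<phi> x (e2ennreal \<bar>f x\<bar>)) \<in> borel_measurable (lebesgue_on \<Omega>)"
    and phi_mono: "\<And>x. x \<in> \<Omega> \<Longrightarrow> mono_on {0..} (\<phi> x)"
    and phi_0: "\<And>x. x \<in> \<Omega> \<Longrightarrow> \<phi> x 0 = 0"
    and phi_at_top: "\<And>x. x \<in> \<Omega> \<Longrightarrow> (\<phi> x \<longlongrightarrow> \<infinity>) at_top"
    and L: "L \<ge> 1"
    and almost_incr: "\<And>x s t. x \<in> \<Omega> \<Longrightarrow> 0 < s \<Longrightarrow> s < t \<Longrightarrow>
        \<phi> x s / ennreal s \<le> ennreal L * (\<phi> x t / ennreal t)"
    and \<beta>: "\<beta> > 0" "AE x in lebesgue_on \<Omega>. \<phi> x \<beta> \<ge> 1"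
begin

lemma \<Omega>_sets [simp]: "\<Omega> \<in> sets lebesgue"
  using open_\<Omega> by simp

abbreviation P :: "real ^ 'n \<Rightarrow> ennreal \<Rightarrow> ennreal" where "P \<equiv> Phi_ext \<phi>"

lemma P_infty [simp]: "P x \<infinity> = \<infinity>" "P x top = top"
  by (auto simp: Phi_ext_def)

lemma P_ennreal: "0 \<le> t \<Longrightarrow> P x (ennreal t) = \<phi> x t"
  by (simp add: Phi_ext_def)

lemma P_0: "x \<in> \<Omega> \<Longrightarrow> P x 0 = 0"
  using phi_0 by (simp add: Phi_ext_def)

lemma P_mono: "x \<in> \<Omega> \<Longrightarrow> s \<le> t \<Longrightarrow> P x s \<le> P x t"
proof (cases t)
  case (real r)
  assume x: "x \<in> \<Omega>" and "s \<le> t"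
  then obtain q where q: "s = ennreal q" "0 \<le> q" "q \<le> r" using real by (cases s) (auto simp: top_unique)
  then show ?thesis using real phi_mono[OF x] by (auto simp: P_ennreal mono_on_def)
qed simp

lemma P_measurable:
  assumes g: "g \<in> borel_measurable (lebesgue_on \<Omega>)"
  shows "(\<lambda>x. P x (g x)) \<in> borel_measurable (lebesgue_on \<Omega>)"
proof -
  have "(\<lambda>x. enn2ereal (g x)) \<in> borel_measurable (lebesgue_on \<Omega>)" using g by measurable
  from measurable_Phi_abs[OF this] show ?thesis by simp
qed

text \<open>The almost monotonicity of the quotient, applied to c * t and t. It compares positive
  reals under a strict inequality, so 0, \<infinity> and c = 1 are separate cases.\<close>

lemma P_scale:
  assumes x: "x \<in> \<Omega>" and c: "0 < c" "c \<le> 1"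
  shows "P x (ennreal c * t) \<le> ennreal (L * c) * P x t"
proof (cases t)
  case top
  have "ennreal (L * c) * top = top" using L c by (simp add: ennreal_mult_eq_top_iff)
  then show ?thesis using top by simp
next
  case (real r)
  consider "r = 0" | "c = 1" | "r > 0" "c < 1" using real c by linarith
  then show ?thesis
  proof cases
    case 1
    then show ?thesis using real x by (simp add: P_0)
  next
    case 2
    have "1 * P x t \<le> ennreal L * P x t" using L by (intro mult_right_mono) auto
    then show ?thesis using 2 by simp
  next
    case 3
    have "\<phi> x (c * r) / ennreal (c * r) \<le> ennreal L * (\<phi> x r / ennreal r)"
      using 3 c by (intro almost_incr x) auto
    then have "\<phi> x (c * r) / ennreal (c * r) * ennreal (c * r) \<le> ennreal L * (\<phi> x r / ennreal r) * ennreal (c * r)"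
      by (rule mult_right_mono) simp
    moreover have "\<phi> x (c * r) / ennreal (c * r) * ennreal (c * r) = \<phi> x (c * r)"
      using 3 c by (simp add: ennreal_divide_times mult_divide_eq_ennreal)
    moreover have "ennreal L * (\<phi> x r / ennreal r) * ennreal (c * r) = ennreal (L * c) * \<phi> x r"
    proof -
      have "ennreal L * (\<phi> x r / ennreal r) * ennreal (c * r) = ennreal L * ennreal c * (\<phi> x r / ennreal r * ennreal r)"
        using 3 c by (simp add: ennreal_mult ac_simps)
      also have "\<phi> x r / ennreal r * ennreal r = \<phi> x r"
        using 3 by (simp add: ennreal_divide_times mult_divide_eq_ennreal)
      finally show ?thesis using L c by (simp add: ennreal_mult)
    qed
    ultimately have "\<phi> x (c * r) \<le> ennreal (L * c) * \<phi> x r" by simp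
    then show ?thesis using real c by (simp add: P_ennreal ennreal_mult[symmetric])
  qed
qed

text \<open>If t > \<beta>, scaling by c = \<beta> / t gives 1 \<le> \<open>\<phi> x \<beta>\<close>
  \<le> L * c * \<open>\<phi> x t\<close>. The null set comes from the bound at
  \<open>\<beta>\<close> alone and is therefore independent of t. This is the source of local
  integrability.\<close>

lemma AE_le_P: "AE x in lebesgue_on \<Omega>. \<forall>t. t \<le> ennreal \<beta> + ennreal (L * \<beta>) * P x t"
proof -
  have "AE x in lebesgue_on \<Omega>. x \<in> \<Omega>" by (rule AE_I2) simp
  then show ?thesis using \<beta>(2)
  proof eventually_elim
    case (elim x)
    show ?case
    proof
      fix t
      show "t \<le> ennreal \<beta> + ennreal (L * \<beta>) * P x t"
      proof (cases t)
        case top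
        have "ennreal (L * \<beta>) * top = top" using L \<beta> by (simp add: ennreal_mult_eq_top_iff)
        then show ?thesis using top by simp
      next
        case (real r)
        show ?thesis
        proof (cases "r \<le> \<beta>")
          case True
          then have "t \<le> ennreal \<beta>" using real by (simp add: ennreal_leI)
          then show ?thesis by (rule order_trans) simp
        next
          case False
          then have r: "\<beta> < r" "0 < r" using \<beta> by auto
          define c where "c = \<beta> / r"
          have c: "0 < c" "c \<le> 1" "c * r = \<beta>" using r \<beta> by (auto simp: c_def)
          have "1 \<le> P x (ennreal c * t)"
            using elim(2) c real \<beta> by (simp add: ennreal_mult[symmetric] P_ennreal)
          also have "\<dots> \<le> ennreal (L * c) * P x t" by (rule P_scale[OF elim(1) c(1,2)])
          finally have "ennreal r * 1 \<le> ennreal r * (ennreal (L * c) * P x t)" by (rule mult_left_mono) simp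
          also have "\<dots> = ennreal (L * \<beta>) * P x t"
            using c r L by (simp add: mult.assoc[symmetric] ennreal_mult[symmetric]) (metis mult.commute mult.assoc)
          finally have "t \<le> ennreal (L * \<beta>) * P x t" using real by simp
          then show ?thesis by (rule order_trans) simp
        qed
      qed
    qed
  qed
qed

lemma AE_in_\<Omega>: "AE x in lebesgue_on \<Omega>. x \<in> \<Omega>"
  by (rule AE_I2) simp

section \<open>Estimates for modular and Luxemburg norm\<close>

lemma modular_mono:
  assumes "AE x in lebesgue_on \<Omega>. f x \<le> g x"
  shows "modular \<Omega> \<phi> f \<le> modular \<Omega> \<phi> g"
  unfolding modular_def using assms AE_in_\<Omega>
  by (intro nn_integral_mono_AE, eventually_elim) (rule P_mono)

lemma lux_norm_less_iff:
  "lux_norm \<Omega> \<phi> g < ennreal c \<longleftrightarrow> (\<exists>l. 0 < l \<and> l < c \<and> modular \<Omega> \<phi> (\<lambda>x. g x / ennreal l) \<le> 1)"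
  unfolding lux_norm_def Inf_less_iff by (auto simp: ennreal_less_iff less_imp_le)

lemma lux_norm_le: "0 < l \<Longrightarrow> modular \<Omega> \<phi> (\<lambda>x. g x / ennreal l) \<le> 1 \<Longrightarrow> lux_norm \<Omega> \<phi> g \<le> ennreal l"
  unfolding lux_norm_def by (intro Inf_lower) auto

lemma lux_norm_mono:
  assumes "AE x in lebesgue_on \<Omega>. f x \<le> g x"
  shows "lux_norm \<Omega> \<phi> f \<le> lux_norm \<Omega> \<phi> g"
  unfolding lux_norm_def
proof (rule Inf_superset_mono, safe)
  fix l assume "0 < l" "modular \<Omega> \<phi> (\<lambda>x. g x / ennreal l) \<le> 1"
  moreover have "modular \<Omega> \<phi> (\<lambda>x. f x / ennreal l) \<le> modular \<Omega> \<phi> (\<lambda>x. g x / ennreal l)"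
    using assms by (intro modular_mono, eventually_elim) (rule divide_right_mono_ennreal)
  ultimately show "\<exists>l'. ennreal l = ennreal l' \<and> 0 < l' \<and> modular \<Omega> \<phi> (\<lambda>x. f x / ennreal l') \<le> 1"
    by (auto intro: order_trans)
qed

lemma modular_scale:
  assumes g: "g \<in> borel_measurable (lebesgue_on \<Omega>)" and c: "0 < c" "c \<le> 1"
  shows "modular \<Omega> \<phi> (\<lambda>x. ennreal c * g x) \<le> ennreal (L * c) * modular \<Omega> \<phi> g"
proof -
  have "modular \<Omega> \<phi> (\<lambda>x. ennreal c * g x) \<le> (\<integral>\<^sup>+x. ennreal (L * c) * P x (g x) \<partial>lebesgue_on \<Omega>)"
    unfolding modular_def using AE_in_\<Omega> by (intro nn_integral_mono_AE, eventually_elim) (rule P_scale[OF _ c])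
  also have "\<dots> = ennreal (L * c) * modular \<Omega> \<phi> g"
    unfolding modular_def by (rule nn_integral_cmult[OF P_measurable[OF g]])
  finally show ?thesis .
qed

lemma nn_integral_le_modular:
  assumes g[measurable]: "g \<in> borel_measurable (lebesgue_on \<Omega>)" and A: "A \<in> sets lebesgue" "A \<subseteq> \<Omega>"
  shows "(\<integral>\<^sup>+x\<in>A. g x \<partial>lebesgue_on \<Omega>) \<le> ennreal \<beta> * emeasure lebesgue A + ennreal (L * \<beta>) * modular \<Omega> \<phi> g"
proof -
  have A'[measurable]: "A \<in> sets (lebesgue_on \<Omega>)" using A by (simp add: sets_restrict_space_iff)
  note [measurable] = P_measurable[OF g]
  have "(\<integral>\<^sup>+x\<in>A. g x \<partial>lebesgue_on \<Omega>) \<le>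
      (\<integral>\<^sup>+x. ennreal \<beta> * indicator A x + ennreal (L * \<beta>) * P x (g x) \<partial>lebesgue_on \<Omega>)"
    using AE_le_P by (intro nn_integral_mono_AE, eventually_elim) (auto simp: indicator_def)
  also have "\<dots> = ennreal \<beta> * emeasure (lebesgue_on \<Omega>) A + ennreal (L * \<beta>) * modular \<Omega> \<phi> g"
    by (simp add: nn_integral_add nn_integral_cmult nn_integral_cmult_indicator modular_def)
  also have "emeasure (lebesgue_on \<Omega>) A = emeasure lebesgue A"
    using A by (simp add: emeasure_restrict_space)
  finally show ?thesis .
qed

text \<open>Dividing \<open>g\<close> by some l below \<open>c\<close> makes its modular at most 1.
  The factor multiplying \<open>c\<close> depends on the set only, so on a set of finite measure
  small norm forces small integral.\<close>

lemma nn_integral_le_lux_norm: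
  assumes g: "g \<in> borel_measurable (lebesgue_on \<Omega>)" and A: "A \<in> sets lebesgue" "A \<subseteq> \<Omega>"
    and less: "lux_norm \<Omega> \<phi> g < ennreal c"
  shows "(\<integral>\<^sup>+x\<in>A. g x \<partial>lebesgue_on \<Omega>) \<le> ennreal c * (ennreal \<beta> * emeasure lebesgue A + ennreal (L * \<beta>))"
proof -
  obtain l where l: "0 < l" "l < c" "modular \<Omega> \<phi> (\<lambda>x. g x / ennreal l) \<le> 1"
    using less lux_norm_less_iff by blast
  have A': "A \<in> sets (lebesgue_on \<Omega>)" using A by (simp add: sets_restrict_space_iff)
  have gl: "(\<lambda>x. g x / ennreal l) \<in> borel_measurable (lebesgue_on \<Omega>)" using g by measurable
  have eq: "ennreal l * (g x / ennreal l) = g x" for x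
    using l by (metis ennreal_eq_0_iff ennreal_mult_divide_eq ennreal_neq_top ennreal_times_divide mult.commute not_le)
  have "(\<integral>\<^sup>+x\<in>A. g x \<partial>lebesgue_on \<Omega>) = (\<integral>\<^sup>+x. ennreal l * (g x / ennreal l * indicator A x) \<partial>lebesgue_on \<Omega>)"
    by (simp add: mult.assoc[symmetric] eq)
  also have "\<dots> = ennreal l * (\<integral>\<^sup>+x\<in>A. g x / ennreal l \<partial>lebesgue_on \<Omega>)"
  proof -
    note [measurable] = g A'
    show ?thesis by (intro nn_integral_cmult) measurable
  qed
  also have "\<dots> \<le> ennreal c * (ennreal \<beta> * emeasure lebesgue A + ennreal (L * \<beta>) * 1)"
  proof (rule mult_mono)
    show "ennreal l \<le> ennreal c" using l by (intro ennreal_leI) simp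
    show "(\<integral>\<^sup>+x\<in>A. g x / ennreal l \<partial>lebesgue_on \<Omega>) \<le> ennreal \<beta> * emeasure lebesgue A + ennreal (L * \<beta>) * 1"
      by (rule order_trans[OF nn_integral_le_modular[OF gl A]]) (intro add_left_mono mult_left_mono l(3), simp)
  qed simp_all
  finally show ?thesis by simp
qed

text \<open>The modular has no triangle inequality; instead, the sum is bounded by one of the terms
  \<open>2 ^ (j + 2) * v j\<close>, because the reciprocals of the factors sum to less than one.\<close>

lemma P_suminf:
  assumes x: "x \<in> \<Omega>"
  shows "P x (\<Sum>j. v j) \<le> (\<Sum>j. P x (2 ^ (j + 2) * v j))"
proof -
  have ex: "\<exists>j. ennreal N < 2 ^ (j + 2) * v j" if N: "0 < N" "ennreal (N / 2) < (\<Sum>j. v j)" for N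
  proof (rule ccontr)
    assume "\<not> ?thesis"
    then have le: "2 ^ (j + 2) * v j \<le> ennreal N" for j by (simp add: not_less)
    have "v j \<le> ennreal (N / 4 * (1 / 2) ^ j)" for j
    proof -
      have "ennreal ((1 / 2) ^ (j + 2)) * (2 ^ (j + 2) * v j) \<le> ennreal ((1 / 2) ^ (j + 2)) * ennreal N"
        using le by (rule mult_left_mono) simp
      moreover have "ennreal ((1 / 2) ^ (j + 2)) * 2 ^ (j + 2) = 1"
      proof -
        have "ennreal ((1 / 2) ^ (j + 2)) * 2 ^ (j + 2) = ennreal ((1 / 2) ^ (j + 2) * 2 ^ (j + 2))"
          unfolding ennreal_two_power by (rule ennreal_mult[symmetric]) (intro zero_le_power; simp)+
        also have "(1 / 2 :: real) ^ (j + 2) * 2 ^ (j + 2) = 1" by (simp only: power_mult_distrib[symmetric]) simp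
        finally show ?thesis by simp
      qed
      moreover have "ennreal ((1 / 2) ^ (j + 2)) * ennreal N = ennreal (N / 4 * (1 / 2) ^ j)"
        using N by (subst ennreal_mult[symmetric]) (auto simp: field_simps)
      ultimately show ?thesis by (simp only: mult.assoc[symmetric]) simp
    qed
    then have "(\<Sum>j. v j) \<le> (\<Sum>j. ennreal (N / 4 * (1 / 2) ^ j))" by (intro suminf_le) auto
    also have "\<dots> = ennreal (\<Sum>j. N / 4 * (1 / 2) ^ j)"
      using N by (intro suminf_ennreal2) (auto intro!: summable_mult summable_geometric)
    also have "(\<Sum>j. N / 4 * (1 / 2) ^ j) = N / 2"
      by (subst suminf_mult) (auto simp: suminf_geometric summable_geometric)
    finally show False using N by simp
  qed
  have term_le: "P x (2 ^ (j + 2) * v j) \<le> (\<Sum>j. P x (2 ^ (j + 2) * v j))" for j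
    using sum_le_suminf[of "\<lambda>j. P x (2 ^ (j + 2) * v j)" "{j}"] by simp
  show ?thesis
  proof (cases "\<Sum>j. v j")
    case (real N)
    show ?thesis
    proof (cases "N = 0")
      case True
      then show ?thesis using real x by (simp add: P_0)
    next
      case False
      then have "N > 0" "ennreal (N / 2) < (\<Sum>j. v j)" using real by (auto simp: ennreal_less_iff)
      then obtain j where "ennreal N < 2 ^ (j + 2) * v j" using ex by blast
      then have "P x (\<Sum>j. v j) \<le> P x (2 ^ (j + 2) * v j)" using real x by (intro P_mono) auto
      then show ?thesis using term_le order_trans by blast
    qed
  next
    case top
    \<comment> \<open>Every real N is exceeded by some weighted term; letting N tend to infinity
      shows that the right-hand side is infinite.\<close>
    have "\<phi> x N \<le> (\<Sum>j. P x (2 ^ (j + 2) * v j))" if "N > 0" for N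
    proof -
      obtain j where "ennreal N < 2 ^ (j + 2) * v j" using ex[of N] \<open>N > 0\<close> top by (auto simp: less_top)
      then have "P x (ennreal N) \<le> P x (2 ^ (j + 2) * v j)" using x by (intro P_mono) auto
      then show ?thesis using term_le[of j] \<open>N > 0\<close> by (simp add: P_ennreal)
    qed
    then have "eventually (\<lambda>N. \<phi> x N \<le> (\<Sum>j. P x (2 ^ (j + 2) * v j))) at_top"
      by (intro eventually_at_top_linorderI[of 1]) auto
    then have "\<infinity> \<le> (\<Sum>j. P x (2 ^ (j + 2) * v j))"
      by (intro tendsto_upperbound[OF phi_at_top[OF x]]) auto
    then show ?thesis by (simp add: top_unique)
  qed
qed

text \<open>Chosen such that \<open>\<Sum>\<^sub>j L * 2 ^ (j + 2) * small j = 1\<close>.\<close>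

definition small :: "nat \<Rightarrow> real" where "small j = (1 / 4) ^ j / (8 * L)"

lemma small_pos: "small j > 0"
  using L by (simp add: small_def)

text \<open>\<open>v j\<close> divided by \<open>l j\<close> has modular at most 1. Undoing the
  division and applying the weight of \<open>P_suminf\<close> together amount to multiplication by
  \<open>c j = 2 ^ (j + 2) * l j\<close>, which is at most 1 and costs the factor
  \<open>L * c j\<close> in the modular. The choice of \<open>small\<close> makes these factors at
  most the terms of a geometric series with sum 1.\<close>

lemma lux_norm_suminf_le_1:
  assumes v: "\<And>j. v j \<in> borel_measurable (lebesgue_on \<Omega>)"
    and less: "\<And>j. lux_norm \<Omega> \<phi> (v j) < ennreal (small j)"
  shows "modular \<Omega> \<phi> (\<lambda>x. \<Sum>j. v j x) \<le> 1"
proof -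
  have "\<exists>l. 0 < l \<and> l < small j \<and> modular \<Omega> \<phi> (\<lambda>x. v j x / ennreal l) \<le> 1" for j
    using less[of j] lux_norm_less_iff by blast
  then obtain l where l: "\<And>j. 0 < l j" "\<And>j. l j < small j" "\<And>j. modular \<Omega> \<phi> (\<lambda>x. v j x / ennreal (l j)) \<le> 1"
    by metis
  define c where "c j = 2 ^ (j + 2) * l j" for j
  have Lc: "L * c j \<le> 1 / 2 * (1 / 2) ^ j" for j
  proof -
    have "L * c j \<le> L * (2 ^ (j + 2) * small j)"
      unfolding c_def using L l(2)[of j] by (intro mult_left_mono) auto
    also have "\<dots> = 1 / 2 * (2 ^ j * (1 / 4) ^ j)" using L by (simp add: small_def field_simps)
    also have "2 ^ j * (1 / 4 :: real) ^ j = (1 / 2) ^ j" by (simp only: power_mult_distrib[symmetric]) simp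
    finally show ?thesis .
  qed
  have c0: "0 < c j" for j using l(1) by (simp add: c_def)
  have c1: "c j \<le> 1" for j
  proof -
    have "1 * c j \<le> L * c j" using L c0[of j] by (intro mult_right_mono) auto
    also have "\<dots> \<le> 1 / 2 * 1" by (rule order_trans[OF Lc]) (intro mult_left_mono power_le_one; simp)
    finally show ?thesis by simp
  qed
  have eq: "2 ^ (j + 2) * v j x = ennreal (c j) * (v j x / ennreal (l j))" for j x
  proof -
    have "ennreal (c j) = 2 ^ (j + 2) * ennreal (l j)"
      unfolding c_def ennreal_two_power by (rule ennreal_mult) (use l(1)[of j] in auto)
    moreover have "ennreal (l j) * (v j x / ennreal (l j)) = v j x"
      using l(1)[of j] by (metis ennreal_eq_0_iff ennreal_mult_divide_eq ennreal_neq_top ennreal_times_divide mult.commute not_le)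
    ultimately show ?thesis by (simp only: mult.assoc)
  qed
  have vl: "(\<lambda>x. v j x / ennreal (l j)) \<in> borel_measurable (lebesgue_on \<Omega>)" for j using v by measurable
  have "modular \<Omega> \<phi> (\<lambda>x. \<Sum>j. v j x) \<le>
      (\<integral>\<^sup>+x. (\<Sum>j. ennreal (L * c j) * P x (v j x / ennreal (l j))) \<partial>lebesgue_on \<Omega>)"
    unfolding modular_def
  proof (rule nn_integral_mono_AE, rule eventually_mono[OF AE_in_\<Omega>])
    fix x assume elim: "x \<in> \<Omega>"
    have "P x (\<Sum>j. v j x) \<le> (\<Sum>j. P x (2 ^ (j + 2) * v j x))" by (rule P_suminf[OF elim])
    also have "\<dots> \<le> (\<Sum>j. ennreal (L * c j) * P x (v j x / ennreal (l j)))"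
      unfolding eq by (intro suminf_le P_scale elim c0 c1) auto
    finally show "P x (\<Sum>j. v j x) \<le> (\<Sum>j. ennreal (L * c j) * P x (v j x / ennreal (l j)))" .
  qed
  also have "\<dots> = (\<Sum>j. ennreal (L * c j) * modular \<Omega> \<phi> (\<lambda>x. v j x / ennreal (l j)))"
  proof -
    note [measurable] = P_measurable[OF vl]
    show ?thesis unfolding modular_def by (subst nn_integral_suminf) (simp_all add: nn_integral_cmult)
  qed
  also have "\<dots> \<le> (\<Sum>j. ennreal (1 / 2 * (1 / 2) ^ j))"
  proof (intro suminf_le)
    fix j
    have "ennreal (L * c j) * modular \<Omega> \<phi> (\<lambda>x. v j x / ennreal (l j)) \<le> ennreal (1 / 2 * (1 / 2) ^ j) * 1"
      by (intro mult_mono ennreal_leI Lc l(3)) auto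
    then show "ennreal (L * c j) * modular \<Omega> \<phi> (\<lambda>x. v j x / ennreal (l j)) \<le> ennreal (1 / 2 * (1 / 2) ^ j)" by simp
  qed auto
  also have "\<dots> = ennreal (\<Sum>j. 1 / 2 * (1 / 2) ^ j)"
    by (intro suminf_ennreal2) (auto intro!: summable_mult summable_geometric)
  also have "(\<Sum>j. 1 / 2 * (1 / 2) ^ j) = (1 :: real)"
    by (subst suminf_mult) (auto simp: suminf_geometric summable_geometric)
  finally show ?thesis by simp
qed

section \<open>The space of functions with finite modular at some scale\<close>

lemma modular_finite_imp_AE_finite:
  assumes g: "g \<in> borel_measurable (lebesgue_on \<Omega>)" and "modular \<Omega> \<phi> g < \<infinity>"
  shows "AE x in lebesgue_on \<Omega>. g x < \<infinity>"
proof -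
  have "AE x in lebesgue_on \<Omega>. P x (g x) \<noteq> \<infinity>"
    using assms by (intro nn_integral_PInf_AE P_measurable) (auto simp: modular_def)
  then show ?thesis by eventually_elim (metis P_infty(1) infinity_ennreal_def less_top)
qed

text \<open>One finite modular at scale l suffices, because at a smaller scale r it is multiplied by
  at most \<open>L * (r / l)\<close>, which tends to 0.\<close>

lemma Lphi_iff:
  "f \<in> Lphi \<Omega> \<phi> \<longleftrightarrow> f \<in> borel_measurable (lebesgue_on \<Omega>) \<and>
     (\<exists>l>0. modular \<Omega> \<phi> (\<lambda>x. ennreal (l * \<bar>f x\<bar>)) < \<infinity>)"
proof (intro iffI conjI)
  assume f: "f \<in> Lphi \<Omega> \<phi>"
  then show "f \<in> borel_measurable (lebesgue_on \<Omega>)" by (simp add: Lphi_def)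
  have "((\<lambda>l. modular \<Omega> \<phi> (\<lambda>x. ennreal \<bar>l * f x\<bar>)) \<longlongrightarrow> 0) (at_right 0)" using f by (simp add: Lphi_def)
  then have "eventually (\<lambda>l. modular \<Omega> \<phi> (\<lambda>x. ennreal \<bar>l * f x\<bar>) < 1) (at_right 0)"
    by (rule order_tendstoD) simp
  then have "eventually (\<lambda>l. modular \<Omega> \<phi> (\<lambda>x. ennreal \<bar>l * f x\<bar>) < 1 \<and> 0 < l) (at_right 0)"
    by (intro eventually_conj eventually_at_right_less)
  then obtain l where "0 < l" "modular \<Omega> \<phi> (\<lambda>x. ennreal \<bar>l * f x\<bar>) < 1"
    using eventually_happens[of _ "at_right (0::real)"] by (auto simp: trivial_limit_at_right_real)
  then show "\<exists>l>0. modular \<Omega> \<phi> (\<lambda>x. ennreal (l * \<bar>f x\<bar>)) < \<infinity>"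
    by (intro exI[of _ l]) (auto simp: abs_mult intro: order.strict_trans)
next
  assume "f \<in> borel_measurable (lebesgue_on \<Omega>) \<and> (\<exists>l>0. modular \<Omega> \<phi> (\<lambda>x. ennreal (l * \<bar>f x\<bar>)) < \<infinity>)"
  then obtain l where f[measurable]: "f \<in> borel_measurable (lebesgue_on \<Omega>)" and l: "l > 0"
    "modular \<Omega> \<phi> (\<lambda>x. ennreal (l * \<bar>f x\<bar>)) < \<infinity>" by blast
  define m where "m = enn2real (modular \<Omega> \<phi> (\<lambda>x. ennreal (l * \<bar>f x\<bar>)))"
  have m: "modular \<Omega> \<phi> (\<lambda>x. ennreal (l * \<bar>f x\<bar>)) = ennreal m" "m \<ge> 0" using l(2) by (auto simp: m_def)
  have bound: "modular \<Omega> \<phi> (\<lambda>x. ennreal \<bar>r * f x\<bar>) \<le> ennreal (L * (r / l) * m)" if r: "0 < r" "r \<le> l" for r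
  proof -
    have "(\<lambda>x. ennreal \<bar>r * f x\<bar>) = (\<lambda>x. ennreal (r / l) * ennreal (l * \<bar>f x\<bar>))"
      using r l by (auto simp: ennreal_mult[symmetric] abs_mult)
    then have "modular \<Omega> \<phi> (\<lambda>x. ennreal \<bar>r * f x\<bar>) \<le> ennreal (L * (r / l)) * modular \<Omega> \<phi> (\<lambda>x. ennreal (l * \<bar>f x\<bar>))"
      using modular_scale[of "\<lambda>x. ennreal (l * \<bar>f x\<bar>)" "r / l"] r l by simp
    also have "\<dots> = ennreal (L * (r / l) * m)"
      unfolding m(1) by (rule ennreal_mult[symmetric]) (use m r l L in auto)
    finally show ?thesis .
  qed
  have "((\<lambda>r. ennreal (L * (r / l) * m)) \<longlongrightarrow> ennreal (L * (0 / l) * m)) (at_right 0)"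
    by (intro tendsto_intros) (use l in auto)
  then have lim: "((\<lambda>r. ennreal (L * (r / l) * m)) \<longlongrightarrow> 0) (at_right 0)" by simp
  have ev: "eventually (\<lambda>r. modular \<Omega> \<phi> (\<lambda>x. ennreal \<bar>r * f x\<bar>) \<le> ennreal (L * (r / l) * m)) (at_right 0)"
    unfolding eventually_at_right_field using l bound by (intro exI[of _ l]) auto
  have "((\<lambda>r. modular \<Omega> \<phi> (\<lambda>x. ennreal \<bar>r * f x\<bar>)) \<longlongrightarrow> 0) (at_right 0)"
    by (rule tendsto_sandwich[OF _ ev tendsto_const lim]) simp
  then show "f \<in> Lphi \<Omega> \<phi>" using f by (simp add: Lphi_def)
qed

lemma Lphi_measurable: "f \<in> Lphi \<Omega> \<phi> \<Longrightarrow> f \<in> borel_measurable (lebesgue_on \<Omega>)"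
  by (simp add: Lphi_def)

lemma Lphi_dominated:
  assumes f: "f \<in> Lphi \<Omega> \<phi>" and g: "g \<in> borel_measurable (lebesgue_on \<Omega>)"
    and le: "AE x in lebesgue_on \<Omega>. \<bar>g x\<bar> \<le> \<bar>f x\<bar>"
  shows "g \<in> Lphi \<Omega> \<phi>"
proof -
  obtain l where l: "l > 0" "modular \<Omega> \<phi> (\<lambda>x. ennreal (l * \<bar>f x\<bar>)) < \<infinity>" using f Lphi_iff by blast
  have "modular \<Omega> \<phi> (\<lambda>x. ennreal (l * \<bar>g x\<bar>)) \<le> modular \<Omega> \<phi> (\<lambda>x. ennreal (l * \<bar>f x\<bar>))"
    using le by (intro modular_mono, eventually_elim) (use l in \<open>auto intro!: ennreal_leI mult_left_mono\<close>)
  then show ?thesis using l g Lphi_iff by (meson order.strict_trans1)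
qed

text \<open>The sum at scale l is at most the larger of the two functions at scale 2 * l;
  monotonicity of \<open>\<phi>\<close> then takes the place of convexity.\<close>

lemma Lphi_add_abs:
  assumes f: "f \<in> Lphi \<Omega> \<phi>" and g: "g \<in> Lphi \<Omega> \<phi>"
  shows "(\<lambda>x. \<bar>f x\<bar> + \<bar>g x\<bar>) \<in> Lphi \<Omega> \<phi>"
proof -
  note [measurable] = Lphi_measurable[OF f] Lphi_measurable[OF g]
  obtain l1 where l1: "l1 > 0" "modular \<Omega> \<phi> (\<lambda>x. ennreal (l1 * \<bar>f x\<bar>)) < \<infinity>" using f Lphi_iff by blast
  obtain l2 where l2: "l2 > 0" "modular \<Omega> \<phi> (\<lambda>x. ennreal (l2 * \<bar>g x\<bar>)) < \<infinity>" using g Lphi_iff by blast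
  define l where "l = min l1 l2 / 2"
  have l: "l > 0" "2 * l \<le> l1" "2 * l \<le> l2" using l1 l2 by (auto simp: l_def)
  have m1: "(\<lambda>x. P x (ennreal (l1 * \<bar>f x\<bar>))) \<in> borel_measurable (lebesgue_on \<Omega>)"
    and m2: "(\<lambda>x. P x (ennreal (l2 * \<bar>g x\<bar>))) \<in> borel_measurable (lebesgue_on \<Omega>)"
    by (rule P_measurable, measurable)+
  have "modular \<Omega> \<phi> (\<lambda>x. ennreal (l * \<bar>\<bar>f x\<bar> + \<bar>g x\<bar>\<bar>)) \<le>
      (\<integral>\<^sup>+x. P x (ennreal (l1 * \<bar>f x\<bar>)) + P x (ennreal (l2 * \<bar>g x\<bar>)) \<partial>lebesgue_on \<Omega>)"
    unfolding modular_def using AE_in_\<Omega>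
  proof (intro nn_integral_mono_AE, eventually_elim)
    case (elim x)
    have a: "2 * l * \<bar>f x\<bar> \<le> l1 * \<bar>f x\<bar>" "2 * l * \<bar>g x\<bar> \<le> l2 * \<bar>g x\<bar>"
      using l by (intro mult_right_mono; simp)+
    have "l * \<bar>\<bar>f x\<bar> + \<bar>g x\<bar>\<bar> \<le> l1 * \<bar>f x\<bar> \<or> l * \<bar>\<bar>f x\<bar> + \<bar>g x\<bar>\<bar> \<le> l2 * \<bar>g x\<bar>"
      using a by (simp add: distrib_left) linarith
    then show ?case
    proof
      assume "l * \<bar>\<bar>f x\<bar> + \<bar>g x\<bar>\<bar> \<le> l1 * \<bar>f x\<bar>"
      then have "P x (ennreal (l * \<bar>\<bar>f x\<bar> + \<bar>g x\<bar>\<bar>)) \<le> P x (ennreal (l1 * \<bar>f x\<bar>))"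
        by (intro P_mono elim ennreal_leI)
      then show ?thesis by (rule order_trans) simp
    next
      assume "l * \<bar>\<bar>f x\<bar> + \<bar>g x\<bar>\<bar> \<le> l2 * \<bar>g x\<bar>"
      then have "P x (ennreal (l * \<bar>\<bar>f x\<bar> + \<bar>g x\<bar>\<bar>)) \<le> P x (ennreal (l2 * \<bar>g x\<bar>))"
        by (intro P_mono elim ennreal_leI)
      then show ?thesis by (rule order_trans) simp
    qed
  qed
  also have "\<dots> = modular \<Omega> \<phi> (\<lambda>x. ennreal (l1 * \<bar>f x\<bar>)) + modular \<Omega> \<phi> (\<lambda>x. ennreal (l2 * \<bar>g x\<bar>))"
    unfolding modular_def by (rule nn_integral_add[OF m1 m2])
  also have "\<dots> < \<infinity>" using l1 l2 by simp
  finally show ?thesis using l(1) by (subst Lphi_iff) (auto intro!: borel_measurable_add)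
qed

lemma Lphi_zero: "(\<lambda>x. 0) \<in> Lphi \<Omega> \<phi>"
proof -
  have "modular \<Omega> \<phi> (\<lambda>x. 0) = (\<integral>\<^sup>+x. 0 \<partial>lebesgue_on \<Omega>)"
    unfolding modular_def by (rule nn_integral_cong) (simp add: P_0)
  then show ?thesis by (subst Lphi_iff) (auto intro!: exI[of _ 1])
qed

lemma Lphi_sum_abs:
  assumes "finite I" "\<And>i. i \<in> I \<Longrightarrow> f i \<in> Lphi \<Omega> \<phi>"
  shows "(\<lambda>x. \<Sum>i\<in>I. \<bar>f i x\<bar>) \<in> Lphi \<Omega> \<phi>"
  using assms
proof (induction I rule: finite_induct)
  case (insert i I)
  have "(\<lambda>x. \<bar>f i x\<bar> + \<bar>\<Sum>i\<in>I. \<bar>f i x\<bar>\<bar>) \<in> Lphi \<Omega> \<phi>"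
    using insert by (intro Lphi_add_abs) auto
  then show ?case using insert by (simp add: sum_nonneg)
qed (simp add: Lphi_zero)

lemma Lphi_if_modular_finite:
  assumes g: "g \<in> borel_measurable (lebesgue_on \<Omega>)" and fin: "modular \<Omega> \<phi> (\<lambda>x. ennreal \<bar>g x\<bar>) < \<infinity>"
  shows "g \<in> Lphi \<Omega> \<phi>"
  unfolding Lphi_iff using g fin by (intro conjI exI[of _ 1]) auto

text \<open>Compact sets have finite measure, so \<open>nn_integral_le_modular\<close> applies.
  Local integrability is what \<open>has_weak_partial\<close> demands of both functions.\<close>

lemma Lphi_locally_integrable:
  assumes f: "f \<in> Lphi \<Omega> \<phi>"
  shows "locally_integrable \<Omega> f"
  unfolding locally_integrable_def
proof (intro allI impI)
  fix K assume K: "compact K \<and> K \<subseteq> \<Omega>"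
  have Km: "K \<in> sets lebesgue" using K by (simp add: compact_imp_closed borel_closed)
  have fK: "f \<in> borel_measurable (lebesgue_on K)"
    using Lphi_measurable[OF f] K Km measurable_restrict_mono by blast
  obtain l where l: "l > 0" "modular \<Omega> \<phi> (\<lambda>x. ennreal (l * \<bar>f x\<bar>)) < \<infinity>" using f Lphi_iff by blast
  have lf: "(\<lambda>x. ennreal (l * \<bar>f x\<bar>)) \<in> borel_measurable (lebesgue_on \<Omega>)" using Lphi_measurable[OF f] by measurable
  have "emeasure lebesgue K < \<infinity>" using K by (metis emeasure_compact_finite emeasure_lborel_cbox_finite
     compact_imp_closed borel_closed emeasure_completion sets_completionI_sets lmeasurable_compact fmeasurableD2 infinity_ennreal_def less_top)
  then have "ennreal \<beta> * emeasure lebesgue K + ennreal (L * \<beta>) * modular \<Omega> \<phi> (\<lambda>x. ennreal (l * \<bar>f x\<bar>)) < \<infinity>"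
    using l by (simp add: ennreal_mult_less_top)
  then have fin: "(\<integral>\<^sup>+x\<in>K. ennreal (l * \<bar>f x\<bar>) \<partial>lebesgue_on \<Omega>) < \<infinity>"
    using nn_integral_le_modular[OF lf Km] K by (auto intro: order.strict_trans1)
  have "(\<integral>\<^sup>+x\<in>K. ennreal (l * \<bar>f x\<bar>) \<partial>lebesgue_on \<Omega>) = (\<integral>\<^sup>+x. ennreal (l * \<bar>f x\<bar>) \<partial>lebesgue_on K)"
    using K Km by (simp add: nn_integral_restrict_space) (intro nn_integral_cong, auto simp: indicator_def)
  also have "\<dots> = (\<integral>\<^sup>+x. ennreal (norm (l * f x)) \<partial>lebesgue_on K)" using l by (simp add: abs_mult)
  finally have "integrable (lebesgue_on K) (\<lambda>x. l * f x)"
    unfolding integrable_iff_bounded using fin fK by (simp only:) measurable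
  then have "integrable (lebesgue_on K) (\<lambda>x. (1 / l) * (l * f x))" by (rule integrable_mult_right)
  then show "integrable (lebesgue_on K) f" using l by simp
qed

end

section \<open>Absolute continuity on curves implies absolute continuity on lines\<close>

lemma insert_coord_diff: "insert_coord k y z - insert_coord k y z' = (z - z') *\<^sub>R axis k 1"
  by (simp add: vec_eq_iff axis_def)

lemma insert_coord_add: "insert_coord k y z + s *\<^sub>R axis k 1 = insert_coord k y (z + s)"
  by (simp add: vec_eq_iff axis_def)

lemma dist_insert_coord: "dist (insert_coord k y z) (insert_coord k y z') = \<bar>z - z'\<bar>"
  by (simp add: dist_norm insert_coord_diff)

lemma continuous_insert_coord: "continuous_on S (insert_coord k y)"
  unfolding continuous_on_iff dist_insert_coord by (auto simp: dist_real_def)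

lemma abs_cont_on_shift:
  assumes "abs_cont_on a b (\<lambda>t. f (c + t))"
  shows "abs_cont_on (c + a) (c + b) f"
  unfolding abs_cont_on_def
proof (intro allI impI)
  fix \<epsilon> :: real assume "\<epsilon> > 0"
  from assms[unfolded abs_cont_on_def, rule_format, OF this]
  obtain \<delta> where \<delta>: "\<delta> > 0" and *: "\<forall>(m::nat) s t.
     (\<forall>i<m. a \<le> s i \<and> s i < t i \<and> t i \<le> b) \<and>
     disjoint_family_on (\<lambda>i. {s i <..< t i}) {..<m} \<and>
     (\<Sum>i<m. t i - s i) < \<delta> \<longrightarrow> (\<Sum>i<m. \<bar>f (c + t i) - f (c + s i)\<bar>) < \<epsilon>"
    by (elim exE conjE)
  show "\<exists>\<delta>>0. \<forall>(m::nat) s t.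
     (\<forall>i<m. c + a \<le> s i \<and> s i < t i \<and> t i \<le> c + b) \<and>
     disjoint_family_on (\<lambda>i. {s i <..< t i}) {..<m} \<and>
     (\<Sum>i<m. t i - s i) < \<delta> \<longrightarrow> (\<Sum>i<m. \<bar>f (t i) - f (s i)\<bar>) < \<epsilon>"
  proof (rule exI[of _ \<delta>], intro conjI allI impI)
    fix m :: nat and s t assume H: "(\<forall>i<m. c + a \<le> s i \<and> s i < t i \<and> t i \<le> c + b) \<and>
     disjoint_family_on (\<lambda>i. {s i <..< t i}) {..<m} \<and> (\<Sum>i<m. t i - s i) < \<delta>"
    have "disjoint_family_on (\<lambda>i. {s i - c<..<t i - c}) {..<m}"
      unfolding disjoint_family_on_def
    proof (intro ballI impI)
      fix i j assume "i \<in> {..<m}" "j \<in> {..<m}" "i \<noteq> j"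
      then have d: "{s i<..<t i} \<inter> {s j<..<t j} = {}" using H unfolding disjoint_family_on_def by blast
      have "x + c \<in> {s i<..<t i} \<inter> {s j<..<t j}" if "x \<in> {s i - c<..<t i - c} \<inter> {s j - c<..<t j - c}" for x
        using that by auto
      then show "{s i - c<..<t i - c} \<inter> {s j - c<..<t j - c} = {}" unfolding d by blast
    qed
    then have "(\<Sum>i<m. \<bar>f (c + (t i - c)) - f (c + (s i - c))\<bar>) < \<epsilon>"
      using H by (intro *[rule_format]) auto
    then show "(\<Sum>i<m. \<bar>f (t i) - f (s i)\<bar>) < \<epsilon>" by simp
  qed (rule \<delta>)
qed

text \<open>Along an axis the chord sum of every partition telescopes to t. The supremum thus runs
  over a singleton, which is nonempty by the two-point partition.\<close>

lemma coordinate_segment_Gamma_rect: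
  assumes "a < b" and sub: "{a..b} \<subseteq> line_section \<Omega> k y"
  shows "(b - a, \<lambda>t. insert_coord k y (a + t)) \<in> Gamma_rect \<Omega>"
proof -
  let ?g = "\<lambda>t. insert_coord k y (a + t)"
  have "curve_length 0 t ?g = ennreal t" if "t \<in> {0..b - a}" for t
  proof -
    have sum: "(\<Sum>i<m. ennreal (dist (?g (s i)) (?g (s (Suc i))))) = ennreal t"
      if s: "mono_on {..m} s" "s 0 = 0" "s m = t" for m :: nat and s
    proof -
      have le: "s i \<le> s (Suc i)" if "i < m" for i using s(1) that by (auto simp: mono_on_def)
      have "(\<Sum>i<m. ennreal (dist (?g (s i)) (?g (s (Suc i))))) = (\<Sum>i<m. ennreal (s (Suc i) - s i))"
        using le by (intro sum.cong) (auto simp: dist_insert_coord)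
      also have "\<dots> = ennreal (\<Sum>i<m. s (Suc i) - s i)" using le by (intro sum_ennreal) auto
      also have "(\<Sum>i<m. s (Suc i) - s i) = t" using s by (simp add: sum_lessThan_telescope)
      finally show ?thesis .
    qed
    have "mono_on {..1} (\<lambda>i::nat. if i = 0 then 0 else t)" using that by (auto simp: mono_on_def)
    then have "\<exists>(m::nat) s. mono_on {..m} s \<and> s 0 = 0 \<and> s m = t"
      by (intro exI[of _ 1] exI[of _ "\<lambda>i::nat. if i = 0 then 0 else t"]) auto
    then obtain m0 :: nat and s0 where s0: "mono_on {..m0} s0" "s0 0 = 0" "s0 m0 = t" by blast
    have "{\<Sum>i<m. ennreal (dist (?g (s i)) (?g (s (Suc i)))) | (m::nat) s. mono_on {..m} s \<and> s 0 = 0 \<and> s m = t} = {ennreal t}"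
    proof (intro equalityI subsetI)
      fix e assume "e \<in> {ennreal t}"
      then have "e = (\<Sum>i<m0. ennreal (dist (?g (s0 i)) (?g (s0 (Suc i)))))" using sum[OF s0] by simp
      then show "e \<in> {\<Sum>i<m. ennreal (dist (?g (s i)) (?g (s (Suc i)))) | (m::nat) s. mono_on {..m} s \<and> s 0 = 0 \<and> s m = t}"
        using s0 by blast
    next
      fix e assume "e \<in> {\<Sum>i<m. ennreal (dist (?g (s i)) (?g (s (Suc i)))) | (m::nat) s. mono_on {..m} s \<and> s 0 = 0 \<and> s m = t}"
      then show "e \<in> {ennreal t}" using sum by (elim CollectE exE conjE) simp
    qed
    then show ?thesis unfolding curve_length_def by simp
  qed
  moreover have "continuous_on {0..b - a} ?g"
    by (rule continuous_on_compose2[OF continuous_insert_coord[of UNIV]]) (auto intro!: continuous_intros)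
  moreover have "?g ` {0..b - a} \<subseteq> \<Omega>" using sub by (auto simp: line_section_def subset_iff)
  ultimately show ?thesis using \<open>a < b\<close> by (simp add: Gamma_rect_def)
qed

context weak_Phi_space
begin

text \<open>Admissible functions are Borel relative to \<open>\<Omega>\<close> only; cutting them to
  a Borel subset makes them Borel on the whole space, as Fubini's theorem requires.\<close>

lemma borel_restrict_times_indicator:
  assumes v: "v \<in> borel_measurable (restrict_space borel \<Omega>)" and A: "A \<in> sets borel" "A \<subseteq> \<Omega>"
  shows "(\<lambda>x. v x * indicator A x :: ennreal) \<in> borel_measurable borel"
proof -
  have "(\<lambda>x. v x * indicator \<Omega> x) \<in> borel_measurable borel"
    using v open_\<Omega> by (simp add: borel_measurable_restrict_space_iff_ennreal)
  then have "(\<lambda>x. v x * indicator \<Omega> x * indicator A x) \<in> borel_measurable borel" using A by measurable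
  moreover have "(\<lambda>x. v x * indicator \<Omega> x * indicator A x) = (\<lambda>x. v x * indicator A x)"
    using A by (auto simp: indicator_def fun_eq_iff)
  ultimately show ?thesis by simp
qed

lemma borel_restrict_imp_lebesgue_on:
  assumes v: "v \<in> borel_measurable (restrict_space borel \<Omega>)"
  shows "(v :: _ \<Rightarrow> ennreal) \<in> borel_measurable (lebesgue_on \<Omega>)"
proof -
  have "(\<lambda>x. v x * indicator \<Omega> x) \<in> borel_measurable borel"
    using v open_\<Omega> by (simp add: borel_measurable_restrict_space_iff_ennreal)
  then have "(\<lambda>x. v x * indicator \<Omega> x) \<in> borel_measurable lebesgue" by (intro measurable_completion) simp
  then show ?thesis by (simp add: borel_measurable_restrict_space_iff_ennreal)
qed

lemma nn_integral_lebesgue_on_eq: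
  assumes "A \<subseteq> \<Omega>"
  shows "(\<integral>\<^sup>+x\<in>A. v x \<partial>lebesgue_on \<Omega>) = (\<integral>\<^sup>+x. v x * indicator A x \<partial>lborel)"
proof -
  have "(\<integral>\<^sup>+x\<in>A. v x \<partial>lebesgue_on \<Omega>) = (\<integral>\<^sup>+x. v x * indicator A x * indicator \<Omega> x \<partial>lebesgue)"
    by (rule nn_integral_restrict_space) simp
  also have "(\<lambda>x. v x * indicator A x * indicator \<Omega> x) = (\<lambda>x. v x * indicator A x)"
    using assms by (auto simp: indicator_def fun_eq_iff)
  finally show ?thesis by (simp add: nn_integral_completion)
qed

text \<open>A segment is compact and lies in a ball, to which \<open>v\<close> can be cut. The
  radius depends on the segment alone and hence serves a whole sequence of admissible
  functions.\<close>

lemma segment_curve_integral_le: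
  assumes sub: "{a..b} \<subseteq> line_section \<Omega> k y"
  shows "\<exists>R::nat. \<forall>v\<in>borel_measurable (restrict_space borel \<Omega>).
    curve_integral (b - a, \<lambda>t. insert_coord k y (a + t)) v \<le>
      (\<integral>\<^sup>+z. v (insert_coord k y z) * indicator (\<Omega> \<inter> ball 0 (real R)) (insert_coord k y z) \<partial>lborel)"
proof -
  have "bounded (insert_coord k y ` {a..b})"
    by (intro compact_imp_bounded compact_continuous_image continuous_insert_coord) simp
  then obtain r where r: "\<And>z. z \<in> {a..b} \<Longrightarrow> norm (insert_coord k y z) \<le> r"
    unfolding bounded_iff by blast
  obtain R :: nat where "r < real R" using reals_Archimedean2 by blast
  define A where "A = \<Omega> \<inter> ball 0 (real R)"
  have inA: "insert_coord k y z \<in> A" if "z \<in> {a..b}" for z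
    using r[OF that] sub that \<open>r < real R\<close> by (auto simp: A_def line_section_def)
  have [measurable]: "insert_coord k y \<in> borel_measurable borel"
    by (intro borel_measurable_continuous_onI continuous_insert_coord)
  have "curve_integral (b - a, \<lambda>t. insert_coord k y (a + t)) v \<le> (\<integral>\<^sup>+z. v (insert_coord k y z) * indicator A (insert_coord k y z) \<partial>lborel)"
    if v: "v \<in> borel_measurable (restrict_space borel \<Omega>)" for v
  proof -
    have [measurable]: "(\<lambda>x. v x * indicator A x) \<in> borel_measurable borel"
      by (rule borel_restrict_times_indicator[OF v]) (use open_\<Omega> in \<open>auto simp: A_def\<close>)
    have "curve_integral (b - a, \<lambda>t. insert_coord k y (a + t)) v = (\<integral>\<^sup>+t\<in>{0..b - a}. v (insert_coord k y (a + t)) \<partial>lborel)"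
      by (simp add: curve_integral_def)
    also have "\<dots> \<le> (\<integral>\<^sup>+t. v (insert_coord k y (a + 1 * t)) * indicator A (insert_coord k y (a + 1 * t)) \<partial>lborel)"
      using inA by (intro nn_integral_mono) (auto simp: indicator_def)
    also have "\<dots> = (\<integral>\<^sup>+z. v (insert_coord k y z) * indicator A (insert_coord k y z) \<partial>lborel)"
      by (subst nn_integral_real_affine[where c = 1 and t = a]) auto
    finally show ?thesis .
  qed
  then show ?thesis unfolding A_def by blast
qed

text \<open>The bound is a real multiple of \<open>c\<close> with a factor depending only on the
  ball, so it is finite and tends to 0 with \<open>c\<close>.\<close>

lemma ball_nn_integral_finite:
  assumes v: "v \<in> borel_measurable (restrict_space borel \<Omega>)" and less: "lux_norm \<Omega> \<phi> v < ennreal c"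
  shows "(\<integral>\<^sup>+x. v x * indicator (\<Omega> \<inter> ball 0 R) x \<partial>lborel) \<le> ennreal (c * (\<beta> * measure lebesgue (\<Omega> \<inter> ball 0 R) + L * \<beta>))"
proof -
  let ?A = "\<Omega> \<inter> ball 0 R"
  have A: "?A \<in> sets borel" using open_\<Omega> by simp
  have "0 < c" using less by (cases "c \<le> 0") (auto simp: ennreal_neg)
  have "emeasure lborel ?A < top"
    using emeasure_bounded_finite[of ?A] by (simp add: bounded_Int)
  then have fin: "emeasure lebesgue ?A < top" using A by simp
  have C: "ennreal \<beta> * emeasure lebesgue ?A + ennreal (L * \<beta>) = ennreal (\<beta> * measure lebesgue ?A + L * \<beta>)"
    using fin \<beta> L by (simp add: emeasure_eq_ennreal_measure less_top[symmetric] ennreal_mult ennreal_plus)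
  have "(\<integral>\<^sup>+x. v x * indicator ?A x \<partial>lborel) = (\<integral>\<^sup>+x\<in>?A. v x \<partial>lebesgue_on \<Omega>)"
    by (rule nn_integral_lebesgue_on_eq[symmetric]) simp
  also have "\<dots> \<le> ennreal c * (ennreal \<beta> * emeasure lebesgue ?A + ennreal (L * \<beta>))"
    by (rule nn_integral_le_lux_norm[OF borel_restrict_imp_lebesgue_on[OF v] _ _ less]) (use A in auto)
  also have "\<dots> = ennreal (c * (\<beta> * measure lebesgue ?A + L * \<beta>))"
    unfolding C by (rule ennreal_mult[symmetric]) (use \<open>0 < c\<close> \<beta> L in auto)
  finally show ?thesis .
qed

lemma ACC_imp_ACL:
  assumes u: "u \<in> ACC \<Omega> \<phi>"
  shows "u \<in> ACL \<Omega>"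
  unfolding ACL_def mem_Collect_eq
proof
  fix k
  have "\<exists>v\<in>F_adm \<Omega> (Gamma_NAC \<Omega> u). lux_norm \<Omega> \<phi> v < ennreal (1 / real (Suc j))" for j
  proof -
    have "(INF v \<in> F_adm \<Omega> (Gamma_NAC \<Omega> u). lux_norm \<Omega> \<phi> v) < ennreal (1 / real (Suc j))"
      using u by (simp add: ACC_def phi_modulus_def)
    then show ?thesis unfolding INF_less_iff .
  qed
  then obtain v where v: "\<And>j. v j \<in> F_adm \<Omega> (Gamma_NAC \<Omega> u)" "\<And>j. lux_norm \<Omega> \<phi> (v j) < ennreal (1 / real (Suc j))"
    by metis
  have vm: "v j \<in> borel_measurable (restrict_space borel \<Omega>)" for j using v(1) by (simp add: F_adm_def)
  define A where "A R = \<Omega> \<inter> ball 0 (real R)" for R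
  have A: "A R \<in> sets borel" "A R \<subseteq> \<Omega>" for R using open_\<Omega> by (auto simp: A_def)
  define w where "w j R x = v j x * indicator (A R) x" for j R x
  have w[measurable]: "w j R \<in> borel_measurable borel" for j R
    unfolding w_def[abs_def] by (rule borel_restrict_times_indicator[OF vm A])
  \<comment> \<open>Measurable by construction, these sets contain the bad lines, whose own set need
    not be measurable. Integer radii keep the union countable, and Markov's inequality for every j
    makes each set null.\<close>
  define Y where "Y R = {y \<in> space (lines_measure k). \<forall>j. 1 \<le> (\<integral>\<^sup>+z. w j R (insert_coord k y z) \<partial>lborel)}" for R
  have Y[measurable]: "Y R \<in> sets (lines_measure k)" for R
    unfolding Y_def by measurable
  have Y_null: "Y R \<in> null_sets (lines_measure k)" for R
  proof -
    define C where "C = \<beta> * measure lebesgue (A R) + L * \<beta>"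
    have "emeasure (lines_measure k) (Y R) \<le> ennreal (1 / real (Suc j) * C)" for j
    proof -
      have "emeasure (lines_measure k) (Y R) = (\<integral>\<^sup>+y. indicator (Y R) y \<partial>lines_measure k)" by simp
      also have "\<dots> \<le> (\<integral>\<^sup>+y. \<integral>\<^sup>+z. w j R (insert_coord k y z) \<partial>lborel \<partial>lines_measure k)"
        by (rule nn_integral_mono) (auto simp: Y_def indicator_def)
      also have "\<dots> = (\<integral>\<^sup>+x. w j R x \<partial>lborel)" by (rule nn_integral_lines[symmetric, OF w])
      also have "\<dots> \<le> ennreal (1 / real (Suc j) * C)"
        unfolding w_def A_def C_def by (rule ball_nn_integral_finite[OF vm v(2)])
      finally show ?thesis .
    qed
    moreover have "(\<lambda>j. ennreal (1 / real (Suc j) * C)) \<longlonglongrightarrow> ennreal (0 * C)"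
    proof (intro tendsto_intros)
      show "(\<lambda>j. 1 / real (Suc j)) \<longlonglongrightarrow> 0" using LIMSEQ_inverse_real_of_nat by (simp add: inverse_eq_divide)
    qed
    ultimately have "emeasure (lines_measure k) (Y R) \<le> ennreal (0 * C)"
      by (intro LIMSEQ_le_const) auto
    then show ?thesis by (simp add: null_setsI)
  qed
  have "y \<in> (\<Union>R. Y R)" if y: "y \<in> line_proj \<Omega> k - AC_lines \<Omega> u k" for y
  proof -
    from y obtain a b where ab: "a \<le> b" "{a..b} \<subseteq> line_section \<Omega> k y" "\<not> abs_cont_on a b (\<lambda>z. u (insert_coord k y z))"
      by (auto simp: AC_lines_def)
    have "a \<noteq> b"
    proof
      assume "a = b"
      then have "abs_cont_on a b (\<lambda>z. u (insert_coord k y z))"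
        by (intro abs_cont_on_lipschitz[where M = 0]) (metis abs_zero antisym diff_self mult_zero_left order.trans order_refl)
      then show False using ab by simp
    qed
    then have "a < b" using ab by simp
    let ?c = "(b - a, \<lambda>t. insert_coord k y (a + t))"
    have "\<not> abs_cont_on 0 (b - a) (u \<circ> (\<lambda>t. insert_coord k y (a + t)))"
      using abs_cont_on_shift[of 0 "b - a" "\<lambda>z. u (insert_coord k y z)" a] ab(3) by (auto simp: comp_def)
    then have c: "?c \<in> Gamma_NAC \<Omega> u"
      using coordinate_segment_Gamma_rect[OF \<open>a < b\<close> ab(2)] by (simp add: Gamma_NAC_def)
    obtain R :: nat where R: "\<And>v. v \<in> borel_measurable (restrict_space borel \<Omega>) \<Longrightarrow>
        curve_integral ?c v \<le> (\<integral>\<^sup>+z. v (insert_coord k y z) * indicator (\<Omega> \<inter> ball 0 (real R)) (insert_coord k y z) \<partial>lborel)"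
      using segment_curve_integral_le[OF ab(2)] by blast
    have ys: "y \<in> space (lines_measure k)" using y by (auto simp: line_proj_def space_PiM)
    have "1 \<le> (\<integral>\<^sup>+z. w j R (insert_coord k y z) \<partial>lborel)" for j
    proof -
      have "1 \<le> curve_integral ?c (v j)" using v(1)[of j] c unfolding F_adm_def by blast
      also have "\<dots> \<le> (\<integral>\<^sup>+z. w j R (insert_coord k y z) \<partial>lborel)" unfolding w_def A_def by (rule R[OF vm])
      finally show ?thesis .
    qed
    then have "y \<in> Y R" using ys by (simp add: Y_def)
    then show ?thesis by blast
  qed
  then have "line_proj \<Omega> k - AC_lines \<Omega> u k \<subseteq> (\<Union>R. Y R)" by blast
  moreover have "(\<Union>R. Y R) \<in> null_sets (lines_measure k)" using Y_null by (intro null_sets_UN)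
  ultimately show "line_proj \<Omega> k - AC_lines \<Omega> u k \<in> null_sets (completion (lines_measure k))"
    unfolding null_sets_completion_iff2 by blast
qed

end

section \<open>Classical partial derivatives of ACL functions are weak derivatives\<close>

text \<open>Needed for difference quotients: a Lebesgue measurable function composed with a Borel
  map may lose measurability, but translations map Lebesgue sets to Lebesgue sets.\<close>

lemma measurable_lebesgue_translation:
  fixes f :: "'a::euclidean_space \<Rightarrow> real"
  assumes "f \<in> borel_measurable lebesgue"
  shows "(\<lambda>x. f (x + a)) \<in> borel_measurable lebesgue"
proof (rule measurableI)
  fix S :: "real set" assume "S \<in> sets borel"
  then have "f -` S \<inter> space lebesgue \<in> sets lebesgue" using assms by (rule measurable_sets[rotated])
  then have "(\<lambda>x. - a + x) ` (f -` S) \<in> sets lebesgue" by (intro lebesgue_sets_translation) simp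
  moreover have "(\<lambda>x. - a + x) ` (f -` S) = (\<lambda>x. f (x + a)) -` S"
  proof (rule set_eqI, rule iffI)
    fix x assume "x \<in> (\<lambda>x. f (x + a)) -` S"
    then have "x = - a + (x + a)" "x + a \<in> f -` S" by auto
    then show "x \<in> (\<lambda>x. - a + x) ` (f -` S)" by (rule image_eqI)
  qed auto
  ultimately show "(\<lambda>x. f (x + a)) -` S \<inter> space lebesgue \<in> sets lebesgue" by simp
qed simp

lemma borel_measurable_lebesgue_on_AE:
  fixes f g :: "'a::euclidean_space \<Rightarrow> real"
  assumes g[measurable]: "g \<in> borel_measurable lebesgue" and [measurable]: "\<Omega> \<in> sets lebesgue"
    and ae: "AE x in lebesgue. x \<in> \<Omega> \<longrightarrow> f x = g x"
  shows "f \<in> borel_measurable (lebesgue_on \<Omega>)"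
proof -
  have g0: "(\<lambda>x. indicator \<Omega> x *\<^sub>R g x) \<in> borel_measurable lebesgue" by measurable
  have "(\<lambda>x. indicator \<Omega> x *\<^sub>R f x) \<in> borel_measurable lebesgue"
  proof (rule measurableI)
    fix S :: "real set" assume S: "S \<in> sets borel"
    have "(\<lambda>x. indicator \<Omega> x *\<^sub>R f x) -` S \<in> sets lebesgue"
    proof (rule completion.in_sets_AE)
      show "(\<lambda>x. indicator \<Omega> x *\<^sub>R g x) -` S \<in> sets lebesgue"
        using measurable_sets[OF g0 S] by simp
      show "AE x in lebesgue. x \<in> (\<lambda>x. indicator \<Omega> x *\<^sub>R g x) -` S \<longleftrightarrow> x \<in> (\<lambda>x. indicator \<Omega> x *\<^sub>R f x) -` S"
        using ae by eventually_elim (auto simp: indicator_def)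
    qed simp
    then show "(\<lambda>x. indicator \<Omega> x *\<^sub>R f x) -` S \<inter> space lebesgue \<in> sets lebesgue" by simp
  qed simp
  then show ?thesis by (subst borel_measurable_restrict_space_iff) auto
qed

text \<open>A null set of parallel lines sweeps out a null set of points. Transfers properties of
  lines to almost every point, in the direction opposite to \<open>AE_lines\<close>.\<close>

lemma AE_lines_imp_AE:
  fixes k :: "'n::finite"
  assumes "AE y in lines_measure k. Q y"
  shows "AE x in lborel. Q (\<lambda>i\<in>UNIV - {k}. (x :: real ^ 'n) $ i)"
proof -
  obtain N where N: "N \<in> null_sets (lines_measure k)" "{y \<in> space (lines_measure k). \<not> Q y} \<subseteq> N"
    using assms by (auto elim!: AE_E3 simp: eventually_ae_filter)
  let ?r = "\<lambda>x :: real ^ 'n. \<lambda>i\<in>UNIV - {k}. x $ i"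
  have r: "?r \<in> borel \<rightarrow>\<^sub>M lines_measure k"
    by (intro measurable_restrict) (simp add: borel_measurable_continuous_onI continuous_on_component)
  let ?T = "?r -` N"
  have T: "?T \<in> sets borel" using measurable_sets[OF r, of N] N(1) by auto
  have "?T \<in> null_sets lebesgue"
  proof (rule null_set_if_null_on_lines)
    show "?T \<in> sets lebesgue" using T by simp
    show "AE y in lines_measure k. AE z in lborel. insert_coord k y z \<notin> ?T"
      using AE_not_in[OF N(1)] AE_space
    proof eventually_elim
      case (elim y)
      have "?r (insert_coord k y z) = y" for z
        using elim(2) by (auto simp: space_PiM PiE_def extensional_def restrict_def fun_eq_iff)
      then have "insert_coord k y z \<notin> ?T" for z using elim(1) by (simp only: vimage_eq not_False_eq_True)
      then show ?case by (intro AE_I2)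
    qed
  qed
  then have "AE x in lborel. x \<notin> ?T" using T AE_not_in AE_completion_iff by blast
  then show ?thesis
  proof eventually_elim
    case (elim x)
    have "?r x \<in> space (lines_measure k)" by (auto simp: space_PiM)
    then show ?case using elim N(2) by blast
  qed
qed

lemma insert_coord_restrict: "insert_coord k (\<lambda>i\<in>UNIV - {k}. x $ i) (x $ k) = x"
  by (simp add: vec_eq_iff)

lemma open_line_section:
  assumes "open \<Omega>"
  shows "open (line_section \<Omega> k y)"
proof -
  have "open (insert_coord k y -` \<Omega>)" by (rule open_vimage[OF assms continuous_insert_coord])
  then show ?thesis by (simp add: line_section_def vimage_def)
qed

lemma has_derivative_line_iff:
  "((\<lambda>s. u (insert_coord k y z + s *\<^sub>R axis k 1)) has_real_derivative D) (at 0) \<longleftrightarrow>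
   ((\<lambda>z. u (insert_coord k y z)) has_real_derivative D) (at z)"
  unfolding insert_coord_add
  using DERIV_shift[of "\<lambda>z. u (insert_coord k y z)" D 0 z] by (simp add: add.commute)

text \<open>Valid also where no derivative exists, because both sides then choose from the same
  predicate.\<close>

lemma partial_deriv_insert_coord:
  "partial_deriv k u (insert_coord k y z) = deriv (\<lambda>z. u (insert_coord k y z)) z"
  unfolding partial_deriv_def deriv_def has_derivative_line_iff ..

text \<open>A line outside \<open>line_proj\<close> contains no interval of a section, so the
  condition holds there vacuously and almost all lines of the space are covered.\<close>

lemma ACL_AE_lines:
  assumes "u \<in> ACL \<Omega>"
  shows "AE y in lines_measure k. \<forall>a b. a \<le> b \<longrightarrow> {a..b} \<subseteq> line_section \<Omega> k y \<longrightarrow>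
     abs_cont_on a b (\<lambda>z. u (insert_coord k y z))"
proof -
  have "line_proj \<Omega> k - AC_lines \<Omega> u k \<in> null_sets (completion (lines_measure k))"
    using assms by (simp add: ACL_def)
  then have "AE y in completion (lines_measure k). y \<notin> line_proj \<Omega> k - AC_lines \<Omega> u k" by (rule AE_not_in)
  then have "AE y in lines_measure k. y \<notin> line_proj \<Omega> k - AC_lines \<Omega> u k" by (simp only: AE_completion_iff)
  then show ?thesis using AE_space
  proof eventually_elim
    case (elim y)
    show ?case
    proof (intro allI impI)
      fix a b assume ab: "a \<le> b" "{a..b} \<subseteq> line_section \<Omega> k y"
      then have "insert_coord k y a \<in> \<Omega>" by (auto simp: line_section_def subset_iff)
      then have "y \<in> line_proj \<Omega> k" using elim(2) by (auto simp: line_proj_def space_PiM)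
      then show "abs_cont_on a b (\<lambda>z. u (insert_coord k y z))" using elim(1) ab by (auto simp: AC_lines_def)
    qed
  qed
qed

text \<open>Restricting to rational increments turns differentiability into a measurable condition.\<close>

lemma rational_quotients_imp_derivative:
  fixes f :: "real \<Rightarrow> real"
  assumes "e > 0" and cont: "continuous_on {z - e..z + e} f"
    and quot: "\<And>\<epsilon>. \<epsilon> > 0 \<Longrightarrow> \<exists>\<delta>>0. \<forall>q::rat. 0 < \<bar>q\<bar> \<and> real_of_rat \<bar>q\<bar> < \<delta> \<longrightarrow>
        \<bar>(f (z + of_rat q) - f z) / of_rat q - D\<bar> \<le> \<epsilon>"
  shows "(f has_real_derivative D) (at z)"
  unfolding DERIV_def LIM_eq
proof (intro allI impI)
  fix \<epsilon> :: real assume "\<epsilon> > 0"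
  then have "\<epsilon> / 2 > 0" by simp
  from quot[OF this] obtain \<delta> where \<delta>: "\<delta> > 0" and q: "\<And>q::rat. 0 < \<bar>q\<bar> \<Longrightarrow> real_of_rat \<bar>q\<bar> < \<delta> \<Longrightarrow>
        \<bar>(f (z + of_rat q) - f z) / of_rat q - D\<bar> \<le> \<epsilon> / 2" by blast
  define S where "S = {s. s \<noteq> 0 \<and> \<bar>s\<bar> < min \<delta> e}"
  let ?h = "\<lambda>s. \<bar>(f (z + s) - f z) / s - D\<bar>"
  have S_open: "open S"
  proof -
    have "S = (- {0}) \<inter> {- min \<delta> e<..<min \<delta> e}" by (auto simp: S_def)
    moreover have "open ((- {0 :: real}) \<inter> {- min \<delta> e<..<min \<delta> e})" by (intro open_Int) auto
    ultimately show ?thesis by simp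
  qed
  have "continuous_on S (\<lambda>s. f (z + s))"
    by (rule continuous_on_compose2[OF cont]) (auto intro!: continuous_intros simp: S_def)
  then have hc: "continuous_on S ?h" by (intro continuous_intros) (auto simp: S_def)
  \<comment> \<open>A violation at one s would persist on an open set by continuity of the quotient,
    and that set contains a rational number.\<close>
  have "?h s \<le> \<epsilon> / 2" if "s \<in> S" for s
  proof (rule ccontr)
    assume "\<not> ?h s \<le> \<epsilon> / 2"
    then have "s \<in> S \<inter> ?h -` {\<epsilon> / 2<..}" using that by simp
    moreover have "open (S \<inter> ?h -` {\<epsilon> / 2<..})" by (rule continuous_open_preimage[OF hc S_open]) simp
    ultimately obtain d where d: "d > 0" "ball s d \<subseteq> S \<inter> ?h -` {\<epsilon> / 2<..}" by (meson openE)
    obtain p where p: "s < of_rat p" "of_rat p < s + d" using of_rat_dense[of s "s + d"] d by auto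
    then have "of_rat p \<in> ball s d" by (simp add: dist_real_def)
    then have *: "of_rat p \<in> S" "\<epsilon> / 2 < ?h (of_rat p)" using d by auto
    have "0 < \<bar>p\<bar>" "real_of_rat \<bar>p\<bar> < \<delta>" using *(1) by (auto simp: S_def abs_if of_rat_minus split: if_splits)
    then show False using q[of p] *(2) by simp
  qed
  then show "\<exists>s>0. \<forall>x. x \<noteq> 0 \<and> norm (x - 0) < s \<longrightarrow> norm ((f (z + x) - f z) / x - D) < \<epsilon>"
    using \<delta> \<open>e > 0\<close> \<open>\<epsilon> > 0\<close> by (intro exI[of _ "min \<delta> e"]) (force simp: S_def)
qed

text \<open>Fubini's theorem asks for a measurable exceptional set before differentiability is
  known. The limit along 1 / (n + 1) provides a measurable candidate \<open>g\<close>, and the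
  condition \<open>C\<close>, with countable quantifiers only, says that rational quotients converge
  to it. Almost everywhere differentiability on almost every line gives \<open>C\<close> almost
  everywhere in \<open>\<Omega>\<close>; continuity along the line turns rational into real
  increments.\<close>

lemma ACL_AE_partial_derivative:
  fixes u :: "real ^ 'n \<Rightarrow> real"
  assumes "open \<Omega>" and u: "u \<in> ACL \<Omega>" and um: "u \<in> borel_measurable (lebesgue_on \<Omega>)"
  obtains g where "g \<in> borel_measurable lebesgue"
    "AE x in lebesgue. x \<in> \<Omega> \<longrightarrow> ((\<lambda>s. u (x + s *\<^sub>R axis k 1)) has_real_derivative g x) (at 0)"
proof -
  have Om[measurable]: "\<Omega> \<in> sets lebesgue" using \<open>open \<Omega>\<close> by simp
  let ?e = "axis k 1 :: real ^ 'n"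
  \<comment> \<open>Extension by zero makes every translate measurable; for small increments at
    points of \<open>\<Omega>\<close> the quotients are those of \<open>u\<close>.\<close>
  define v where "v x = indicator \<Omega> x *\<^sub>R u x" for x
  have v: "v \<in> borel_measurable lebesgue"
    using um unfolding v_def[abs_def] by (subst (asm) borel_measurable_restrict_space_iff) auto
  define D where "D s x = (v (x + s *\<^sub>R ?e) - v x) / s" for s x
  have D[measurable]: "D s \<in> borel_measurable lebesgue" for s
    unfolding D_def[abs_def] using v measurable_lebesgue_translation[OF v, of "s *\<^sub>R ?e"] by (intro borel_measurable_divide borel_measurable_diff) auto
  define g where "g x = lim (\<lambda>n. D (1 / real (Suc n)) x)" for x
  have g[measurable]: "g \<in> borel_measurable lebesgue"
    unfolding g_def[abs_def] by (intro borel_measurable_lim_metric D)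
  define C where "C x \<longleftrightarrow> (\<forall>n::nat. \<exists>m::nat. \<forall>q::rat. 0 < \<bar>q\<bar> \<and> real_of_rat \<bar>q\<bar> < 1 / real (Suc m) \<longrightarrow>
      \<bar>D (of_rat q) x - g x\<bar> \<le> 1 / real (Suc n))" for x
  have B: "{x \<in> space lebesgue. x \<in> \<Omega> \<and> \<not> C x} \<in> sets lebesgue" unfolding C_def by measurable
  then have B: "{x. x \<in> \<Omega> \<and> \<not> C x} \<in> sets lebesgue" by simp
  have "{x. x \<in> \<Omega> \<and> \<not> C x} \<in> null_sets lebesgue"
  proof (rule null_set_if_null_on_lines[OF B])
    show "AE y in lines_measure k. AE z in lborel. insert_coord k y z \<notin> {x. x \<in> \<Omega> \<and> \<not> C x}"
      using ACL_AE_lines[OF u, of k]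
    proof eventually_elim
      case (elim y)
      let ?f = "\<lambda>z. u (insert_coord k y z)" and ?Z = "line_section \<Omega> k y"
      have Z: "open ?Z" by (rule open_line_section[OF \<open>open \<Omega>\<close>])
      have "AE z in lborel. z \<in> ?Z \<longrightarrow> (?f has_real_derivative deriv ?f z) (at z)"
        by (rule abs_cont_on_AE_differentiable[OF _ Z]) (use elim in blast)
      then show ?case
      proof eventually_elim
        case (elim z)
        show ?case
        proof (rule notI)
          let ?x = "insert_coord k y z"
          assume "?x \<in> {x. x \<in> \<Omega> \<and> \<not> C x}"
          then have x: "?x \<in> \<Omega>" "\<not> C ?x" by auto
          then have zZ: "z \<in> ?Z" by (simp add: line_section_def)
          define d where "d = deriv ?f z"
          have der: "(?f has_real_derivative d) (at z)" using elim zZ by (simp add: d_def)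
          obtain r where r: "r > 0" "ball z r \<subseteq> ?Z" using Z zZ openE by blast
          have Dx: "D s ?x = (?f (z + s) - ?f z) / s" if "\<bar>s\<bar> < r" for s
          proof -
            have "z + s \<in> ?Z" using r that by (auto simp: dist_real_def)
            then have "insert_coord k y (z + s) \<in> \<Omega>" by (simp add: line_section_def)
            then show ?thesis using x by (simp add: D_def v_def insert_coord_add)
          qed
          have lim: "\<exists>\<delta>>0. \<forall>s. s \<noteq> 0 \<and> \<bar>s\<bar> < \<delta> \<longrightarrow> \<bar>D s ?x - d\<bar> < \<epsilon>" if "\<epsilon> > 0" for \<epsilon>
          proof -
            obtain \<delta> where \<delta>: "\<delta> > 0" "\<forall>s. s \<noteq> 0 \<and> norm (s - 0) < \<delta> \<longrightarrow> norm ((?f (z + s) - ?f z) / s - d) < \<epsilon>"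
              using der \<open>\<epsilon> > 0\<close> unfolding DERIV_def LIM_eq by blast
            then show ?thesis using Dx r by (intro exI[of _ "min \<delta> r"]) auto
          qed
          have "(\<lambda>n. D (1 / real (Suc n)) ?x) \<longlonglongrightarrow> d"
          proof (rule LIMSEQ_I)
            fix \<epsilon> :: real assume "\<epsilon> > 0"
            then obtain \<delta> where \<delta>: "\<delta> > 0" "\<forall>s. s \<noteq> 0 \<and> \<bar>s\<bar> < \<delta> \<longrightarrow> \<bar>D s ?x - d\<bar> < \<epsilon>" using lim by blast
            obtain N where N: "1 / real (Suc N) < \<delta>" using \<delta>(1) by (meson nat_approx_posE)
            have "norm (D (1 / real (Suc n)) ?x - d) < \<epsilon>" if "n \<ge> N" for n
            proof -
              have "1 / real (Suc n) \<le> 1 / real (Suc N)" using that by (intro divide_left_mono) auto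
              then have "1 / real (Suc n) < \<delta>" using N by linarith
              then show ?thesis using \<delta>(2)[rule_format, of "1 / real (Suc n)"] by simp
            qed
            then show "\<exists>no. \<forall>n\<ge>no. norm (D (1 / real (Suc n)) ?x - d) < \<epsilon>" by blast
          qed
          then have gd: "g ?x = d" unfolding g_def by (rule limI)
          have "C ?x"
            unfolding C_def
          proof
            fix n :: nat
            obtain \<delta> where \<delta>: "\<delta> > 0" "\<forall>s. s \<noteq> 0 \<and> \<bar>s\<bar> < \<delta> \<longrightarrow> \<bar>D s ?x - d\<bar> < 1 / real (Suc n)"
              using lim[of "1 / real (Suc n)"] by auto
            obtain m where m: "1 / real (Suc m) < \<delta>" using \<delta>(1) by (meson nat_approx_posE)
            have "\<bar>D (of_rat q) ?x - g ?x\<bar> \<le> 1 / real (Suc n)" if "0 < \<bar>q\<bar>" "real_of_rat \<bar>q\<bar> < 1 / real (Suc m)" for q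
            proof -
              have "\<bar>real_of_rat q\<bar> < \<delta>" using that(2) m by (simp add: abs_if of_rat_minus split: if_splits)
              then show ?thesis using \<delta>(2)[rule_format, of "of_rat q"] that(1) gd by auto
            qed
            then show "\<exists>m. \<forall>q. 0 < \<bar>q\<bar> \<and> real_of_rat \<bar>q\<bar> < 1 / real (Suc m) \<longrightarrow>
                \<bar>D (of_rat q) ?x - g ?x\<bar> \<le> 1 / real (Suc n)" by blast
          qed
          then show False using x by simp
        qed
      qed
    qed
  qed
  then have ae1: "AE x in lebesgue. x \<notin> {x. x \<in> \<Omega> \<and> \<not> C x}" by (rule AE_not_in)
  \<comment> \<open>Supplies absolute continuity, hence continuity, on the line through almost every
    point.\<close>
  note ae2 = AE_completion[OF AE_lines_imp_AE[OF ACL_AE_lines[OF u, of k]]]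
  have "AE x in lebesgue. x \<in> \<Omega> \<longrightarrow> ((\<lambda>s. u (x + s *\<^sub>R ?e)) has_real_derivative g x) (at 0)"
    using ae1 ae2
  proof eventually_elim
    case (elim x)
    show ?case
    proof
      assume x: "x \<in> \<Omega>"
      define y where "y = (\<lambda>i\<in>UNIV - {k}. x $ i)"
      define z where "z = x $ k"
      have xyz: "x = insert_coord k y z" by (simp add: y_def z_def insert_coord_restrict)
      let ?f = "\<lambda>z. u (insert_coord k y z)" and ?Z = "line_section \<Omega> k y"
      have "z \<in> ?Z" using x xyz by (simp add: line_section_def)
      then obtain e where e: "e > 0" "cball z e \<subseteq> ?Z"
        using open_line_section[OF \<open>open \<Omega>\<close>] open_contains_cball by blast
      have sub: "{z - e..z + e} \<subseteq> ?Z" using e(2) by (simp add: cball_eq_atLeastAtMost)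
      have "(?f has_real_derivative g x) (at z)"
      proof (rule rational_quotients_imp_derivative[OF e(1)])
        have "abs_cont_on (z - e) (z + e) ?f" using elim(2) sub e(1) by (simp add: y_def)
        then show "continuous_on {z - e..z + e} ?f" by (rule abs_cont_on_continuous)
        fix \<epsilon> :: real assume "\<epsilon> > 0"
        then obtain n where n: "1 / real (Suc n) < \<epsilon>" by (meson nat_approx_posE)
        have "C x" using elim(1) x by simp
        then obtain m :: nat where m: "\<And>q::rat. 0 < \<bar>q\<bar> \<Longrightarrow> real_of_rat \<bar>q\<bar> < 1 / real (Suc m) \<Longrightarrow>
           \<bar>D (of_rat q) x - g x\<bar> \<le> 1 / real (Suc n)" unfolding C_def by meson
        have "\<bar>(?f (z + of_rat q) - ?f z) / of_rat q - g x\<bar> \<le> \<epsilon>"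
          if q: "0 < \<bar>q\<bar>" "real_of_rat \<bar>q\<bar> < min (1 / real (Suc m)) e" for q :: rat
        proof -
          have "\<bar>real_of_rat q\<bar> < e" using q(2) by (simp add: abs_if of_rat_minus split: if_splits)
          then have "z + of_rat q \<in> {z - e..z + e}" by (simp only: abs_less_iff atLeastAtMost_iff) linarith
          then have "z + of_rat q \<in> ?Z" using sub by blast
          then have "D (of_rat q) x = (?f (z + of_rat q) - ?f z) / of_rat q"
            using x by (simp add: D_def v_def xyz insert_coord_add line_section_def)
          then show ?thesis using m[of q] q n by simp
        qed
        then show "\<exists>\<delta>>0. \<forall>q::rat. 0 < \<bar>q\<bar> \<and> real_of_rat \<bar>q\<bar> < \<delta> \<longrightarrow>
            \<bar>(?f (z + of_rat q) - ?f z) / of_rat q - g x\<bar> \<le> \<epsilon>"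
          using e(1) by (intro exI[of _ "min (1 / real (Suc m)) e"]) auto
      qed
      then show "((\<lambda>s. u (x + s *\<^sub>R ?e)) has_real_derivative g x) (at 0)"
        unfolding xyz has_derivative_line_iff .
    qed
  qed
  then show thesis using that g by blast
qed

lemma ACL_partial_deriv_measurable:
  assumes "open \<Omega>" "u \<in> ACL \<Omega>" "u \<in> borel_measurable (lebesgue_on \<Omega>)"
  shows "partial_deriv k u \<in> borel_measurable (lebesgue_on \<Omega>)"
proof -
  obtain g where g: "g \<in> borel_measurable lebesgue"
    "AE x in lebesgue. x \<in> \<Omega> \<longrightarrow> ((\<lambda>s. u (x + s *\<^sub>R axis k 1)) has_real_derivative g x) (at 0)"
    using ACL_AE_partial_derivative[OF assms] .
  have "AE x in lebesgue. x \<in> \<Omega> \<longrightarrow> partial_deriv k u x = g x"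
    using g(2) by eventually_elim (auto simp: partial_deriv_def DERIV_imp_deriv)
  then show ?thesis by (rule borel_measurable_lebesgue_on_AE[OF g(1), rotated]) (use \<open>open \<Omega>\<close> in simp)
qed

lemma has_derivative_imp_partial:
  assumes "(f has_derivative f') (at x)"
  shows "((\<lambda>s. f (x + s *\<^sub>R axis k 1)) has_real_derivative f' (axis k 1)) (at 0)"
    and "partial_deriv k f x = f' (axis k 1)"
proof -
  have "((\<lambda>s. x + s *\<^sub>R axis k 1) has_derivative (\<lambda>s. s *\<^sub>R axis k 1)) (at 0)"
    by (auto intro!: derivative_eq_intros)
  moreover have "(f has_derivative f') (at (x + 0 *\<^sub>R axis k 1))" using assms by simp
  ultimately have "((\<lambda>s. f (x + s *\<^sub>R axis k 1)) has_derivative (\<lambda>s. f' (s *\<^sub>R axis k 1))) (at 0)"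
    by (rule has_derivative_compose)
  moreover have "f' (s *\<^sub>R axis k 1) = f' (axis k 1) * s" for s
    using linear_scale[OF has_derivative_linear[OF assms]] by simp
  ultimately show "((\<lambda>s. f (x + s *\<^sub>R axis k 1)) has_real_derivative f' (axis k 1)) (at 0)"
    by (simp add: has_field_derivative_def)
  then show "partial_deriv k f x = f' (axis k 1)" unfolding partial_deriv_def by (rule DERIV_imp_deriv)
qed

lemma C1_partial:
  assumes "Ck_on 1 S f"
  shows "\<And>x. x \<in> S \<Longrightarrow> ((\<lambda>s. f (x + s *\<^sub>R axis k 1)) has_real_derivative partial_deriv k f x) (at 0)"
    and "continuous_on S (partial_deriv k f)"
proof -
  obtain f' where f': "\<forall>x\<in>S. (f has_derivative f' x) (at x)" "\<forall>k. continuous_on S (\<lambda>x. f' x (axis k 1))"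
    using assms by auto
  then have eq: "partial_deriv k f x = f' x (axis k 1)" if "x \<in> S" for x
    using has_derivative_imp_partial(2) that by blast
  show "((\<lambda>s. f (x + s *\<^sub>R axis k 1)) has_real_derivative partial_deriv k f x) (at 0)" if "x \<in> S" for x
    using has_derivative_imp_partial(1) f'(1) eq that by metis
  show "continuous_on S (partial_deriv k f)" using f'(2) eq by (simp cong: continuous_on_cong)
qed

lemma partial_deriv_zero_off_support:
  assumes "closed K" "\<And>x. x \<notin> K \<Longrightarrow> \<psi> x = 0" "x \<notin> K"
  shows "partial_deriv k \<psi> x = 0"
proof -
  have "((\<lambda>_. 0) has_derivative (\<lambda>_. 0)) (at x)" by simp
  then have "(\<psi> has_derivative (\<lambda>_. 0)) (at x)"
    by (rule has_derivative_transform_within_open[of _ _ _ _ "- K"]) (use assms in auto)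
  from has_derivative_imp_partial(2)[OF this] show ?thesis by simp
qed

text \<open>The sum of both integrands has integral 0 on almost every line by integration by parts;
  integrability of the sum lets Fubini's theorem carry this to the whole space.\<close>

lemma ACL_has_weak_partial:
  fixes u :: "real ^ 'n \<Rightarrow> real"
  assumes "open \<Omega>" and u: "u \<in> ACL \<Omega>" "locally_integrable \<Omega> u" "locally_integrable \<Omega> (partial_deriv k u)"
  shows "has_weak_partial \<Omega> k u (partial_deriv k u)"
  unfolding has_weak_partial_def
proof (intro conjI u ballI)
  fix \<psi> assume \<psi>: "\<psi> \<in> test_functions \<Omega>"
  define K where "K = closure {x. \<psi> x \<noteq> 0}"
  note props = test_function_props[OF \<psi>, folded K_def]
  have K: "closed K" by (simp add: K_def)
  have C1: "Ck_on 1 UNIV \<psi>" using \<psi> by (simp add: test_functions_def del: One_nat_def)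
  note d\<psi> = C1_partial[OF C1, where k = k]
  have z: "partial_deriv k \<psi> x = 0" if "x \<notin> K" for x
    by (rule partial_deriv_zero_off_support[OF K props(4) that])
  note i1 = integrable_compact_support_mult[OF \<open>open \<Omega>\<close> u(2) d\<psi>(2) props(2,3) z]
  note i2 = integrable_compact_support_mult[OF \<open>open \<Omega>\<close> u(3) props]
  \<comment> \<open>The cutoff to the support of \<open>\<psi>\<close> makes the sum integrable on
    the whole space and discards the arbitrary values of \<open>u\<close> outside
    \<open>\<Omega>\<close>.\<close>
  define F where "F x = indicator K x * u x * partial_deriv k \<psi> x + indicator K x * partial_deriv k u x * \<psi> x" for x
  have F: "integrable lebesgue F" unfolding F_def[abs_def] by (intro Bochner_Integration.integrable_add i1(2) i2(2))
  have F0: "(\<integral>x. F x \<partial>lebesgue) = 0"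
  proof (rule lebesgue_integral_eq_0_if_on_lines[OF F])
    show "AE y in lines_measure k. \<exists>g. integrable lborel g \<and> (LBINT z. g z) = 0 \<and> (AE z in lborel. F (insert_coord k y z) = g z)"
      using ACL_AE_lines[OF u(1), of k]
    proof eventually_elim
      case (elim y)
      let ?f = "\<lambda>z. u (insert_coord k y z)" and ?Z = "line_section \<Omega> k y"
      let ?\<psi> = "\<lambda>z. \<psi> (insert_coord k y z)" and ?\<psi>' = "\<lambda>z. partial_deriv k \<psi> (insert_coord k y z)"
      let ?S = "insert_coord k y -` K"
      obtain g where g: "integrable lborel g" "(LBINT z. g z) = 0"
        "AE z in lborel. g z = (if z \<in> ?Z then deriv ?f z * ?\<psi> z + ?f z * ?\<psi>' z else 0)"
      proof (rule abs_cont_integration_by_parts)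
        show "open ?Z" by (rule open_line_section[OF \<open>open \<Omega>\<close>])
        show "abs_cont_on a b ?f" if "a \<le> b" "{a..b} \<subseteq> ?Z" for a b using elim that by blast
        show "(?\<psi> has_real_derivative ?\<psi>' z) (at z)" for z
          using d\<psi>(1)[of "insert_coord k y z"] unfolding has_derivative_line_iff by simp
        show "continuous_on UNIV ?\<psi>'"
          by (rule continuous_on_compose2[OF d\<psi>(2) continuous_insert_coord]) simp
        show "compact ?S"
          unfolding compact_eq_bounded_closed
        proof
          show "closed ?S" by (rule closed_vimage[OF K continuous_insert_coord])
          have "bounded K" by (rule compact_imp_bounded[OF props(2)])
          then obtain r where r: "\<And>x. x \<in> K \<Longrightarrow> norm x \<le> r" unfolding bounded_iff by blast
          have "norm z \<le> r" if "z \<in> ?S" for z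
            using r[of "insert_coord k y z"] component_le_norm_cart[of "insert_coord k y z" k] that by simp
          then show "bounded ?S" unfolding bounded_iff by blast
        qed
        show "?S \<subseteq> ?Z" using props(3) by (auto simp: line_section_def)
        show "?\<psi> z = 0" if "z \<notin> ?S" for z using props(4) that by simp
      qed (rule that)
      have "AE z in lborel. F (insert_coord k y z) = g z"
        using g(3)
      proof eventually_elim
        case (elim z)
        show ?case
        proof (cases "insert_coord k y z \<in> K")
          case True
          then have "z \<in> ?Z" using props(3) by (auto simp: line_section_def)
          then show ?thesis using True elim by (simp add: F_def partial_deriv_insert_coord)
        next
          case False
          then show ?thesis using elim props(4) z by (simp add: F_def)
        qed
      qed
      then show ?case using g by blast
    qed
  qed
  have Om: "\<Omega> \<in> sets lebesgue" using \<open>open \<Omega>\<close> by simp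
  have "(\<integral>x. u x * partial_deriv k \<psi> x \<partial>lebesgue_on \<Omega>) + (\<integral>x. partial_deriv k u x * \<psi> x \<partial>lebesgue_on \<Omega>)
      = (\<integral>x. u x * partial_deriv k \<psi> x + partial_deriv k u x * \<psi> x \<partial>lebesgue_on \<Omega>)"
    by (rule Bochner_Integration.integral_add[OF i1(1) i2(1), symmetric])
  also have "\<dots> = (\<integral>x. F x \<partial>lebesgue)"
  proof -
    have "(\<lambda>x. indicator \<Omega> x *\<^sub>R (u x * partial_deriv k \<psi> x + partial_deriv k u x * \<psi> x)) = F"
      using props(3,4) z by (fastforce simp: F_def indicator_def fun_eq_iff)
    then show ?thesis using Om by (simp add: integral_restrict_space)
  qed
  finally show "(\<integral>x. u x * partial_deriv k \<psi> x \<partial>lebesgue_on \<Omega>) = - (\<integral>x. partial_deriv k u x * \<psi> x \<partial>lebesgue_on \<Omega>)"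
    using F0 by simp
qed

context weak_Phi_space
begin

lemma ACLphi_imp_W1phi:
  assumes "u \<in> ACLphi \<Omega> \<phi>" "u \<in> Lphi \<Omega> \<phi>"
  shows "u \<in> W1phi \<Omega> \<phi>"
proof -
  have u: "u \<in> ACL \<Omega>" "(\<lambda>x. norm (gradient u x)) \<in> Lphi \<Omega> \<phi>" using assms(1) by (auto simp: ACLphi_def)
  have "\<exists>g\<in>Lphi \<Omega> \<phi>. has_weak_partial \<Omega> k u g" for k
  proof -
    have "\<bar>partial_deriv k u x\<bar> \<le> norm (gradient u x)" for x
      using component_le_norm_cart[of "gradient u x" k] by (simp add: gradient_def)
    then have p: "partial_deriv k u \<in> Lphi \<Omega> \<phi>"
      using Lphi_dominated[OF u(2) ACL_partial_deriv_measurable[OF open_\<Omega> u(1) Lphi_measurable[OF assms(2)]]] by simp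
    then show ?thesis
      using ACL_has_weak_partial[OF open_\<Omega> u(1) Lphi_locally_integrable[OF assms(2)] Lphi_locally_integrable[OF p]] by blast
  qed
  then show ?thesis using assms(2) by (simp add: W1phi_def)
qed

end

section \<open>Limits of continuously differentiable functions along curves\<close>

lemma C1_imp_ACL:
  assumes "Ck_on 1 \<Omega> w"
  shows "w \<in> ACL \<Omega>"
proof -
  have "abs_cont_on a b (\<lambda>z. w (insert_coord k y z))" if "{a..b} \<subseteq> line_section \<Omega> k y" for k y a b
  proof (rule abs_cont_on_C1)
    have in\<Omega>: "insert_coord k y z \<in> \<Omega>" if "a \<le> z" "z \<le> b" for z
      using \<open>{a..b} \<subseteq> line_section \<Omega> k y\<close> that by (auto simp: line_section_def subset_iff)
    show "((\<lambda>z. w (insert_coord k y z)) has_real_derivative partial_deriv k w (insert_coord k y z)) (at z)"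
      if "a \<le> z" "z \<le> b" for z
      using C1_partial(1)[OF assms in\<Omega>[OF that], of k] unfolding has_derivative_line_iff .
    show "continuous_on {a..b} (\<lambda>z. partial_deriv k w (insert_coord k y z))"
      by (rule continuous_on_compose2[OF C1_partial(2)[OF assms] continuous_insert_coord]) (use in\<Omega> in auto)
  qed
  then have empty: "line_proj \<Omega> k - AC_lines \<Omega> w k = {}" for k by (auto simp: AC_lines_def)
  show ?thesis unfolding ACL_def mem_Collect_eq empty by simp
qed

lemma C1_imp_continuous:
  assumes "Ck_on 1 \<Omega> w"
  shows "continuous_on \<Omega> w"
  using Ck_on_Suc_imp[of 0 \<Omega> w] assms by simp

lemma continuous_imp_locally_integrable:
  fixes w :: "real ^ 'n \<Rightarrow> real"
  assumes "continuous_on \<Omega> w"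
  shows "locally_integrable \<Omega> w"
  unfolding locally_integrable_def
proof (intro allI impI)
  fix K assume K: "compact K \<and> K \<subseteq> \<Omega>"
  then have "integrable lborel (\<lambda>x. indicator K x *\<^sub>R w x)"
    using assms by (intro borel_integrable_compact) (auto intro: continuous_on_subset)
  then have "integrable lebesgue (\<lambda>x. indicator K x *\<^sub>R w x)"
    by (subst integrable_completion) auto
  moreover have "K \<in> sets lebesgue" using K by (simp add: compact_imp_closed borel_closed)
  ultimately show "integrable (lebesgue_on K) w" by (simp add: integrable_restrict_space)
qed

lemma C1_has_weak_partial:
  assumes "open \<Omega>" "Ck_on 1 \<Omega> w"
  shows "has_weak_partial \<Omega> k w (partial_deriv k w)"
  using assms by (intro ACL_has_weak_partial C1_imp_ACL continuous_imp_locally_integrable C1_imp_continuous C1_partial(2))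

lemma has_weak_partial_diff:
  assumes "open \<Omega>" and u: "has_weak_partial \<Omega> k u g" and w: "has_weak_partial \<Omega> k w h"
  shows "has_weak_partial \<Omega> k (\<lambda>x. w x - u x) (\<lambda>x. h x - g x)"
  unfolding has_weak_partial_def
proof (intro conjI ballI)
  have li: "locally_integrable \<Omega> u" "locally_integrable \<Omega> g" "locally_integrable \<Omega> w" "locally_integrable \<Omega> h"
    using u w by (auto simp: has_weak_partial_def)
  then show "locally_integrable \<Omega> (\<lambda>x. w x - u x)" "locally_integrable \<Omega> (\<lambda>x. h x - g x)"
    unfolding locally_integrable_def by auto
  fix \<psi> assume \<psi>: "\<psi> \<in> test_functions \<Omega>"
  define K where "K = closure {x. \<psi> x \<noteq> 0}"
  note props = test_function_props[OF \<psi>, folded K_def]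
  have C1: "Ck_on 1 UNIV \<psi>" using \<psi> by (simp add: test_functions_def del: One_nat_def)
  have z: "partial_deriv k \<psi> x = 0" if "x \<notin> K" for x
    by (rule partial_deriv_zero_off_support[OF _ props(4) that]) (auto simp: K_def)
  note i1 = integrable_compact_support_mult(1)[OF \<open>open \<Omega>\<close> _ C1_partial(2)[OF C1] props(2,3) z]
  note i2 = integrable_compact_support_mult(1)[OF \<open>open \<Omega>\<close> _ props]
  have "(\<integral>x. (w x - u x) * partial_deriv k \<psi> x \<partial>lebesgue_on \<Omega>) =
      (\<integral>x. w x * partial_deriv k \<psi> x \<partial>lebesgue_on \<Omega>) - (\<integral>x. u x * partial_deriv k \<psi> x \<partial>lebesgue_on \<Omega>)"
    unfolding left_diff_distrib by (rule Bochner_Integration.integral_diff[OF i1[OF li(3)] i1[OF li(1)]])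
  moreover have "(\<integral>x. (h x - g x) * \<psi> x \<partial>lebesgue_on \<Omega>) =
      (\<integral>x. h x * \<psi> x \<partial>lebesgue_on \<Omega>) - (\<integral>x. g x * \<psi> x \<partial>lebesgue_on \<Omega>)"
    unfolding left_diff_distrib by (rule Bochner_Integration.integral_diff[OF i2[OF li(4)] i2[OF li(2)]])
  moreover have "(\<integral>x. w x * partial_deriv k \<psi> x \<partial>lebesgue_on \<Omega>) = - (\<integral>x. h x * \<psi> x \<partial>lebesgue_on \<Omega>)"
    "(\<integral>x. u x * partial_deriv k \<psi> x \<partial>lebesgue_on \<Omega>) = - (\<integral>x. g x * \<psi> x \<partial>lebesgue_on \<Omega>)"
    using u w \<psi> by (auto simp: has_weak_partial_def)
  ultimately show "(\<integral>x. (w x - u x) * partial_deriv k \<psi> x \<partial>lebesgue_on \<Omega>) =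
      - (\<integral>x. (h x - g x) * \<psi> x \<partial>lebesgue_on \<Omega>)" by simp
qed

section \<open>Growth of C1 functions along rectifiable curves\<close>

lemma has_derivative_abs_le_gradient:
  fixes w :: "real ^ 'n \<Rightarrow> real"
  assumes "(w has_derivative w') (at x)"
  shows "\<bar>w' v\<bar> \<le> norm (gradient w x) * norm v"
proof -
  have lin: "linear w'" by (rule has_derivative_linear[OF assms])
  have v: "v = (\<Sum>k\<in>UNIV. (v $ k) *\<^sub>R axis k 1)"
    using basis_expansion[of v] by (simp add: scalar_mult_eq_scaleR)
  have "w' v = (\<Sum>k\<in>UNIV. (v $ k) * w' (axis k 1))"
    by (subst v) (simp add: linear_sum[OF lin] linear_scale[OF lin])
  also have "\<dots> = gradient w x \<bullet> v"
    by (simp add: inner_vec_def gradient_def has_derivative_imp_partial(2)[OF assms] mult.commute)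
  finally show ?thesis by (metis Cauchy_Schwarz_ineq2)
qed

text \<open>Appending t to a partition of [0, s] adds the chord from s to t; taking the supremum, s
  plus this chord is at most the length t.\<close>

lemma Gamma_rect_Lipschitz:
  assumes c: "(l, \<gamma>) \<in> Gamma_rect \<Omega>" and st: "0 \<le> s" "s \<le> t" "t \<le> l"
  shows "dist (\<gamma> s) (\<gamma> t) \<le> t - s"
proof (rule ccontr)
  let ?d = "dist (\<gamma> s) (\<gamma> t)"
  assume "\<not> ?d \<le> t - s"
  then have d: "t - ?d < s" by simp
  have len: "curve_length 0 s \<gamma> = ennreal s" "curve_length 0 t \<gamma> = ennreal t"
    using c st by (auto simp: Gamma_rect_def)
  have ext: "\<sigma> + ennreal ?d \<le> ennreal t"
    if \<sigma>: "\<sigma> = (\<Sum>i<m. ennreal (dist (\<gamma> (p i)) (\<gamma> (p (Suc i)))))" and p: "mono_on {..m} p" "p 0 = 0" "p m = s"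
    for \<sigma> m p
  proof -
    define q where "q = p(Suc m := t)"
    have q: "mono_on {..Suc m} q"
    proof (rule mono_onI)
      fix i j assume ij: "i \<in> {..Suc m}" "j \<in> {..Suc m}" "i \<le> j"
      show "q i \<le> q j"
      proof (cases "j = Suc m")
        case True
        have "p i \<le> t" if "i \<le> m" using p(1,3) that st unfolding mono_on_def by force
        then show ?thesis using True ij by (auto simp: q_def)
      next
        case False
        then show ?thesis using ij p(1) by (auto simp: q_def mono_on_def)
      qed
    qed
    have "q 0 = 0" "q (Suc m) = t" using p by (auto simp: q_def)
    have "(\<Sum>i<Suc m. ennreal (dist (\<gamma> (q i)) (\<gamma> (q (Suc i))))) = \<sigma> + ennreal ?d"
      using p(3) by (simp add: \<sigma> q_def)
    moreover have "(\<Sum>i<Suc m. ennreal (dist (\<gamma> (q i)) (\<gamma> (q (Suc i))))) \<le> curve_length 0 t \<gamma>"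
      unfolding curve_length_def by (rule Sup_upper) (use q \<open>q 0 = 0\<close> \<open>q (Suc m) = t\<close> in blast)
    ultimately show ?thesis using len by simp
  qed
  show False
  \<comment> \<open>For negative \<open>t - ?d\<close> the coercion to \<open>ennreal\<close> would
    give 0; in that case the chord alone already exceeds t.\<close>
  proof (cases "t - ?d < 0")
    case True
    have "mono_on {..1} (\<lambda>i::nat. if i = 0 then 0 else s)" using st by (auto simp: mono_on_def)
    from ext[OF refl this] have "ennreal (dist (\<gamma> 0) (\<gamma> s)) + ennreal ?d \<le> ennreal t" by simp
    then have "ennreal ?d \<le> ennreal t" by (rule order_trans[rotated]) simp
    then show False using True st by (simp add: ennreal_le_iff)
  next
    case False
    then have "ennreal (t - ?d) < curve_length 0 s \<gamma>" using d len by (simp add: ennreal_less_iff)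
    then obtain \<sigma> m p where \<sigma>: "ennreal (t - ?d) < \<sigma>" "\<sigma> = (\<Sum>i<m. ennreal (dist (\<gamma> (p i)) (\<gamma> (p (Suc i)))))"
      "mono_on {..m} p" "p 0 = 0" "p m = s"
      unfolding curve_length_def less_Sup_iff by blast
    have "ennreal t = ennreal (t - ?d) + ennreal ?d" using False by (subst ennreal_plus[symmetric]) auto
    also have "\<dots> < \<sigma> + ennreal ?d" using \<sigma>(1) by (simp add: ennreal_add_left_cancel_less add.commute[of _ "ennreal ?d"])
    finally show False using ext[OF \<sigma>(2-5)] by simp
  qed
qed

lemma gradient_continuous:
  fixes w :: "real ^ 'n \<Rightarrow> real"
  assumes "Ck_on 1 \<Omega> w"
  shows "continuous_on \<Omega> (gradient w)"
  unfolding gradient_def[abs_def] by (intro continuous_on_vec_lambda C1_partial(2)[OF assms])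

lemma Gamma_rectD:
  assumes "(l, \<gamma>) \<in> Gamma_rect \<Omega>"
  shows "0 < l" "continuous_on {0..l} \<gamma>" "\<And>t. t \<in> {0..l} \<Longrightarrow> \<gamma> t \<in> \<Omega>"
  using assms by (auto simp: Gamma_rect_def)

text \<open>In place of a chain rule along a merely Lipschitz curve, the first-order expansion of
  \<open>w\<close> at a point of the curve bounds the increments over short intervals, and bisection
  adds them up. The additive \<open>\<epsilon>\<close> makes room for two errors of size
  \<open>\<epsilon> / 2\<close>: the remainder of the expansion and the oscillation of the
  gradient.\<close>

lemma C1_curve_estimate_real:
  fixes w :: "real ^ 'n \<Rightarrow> real"
  assumes w: "Ck_on 1 \<Omega> w" and c: "(l, \<gamma>) \<in> Gamma_rect \<Omega>" and "\<epsilon> > 0" and st: "0 \<le> s" "s \<le> t" "t \<le> l"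
  shows "\<bar>w (\<gamma> t) - w (\<gamma> s)\<bar> \<le> integral {s..t} (\<lambda>r. norm (gradient w (\<gamma> r)) + \<epsilon>)"
proof -
  let ?h = "\<lambda>r. norm (gradient w (\<gamma> r))"
  note \<gamma> = Gamma_rectD[OF c]
  have hc: "continuous_on {0..l} ?h"
    by (intro continuous_on_norm continuous_on_compose2[OF gradient_continuous[OF w] \<gamma>(2)]) (use \<gamma>(3) in auto)
  have int: "(\<lambda>r. ?h r + \<epsilon>) integrable_on {a..b}" if "0 \<le> a" "b \<le> l" for a b
    by (intro integrable_continuous_real continuous_intros continuous_on_subset[OF hc]) (use that in auto)
  obtain w' where w': "\<And>x. x \<in> \<Omega> \<Longrightarrow> (w has_derivative w' x) (at x)" using w by auto
  have "0 \<le> s \<and> t \<le> l \<longrightarrow> \<bar>w (\<gamma> t) - w (\<gamma> s)\<bar> \<le> integral {s..t} (\<lambda>r. ?h r + \<epsilon>)"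
    using st(2)
  proof (rule Bolzano[where P = "\<lambda>a b. 0 \<le> a \<and> b \<le> l \<longrightarrow> \<bar>w (\<gamma> b) - w (\<gamma> a)\<bar> \<le> integral {a..b} (\<lambda>r. ?h r + \<epsilon>)"])
    fix a b c
    assume *: "0 \<le> a \<and> b \<le> l \<longrightarrow> \<bar>w (\<gamma> b) - w (\<gamma> a)\<bar> \<le> integral {a..b} (\<lambda>r. ?h r + \<epsilon>)"
      "0 \<le> b \<and> c \<le> l \<longrightarrow> \<bar>w (\<gamma> c) - w (\<gamma> b)\<bar> \<le> integral {b..c} (\<lambda>r. ?h r + \<epsilon>)" "a \<le> b" "b \<le> c"
    show "0 \<le> a \<and> c \<le> l \<longrightarrow> \<bar>w (\<gamma> c) - w (\<gamma> a)\<bar> \<le> integral {a..c} (\<lambda>r. ?h r + \<epsilon>)"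
    proof
      assume ac: "0 \<le> a \<and> c \<le> l"
      have "integral {a..b} (\<lambda>r. ?h r + \<epsilon>) + integral {b..c} (\<lambda>r. ?h r + \<epsilon>) = integral {a..c} (\<lambda>r. ?h r + \<epsilon>)"
        using * ac by (intro Henstock_Kurzweil_Integration.integral_combine int) auto
      then show "\<bar>w (\<gamma> c) - w (\<gamma> a)\<bar> \<le> integral {a..c} (\<lambda>r. ?h r + \<epsilon>)" using * ac by linarith
    qed
  next
    fix x assume x: "s \<le> x" "x \<le> t"
    then have xl: "x \<in> {0..l}" using st by auto
    have e2: "\<epsilon> / 2 > 0" using \<open>\<epsilon> > 0\<close> by simp
    obtain d1 where d1: "d1 > 0" "\<And>r. r \<in> {0..l} \<Longrightarrow> dist r x < d1 \<Longrightarrow> dist (?h r) (?h x) < \<epsilon> / 2"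
      using hc xl e2 unfolding continuous_on_iff by metis
    obtain d2 where d2: "d2 > 0" "\<And>y. norm (y - \<gamma> x) < d2 \<Longrightarrow>
        norm (w y - w (\<gamma> x) - w' (\<gamma> x) (y - \<gamma> x)) \<le> \<epsilon> / 2 * norm (y - \<gamma> x)"
      using w'[OF \<gamma>(3)[OF xl]] e2 unfolding has_derivative_at_alt by metis
    have est: "\<bar>w (\<gamma> r) - w (\<gamma> x)\<bar> \<le> (?h x + \<epsilon> / 2) * \<bar>r - x\<bar>" if r: "r \<in> {0..l}" "\<bar>r - x\<bar> < d2" for r
    proof -
      have lip: "norm (\<gamma> r - \<gamma> x) \<le> \<bar>r - x\<bar>"
        using Gamma_rect_Lipschitz[OF c, of r x] Gamma_rect_Lipschitz[OF c, of x r] r xl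
        by (cases "r \<le> x") (auto simp: dist_norm norm_minus_commute)
      have "\<bar>w (\<gamma> r) - w (\<gamma> x)\<bar> \<le> \<bar>w' (\<gamma> x) (\<gamma> r - \<gamma> x)\<bar> + \<epsilon> / 2 * norm (\<gamma> r - \<gamma> x)"
      proof -
        have "\<bar>w (\<gamma> r) - w (\<gamma> x) - w' (\<gamma> x) (\<gamma> r - \<gamma> x)\<bar> \<le> \<epsilon> / 2 * norm (\<gamma> r - \<gamma> x)"
          using d2(2)[of "\<gamma> r"] lip r by (simp only: real_norm_def)
        then show ?thesis by linarith
      qed
      also have "\<dots> \<le> ?h x * norm (\<gamma> r - \<gamma> x) + \<epsilon> / 2 * norm (\<gamma> r - \<gamma> x)"
        using has_derivative_abs_le_gradient[OF w'[OF \<gamma>(3)[OF xl]]] by simp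
      also have "\<dots> = (?h x + \<epsilon> / 2) * norm (\<gamma> r - \<gamma> x)" by (simp add: distrib_right)
      also have "\<dots> \<le> (?h x + \<epsilon> / 2) * \<bar>r - x\<bar>" using lip e2 by (intro mult_left_mono) auto
      finally show ?thesis .
    qed
    have "\<bar>w (\<gamma> b) - w (\<gamma> a)\<bar> \<le> integral {a..b} (\<lambda>r. ?h r + \<epsilon>)"
      if ab: "a \<le> x \<and> x \<le> b \<and> b - a < min d1 d2" "0 \<le> a \<and> b \<le> l" for a b
    proof -
      have "\<bar>w (\<gamma> b) - w (\<gamma> a)\<bar> \<le> (?h x + \<epsilon> / 2) * \<bar>b - x\<bar> + (?h x + \<epsilon> / 2) * \<bar>a - x\<bar>"
        using est[of b] est[of a] ab by auto
      also have "\<dots> = (?h x + \<epsilon> / 2) * (\<bar>b - x\<bar> + \<bar>a - x\<bar>)" by (simp only: distrib_left)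
      also have "\<bar>b - x\<bar> + \<bar>a - x\<bar> = b - a" using ab by simp
      also have "(?h x + \<epsilon> / 2) * (b - a) = integral {a..b} (\<lambda>r. ?h x + \<epsilon> / 2)" using ab by simp
      also have "\<dots> \<le> integral {a..b} (\<lambda>r. ?h r + \<epsilon>)"
      proof (rule integral_le)
        fix r assume "r \<in> {a..b}"
        then have "dist (?h r) (?h x) < \<epsilon> / 2" using ab by (intro d1(2)) (auto simp: dist_real_def)
        then show "?h x + \<epsilon> / 2 \<le> ?h r + \<epsilon>" unfolding dist_real_def by linarith
      qed (use int ab in auto)
      finally show ?thesis .
    qed
    then show "\<exists>d>0. \<forall>a b. a \<le> x \<and> x \<le> b \<and> b - a < d \<longrightarrow> 0 \<le> a \<and> b \<le> l \<longrightarrow>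
        \<bar>w (\<gamma> b) - w (\<gamma> a)\<bar> \<le> integral {a..b} (\<lambda>r. ?h r + \<epsilon>)"
      using d1(1) d2(1) by (intro exI[of _ "min d1 d2"]) auto
  qed
  then show ?thesis using st by simp
qed

lemma C1_curve_estimate:
  fixes w :: "real ^ 'n \<Rightarrow> real"
  assumes w: "Ck_on 1 \<Omega> w" and c: "(l, \<gamma>) \<in> Gamma_rect \<Omega>" and st: "0 \<le> s" "s \<le> t" "t \<le> l"
  shows "ennreal \<bar>w (\<gamma> t) - w (\<gamma> s)\<bar> \<le> (\<integral>\<^sup>+r\<in>{s..t}. ennreal (norm (gradient w (\<gamma> r))) \<partial>lborel)"
proof -
  let ?h = "\<lambda>r. norm (gradient w (\<gamma> r))"
  note \<gamma> = Gamma_rectD[OF c]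
  have hc: "continuous_on {s..t} ?h"
    by (intro continuous_on_norm continuous_on_compose2[OF gradient_continuous[OF w] continuous_on_subset[OF \<gamma>(2)]])
       (use \<gamma>(3) st in auto)
  have "\<bar>w (\<gamma> t) - w (\<gamma> s)\<bar> \<le> integral {s..t} ?h"
  proof (rule field_le_epsilon)
    fix e :: real assume "e > 0"
    \<comment> \<open>The added 1 keeps the denominator positive when s = t.\<close>
    define \<epsilon> where "\<epsilon> = e / (t - s + 1)"
    have "\<epsilon> > 0" using \<open>e > 0\<close> st by (simp add: \<epsilon>_def)
    have "\<bar>w (\<gamma> t) - w (\<gamma> s)\<bar> \<le> integral {s..t} (\<lambda>r. ?h r + \<epsilon>)"
      by (rule C1_curve_estimate_real[OF w c \<open>\<epsilon> > 0\<close> st])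
    also have "\<dots> = integral {s..t} ?h + \<epsilon> * (t - s)"
      using st hc by (subst Henstock_Kurzweil_Integration.integral_add) (auto intro!: integrable_continuous_real simp: mult.commute)
    also have "\<epsilon> * (t - s) \<le> e" using \<open>e > 0\<close> st by (simp add: \<epsilon>_def field_simps)
    finally show "\<bar>w (\<gamma> t) - w (\<gamma> s)\<bar> \<le> integral {s..t} ?h + e" by simp
  qed
  also have si: "set_integrable lborel {s..t} ?h" by (rule borel_integrable_atLeastAtMost'[OF hc])
  then have "integral {s..t} ?h = (LBINT r:{s..t}. ?h r)" by (rule set_borel_integral_eq_integral(2)[symmetric])
  finally have "ennreal \<bar>w (\<gamma> t) - w (\<gamma> s)\<bar> \<le> ennreal (LBINT r:{s..t}. ?h r)" by (rule ennreal_leI)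
  also have "\<dots> = (\<integral>\<^sup>+r. ennreal (indicator {s..t} r *\<^sub>R ?h r) \<partial>lborel)"
    unfolding set_lebesgue_integral_def using si unfolding set_integrable_def
    by (intro nn_integral_eq_integral[symmetric]) auto
  also have "\<dots> = (\<integral>\<^sup>+r\<in>{s..t}. ennreal (?h r) \<partial>lborel)"
    by (intro nn_integral_cong) (auto simp: indicator_def)
  finally show ?thesis .
qed

lemma C1_diff:
  fixes u w :: "real ^ 'n \<Rightarrow> real"
  assumes u: "Ck_on 1 \<Omega> u" and w: "Ck_on 1 \<Omega> w"
  shows "Ck_on 1 \<Omega> (\<lambda>x. w x - u x)"
    and "x \<in> \<Omega> \<Longrightarrow> gradient (\<lambda>x. w x - u x) x = gradient w x - gradient u x"
proof -
  have "Ck_on 1 \<Omega> (\<lambda>x. w x + (- 1) * u x)" by (intro Ck_on_add Ck_on_mult Ck_on_const u w)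
  then show "Ck_on 1 \<Omega> (\<lambda>x. w x - u x)" by simp
  show "gradient (\<lambda>x. w x - u x) x = gradient w x - gradient u x" if x: "x \<in> \<Omega>"
  proof (rule vec_eq_iff[THEN iffD2], rule allI)
    fix k
    have "((\<lambda>s. w (x + s *\<^sub>R axis k 1) - u (x + s *\<^sub>R axis k 1)) has_real_derivative
        partial_deriv k w x - partial_deriv k u x) (at 0)"
      by (intro DERIV_diff C1_partial(1)[OF u x] C1_partial(1)[OF w x])
    then show "gradient (\<lambda>x. w x - u x) x $ k = (gradient w x - gradient u x) $ k"
      by (simp add: gradient_def partial_deriv_def DERIV_imp_deriv)
  qed
qed

section \<open>Fuglede's argument for a sequence with summable gradient jumps\<close>

definition grad_jump :: "(nat \<Rightarrow> real ^ 'n \<Rightarrow> real) \<Rightarrow> nat \<Rightarrow> real ^ 'n \<Rightarrow> real" where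
  "grad_jump w j x = norm (gradient (w (Suc j)) x - gradient (w j) x)"

definition grad_majorant :: "(nat \<Rightarrow> real ^ 'n \<Rightarrow> real) \<Rightarrow> real ^ 'n \<Rightarrow> ennreal" where
  "grad_majorant w x = ennreal (norm (gradient (w 0) x)) + (\<Sum>j. ennreal (grad_jump w j x))"

text \<open>A curve lying entirely in the set where the sequence diverges has infinite integral, although the
  infinite values are taken on a null set only.\<close>

definition exceptional_weight :: "(nat \<Rightarrow> real ^ 'n \<Rightarrow> real) \<Rightarrow> real ^ 'n \<Rightarrow> ennreal" where
  "exceptional_weight w x = grad_majorant w x + (if Cauchy (\<lambda>j. w j x) then 0 else \<infinity>)"

text \<open>Unspecified where the sequence diverges; curves of finite exceptional integral turn out
  to avoid such points.\<close>

definition pointwise_lim :: "(nat \<Rightarrow> real ^ 'n \<Rightarrow> real) \<Rightarrow> real ^ 'n \<Rightarrow> real" where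
  "pointwise_lim w x = lim (\<lambda>j. w j x)"

text \<open>Telescoping: the gradient of \<open>w j\<close> differs from that of \<open>w 0\<close>
  by at most the sum of the first j jumps.\<close>

lemma grad_le_majorant: "ennreal (norm (gradient (w j) x)) \<le> grad_majorant w x"
proof -
  have "norm (gradient (w j) x) \<le> norm (gradient (w 0) x) + (\<Sum>i<j. grad_jump w i x)"
  proof (induction j)
    case (Suc j)
    have "norm (gradient (w (Suc j)) x) \<le> norm (gradient (w j) x) + grad_jump w j x"
      unfolding grad_jump_def by (metis add.commute norm_triangle_sub)
    then show ?case using Suc by simp
  qed simp
  then have "ennreal (norm (gradient (w j) x)) \<le> ennreal (norm (gradient (w 0) x)) + ennreal (\<Sum>i<j. grad_jump w i x)"
    by (subst ennreal_plus[symmetric]) (auto intro!: ennreal_leI sum_nonneg simp: grad_jump_def)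
  also have "ennreal (\<Sum>i<j. grad_jump w i x) = (\<Sum>i<j. ennreal (grad_jump w i x))"
    by (rule sum_ennreal[symmetric]) (simp add: grad_jump_def)
  also have "\<dots> \<le> (\<Sum>j. ennreal (grad_jump w j x))" by (rule sum_le_suminf) auto
  finally show ?thesis by (simp add: grad_majorant_def add_left_mono)
qed

lemma continuous_borel_restrict:
  assumes "continuous_on \<Omega> (f :: real ^ 'n \<Rightarrow> real)"
  shows "f \<in> borel_measurable (restrict_space borel \<Omega>)"
  by (rule borel_measurable_continuous_on_restrict[OF assms])

lemma grad_majorant_measurable:
  assumes w: "\<And>j. Ck_on 1 \<Omega> (w j)"
  shows "(\<lambda>x. ennreal (grad_jump w j x)) \<in> borel_measurable (restrict_space borel \<Omega>)"
    "grad_majorant w \<in> borel_measurable (restrict_space borel \<Omega>)"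
    "exceptional_weight w \<in> borel_measurable (restrict_space borel \<Omega>)"
proof -
  have [measurable]: "grad_jump w j \<in> borel_measurable (restrict_space borel \<Omega>)" for j
    unfolding grad_jump_def[abs_def] by (intro continuous_borel_restrict continuous_intros gradient_continuous[OF w])
  show "(\<lambda>x. ennreal (grad_jump w j x)) \<in> borel_measurable (restrict_space borel \<Omega>)" by measurable
  have [measurable]: "(\<lambda>x. norm (gradient (w 0) x)) \<in> borel_measurable (restrict_space borel \<Omega>)"
    by (intro continuous_borel_restrict continuous_intros gradient_continuous[OF w])
  show m[measurable]: "grad_majorant w \<in> borel_measurable (restrict_space borel \<Omega>)"
    unfolding grad_majorant_def[abs_def] by measurable
  have wm: "w j \<in> borel_measurable (restrict_space borel \<Omega>)" for j
    by (intro continuous_borel_restrict C1_imp_continuous[OF w])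
  have "{x \<in> space (restrict_space borel \<Omega>). Cauchy (\<lambda>j. w j x)} \<in> sets (restrict_space borel \<Omega>)"
    by (rule sets_Collect_Cauchy[OF wm])
  then show "exceptional_weight w \<in> borel_measurable (restrict_space borel \<Omega>)"
    unfolding exceptional_weight_def[abs_def] by (intro borel_measurable_add m measurable_If) auto
qed

lemma curve_measurable:
  fixes v :: "real ^ 'n \<Rightarrow> ennreal"
  assumes v: "v \<in> borel_measurable (restrict_space borel \<Omega>)" and c: "(l, \<gamma>) \<in> Gamma_rect \<Omega>"
  shows "(\<lambda>t. v (\<gamma> t) * indicator {0..l} t) \<in> borel_measurable lborel"
proof -
  have "\<gamma> \<in> borel_measurable (restrict_space borel {0..l})"
    by (rule borel_measurable_continuous_on_restrict[OF Gamma_rectD(2)[OF c]])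
  then have "\<gamma> \<in> restrict_space borel {0..l} \<rightarrow>\<^sub>M restrict_space borel \<Omega>"
    by (rule measurable_restrict_space2[rotated]) (use Gamma_rectD(3)[OF c] in \<open>auto simp: space_restrict_space\<close>)
  from measurable_compose[OF this v] show ?thesis
    by (simp add: borel_measurable_restrict_space_iff_ennreal)
qed

lemma summable_diff_imp_convergent:
  fixes d :: "nat \<Rightarrow> real"
  assumes "(\<Sum>j. ennreal \<bar>d (Suc j) - d j\<bar>) < \<infinity>"
  shows "convergent d"
proof -
  have "summable (\<lambda>j. \<bar>d (Suc j) - d j\<bar>)"
    by (rule summable_suminf_not_top) (use assms in auto)
  then have "summable (\<lambda>j. d (Suc j) - d j)" by (rule summable_rabs_cancel)
  then have "convergent (\<lambda>n. \<Sum>j<n. d (Suc j) - d j)" by (simp add: summable_iff_convergent)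
  then have "convergent (\<lambda>n. (d n - d 0) + d 0)"
    by (intro convergent_add convergent_const) (simp add: sum_lessThan_telescope)
  then show ?thesis by simp
qed

text \<open>A finite integral excludes that the whole curve lies in the divergence set, so there is
  one point of convergence \<open>t0\<close>. The increments of consecutive differences between
  \<open>t0\<close> and any other point are bounded by the integrals of the jumps, which are
  summable, so convergence spreads along the curve. The estimate then follows by passing to the
  limit.\<close>

lemma pointwise_lim_curve_estimate:
  fixes w :: "nat \<Rightarrow> real ^ 'n \<Rightarrow> real"
  assumes w: "\<And>j. Ck_on 1 \<Omega> (w j)" and c: "(l, \<gamma>) \<in> Gamma_rect \<Omega>"
    and fin: "curve_integral (l, \<gamma>) (exceptional_weight w) < \<infinity>" and st: "0 \<le> s" "s \<le> t" "t \<le> l"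
  shows "ennreal \<bar>pointwise_lim w (\<gamma> t) - pointwise_lim w (\<gamma> s)\<bar> \<le> (\<integral>\<^sup>+r\<in>{s..t}. grad_majorant w (\<gamma> r) \<partial>lborel)"
proof -
  note \<gamma> = Gamma_rectD[OF c]
  have fin': "(\<integral>\<^sup>+r\<in>{0..l}. exceptional_weight w (\<gamma> r) \<partial>lborel) < \<infinity>" using fin by (simp add: curve_integral_def)
  have "\<exists>t0\<in>{0..l}. Cauchy (\<lambda>j. w j (\<gamma> t0))"
  proof (rule ccontr)
    assume "\<not> ?thesis"
    then have "\<infinity> * indicator {0..l} r \<le> exceptional_weight w (\<gamma> r) * indicator {0..l} r" for r
      by (auto simp: exceptional_weight_def indicator_def)
    then have "(\<integral>\<^sup>+r. \<infinity> * indicator {0..l} r \<partial>lborel) \<le> (\<integral>\<^sup>+r\<in>{0..l}. exceptional_weight w (\<gamma> r) \<partial>lborel)"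
      by (intro nn_integral_mono)
    moreover have "(\<integral>\<^sup>+r. \<infinity> * indicator {0..l} r \<partial>lborel) = \<infinity> * emeasure lborel {0..l}"
      by (rule nn_integral_cmult_indicator) simp
    ultimately show False using fin' \<gamma>(1) by (simp add: ennreal_top_mult top_unique)
  qed
  then obtain t0 where t0: "t0 \<in> {0..l}" "Cauchy (\<lambda>j. w j (\<gamma> t0))" by blast
  have jump_fin: "(\<Sum>j. \<integral>\<^sup>+r\<in>{0..l}. ennreal (grad_jump w j (\<gamma> r)) \<partial>lborel) < \<infinity>"
  proof -
    have "(\<Sum>j. \<integral>\<^sup>+r\<in>{0..l}. ennreal (grad_jump w j (\<gamma> r)) \<partial>lborel) =
        (\<integral>\<^sup>+r. (\<Sum>j. ennreal (grad_jump w j (\<gamma> r)) * indicator {0..l} r) \<partial>lborel)"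
      by (rule nn_integral_suminf[symmetric]) (rule curve_measurable[OF grad_majorant_measurable(1)[OF w] c])
    also have "\<dots> \<le> (\<integral>\<^sup>+r\<in>{0..l}. exceptional_weight w (\<gamma> r) \<partial>lborel)"
      by (intro nn_integral_mono) (auto simp: exceptional_weight_def grad_majorant_def indicator_def)
    also note fin'
    finally show ?thesis .
  qed
  have conv: "convergent (\<lambda>j. w j (\<gamma> t))" if t: "t \<in> {0..l}" for t
  proof -
    have est: "ennreal \<bar>(w (Suc j) (\<gamma> t) - w (Suc j) (\<gamma> t0)) - (w j (\<gamma> t) - w j (\<gamma> t0))\<bar> \<le>
        (\<integral>\<^sup>+r\<in>{0..l}. ennreal (grad_jump w j (\<gamma> r)) \<partial>lborel)" for j
    proof -
      let ?D = "\<lambda>x. w (Suc j) x - w j x"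
      define a b where "a = min t t0" and "b = max t t0"
      have ab: "0 \<le> a" "a \<le> b" "b \<le> l" using t t0 by (auto simp: a_def b_def)
      have "ennreal \<bar>?D (\<gamma> b) - ?D (\<gamma> a)\<bar> \<le> (\<integral>\<^sup>+r\<in>{a..b}. ennreal (norm (gradient ?D (\<gamma> r))) \<partial>lborel)"
        by (rule C1_curve_estimate[OF C1_diff(1)[OF w w] c ab])
      also have "\<dots> \<le> (\<integral>\<^sup>+r\<in>{0..l}. ennreal (grad_jump w j (\<gamma> r)) \<partial>lborel)"
        using ab \<gamma>(3) by (intro nn_integral_mono) (auto simp: indicator_def grad_jump_def C1_diff(2)[OF w w])
      also have "\<bar>?D (\<gamma> b) - ?D (\<gamma> a)\<bar> = \<bar>(w (Suc j) (\<gamma> t) - w (Suc j) (\<gamma> t0)) - (w j (\<gamma> t) - w j (\<gamma> t0))\<bar>"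
        unfolding a_def b_def by (cases "t \<le> t0") (simp add: min_def max_def, linarith)+
      finally show ?thesis .
    qed
    have "(\<Sum>j. ennreal \<bar>(w (Suc j) (\<gamma> t) - w (Suc j) (\<gamma> t0)) - (w j (\<gamma> t) - w j (\<gamma> t0))\<bar>) < \<infinity>"
      by (rule order.strict_trans1[OF suminf_le jump_fin]) (auto intro: est)
    then have "convergent (\<lambda>j. w j (\<gamma> t) - w j (\<gamma> t0))" by (rule summable_diff_imp_convergent)
    moreover have "convergent (\<lambda>j. w j (\<gamma> t0))" using t0(2) by (simp add: Cauchy_convergent_iff)
    ultimately have "convergent (\<lambda>j. (w j (\<gamma> t) - w j (\<gamma> t0)) + w j (\<gamma> t0))" by (rule convergent_add)
    then show ?thesis by simp
  qed
  have lim: "(\<lambda>j. w j (\<gamma> t)) \<longlonglongrightarrow> pointwise_lim w (\<gamma> t)" if "t \<in> {0..l}" for t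
    using conv[OF that] by (simp add: pointwise_lim_def convergent_LIMSEQ_iff)
  have L: "(\<lambda>j. ennreal \<bar>w j (\<gamma> t) - w j (\<gamma> s)\<bar>) \<longlonglongrightarrow> ennreal \<bar>pointwise_lim w (\<gamma> t) - pointwise_lim w (\<gamma> s)\<bar>"
    by (intro tendsto_intros lim) (use st in auto)
  have E: "ennreal \<bar>w j (\<gamma> t) - w j (\<gamma> s)\<bar> \<le> (\<integral>\<^sup>+r\<in>{s..t}. grad_majorant w (\<gamma> r) \<partial>lborel)" for j
    by (rule order_trans[OF C1_curve_estimate[OF w c st]])
       (intro nn_integral_mono mult_right_mono grad_le_majorant, simp)
  show ?thesis by (rule LIMSEQ_le_const2[OF L]) (use E in blast)
qed

lemma pointwise_lim_NAC_curve:
  fixes w :: "nat \<Rightarrow> real ^ 'n \<Rightarrow> real"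
  assumes w: "\<And>j. Ck_on 1 \<Omega> (w j)" and c: "(l, \<gamma>) \<in> Gamma_NAC \<Omega> (pointwise_lim w)"
  shows "curve_integral (l, \<gamma>) (exceptional_weight w) = \<infinity>"
proof (rule ccontr)
  assume "\<not> ?thesis"
  then have fin: "curve_integral (l, \<gamma>) (exceptional_weight w) < \<infinity>" by (simp add: less_top)
  have c': "(l, \<gamma>) \<in> Gamma_rect \<Omega>" "\<not> abs_cont_on 0 l (pointwise_lim w \<circ> \<gamma>)" using c by (auto simp: Gamma_NAC_def)
  have "abs_cont_on 0 l (pointwise_lim w \<circ> \<gamma>)"
  proof (rule abs_cont_on_dominated)
    show "(\<lambda>t. grad_majorant w (\<gamma> t) * indicator {0..l} t) \<in> borel_measurable lborel"
      by (rule curve_measurable[OF grad_majorant_measurable(2)[OF w] c'(1)])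
    have "(\<integral>\<^sup>+t. grad_majorant w (\<gamma> t) * indicator {0..l} t \<partial>lborel) \<le> curve_integral (l, \<gamma>) (exceptional_weight w)"
      unfolding curve_integral_def by (intro nn_integral_mono) (auto simp: exceptional_weight_def indicator_def)
    then show "(\<integral>\<^sup>+t. grad_majorant w (\<gamma> t) * indicator {0..l} t \<partial>lborel) < \<infinity>" using fin by (rule order.strict_trans1)
    fix s t :: real assume st: "0 \<le> s" "s \<le> t" "t \<le> l"
    have "ennreal \<bar>(pointwise_lim w \<circ> \<gamma>) t - (pointwise_lim w \<circ> \<gamma>) s\<bar> \<le> (\<integral>\<^sup>+r\<in>{s..t}. grad_majorant w (\<gamma> r) \<partial>lborel)"
      unfolding comp_def by (rule pointwise_lim_curve_estimate[OF w c'(1) fin st])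
    also have "\<dots> = (\<integral>\<^sup>+r\<in>{s..t}. grad_majorant w (\<gamma> r) * indicator {0..l} r \<partial>lborel)"
      using st by (intro nn_integral_cong) (auto simp: indicator_def)
    finally show "ennreal \<bar>(pointwise_lim w \<circ> \<gamma>) t - (pointwise_lim w \<circ> \<gamma>) s\<bar> \<le>
        (\<integral>\<^sup>+r\<in>{s..t}. grad_majorant w (\<gamma> r) * indicator {0..l} r \<partial>lborel)" .
  qed
  then show False using c'(2) by simp
qed

section \<open>Representatives of Sobolev functions\<close>

context weak_Phi_space
begin

lemma Lphi_norm_vec:
  fixes f :: "real ^ 'n \<Rightarrow> real ^ 'n"
  assumes f: "\<And>k. (\<lambda>x. f x $ k) \<in> Lphi \<Omega> \<phi>"
  shows "(\<lambda>x. norm (f x)) \<in> Lphi \<Omega> \<phi>"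
proof (rule Lphi_dominated)
  show "(\<lambda>x. \<Sum>k\<in>UNIV. \<bar>f x $ k\<bar>) \<in> Lphi \<Omega> \<phi>" by (rule Lphi_sum_abs) (simp_all add: f)
  note [measurable] = Lphi_measurable[OF f]
  show "(\<lambda>x. norm (f x)) \<in> borel_measurable (lebesgue_on \<Omega>)"
    unfolding norm_vec_def L2_set_def by measurable
  show "AE x in lebesgue_on \<Omega>. \<bar>norm (f x)\<bar> \<le> \<bar>\<Sum>k\<in>UNIV. \<bar>f x $ k\<bar>\<bar>"
    using norm_le_l1_cart by (auto simp: sum_nonneg)
qed

lemma Lphi_modular_le_1:
  assumes "f \<in> Lphi \<Omega> \<phi>"
  obtains c where "c > 0" "modular \<Omega> \<phi> (\<lambda>x. ennreal \<bar>f x\<bar> / ennreal c) \<le> 1"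
proof -
  have "((\<lambda>l. modular \<Omega> \<phi> (\<lambda>x. ennreal \<bar>l * f x\<bar>)) \<longlongrightarrow> 0) (at_right 0)" using assms by (simp add: Lphi_def)
  then have "eventually (\<lambda>l. modular \<Omega> \<phi> (\<lambda>x. ennreal \<bar>l * f x\<bar>) < 1) (at_right 0)"
    by (rule order_tendstoD) simp
  then have "eventually (\<lambda>l. modular \<Omega> \<phi> (\<lambda>x. ennreal \<bar>l * f x\<bar>) < 1 \<and> 0 < l) (at_right 0)"
    by (intro eventually_conj eventually_at_right_less)
  then obtain l where l: "0 < l" "modular \<Omega> \<phi> (\<lambda>x. ennreal \<bar>l * f x\<bar>) < 1"
    using eventually_happens[of _ "at_right (0::real)"] by (auto simp: trivial_limit_at_right_real)
  have "ennreal \<bar>f x\<bar> / ennreal (1 / l) = ennreal \<bar>l * f x\<bar>" for x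
    using l(1) by (subst divide_ennreal) (auto simp: abs_mult mult.commute)
  then show thesis using l by (intro that[of "1 / l"]) auto
qed

text \<open>The extended-valued \<open>v\<close> may be infinite on a null set, hence the real
  function \<open>H\<close> representing it almost everywhere. One constant \<open>c\<close> serves
  all scales, as dividing by \<open>\<epsilon> * c\<close> cancels
  \<open>\<epsilon>\<close>.\<close>

lemma lux_norm_scaled_le:
  assumes H: "H \<in> Lphi \<Omega> \<phi>" and ae: "AE x in lebesgue_on \<Omega>. v x = ennreal \<bar>H x\<bar>"
  obtains c where "c > 0" "\<And>\<epsilon>. \<epsilon> > 0 \<Longrightarrow> lux_norm \<Omega> \<phi> (\<lambda>x. ennreal \<epsilon> * v x) \<le> ennreal (\<epsilon> * c)"
proof -
  obtain c where c: "c > 0" "modular \<Omega> \<phi> (\<lambda>x. ennreal \<bar>H x\<bar> / ennreal c) \<le> 1"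
    by (rule Lphi_modular_le_1[OF H])
  have "lux_norm \<Omega> \<phi> (\<lambda>x. ennreal \<epsilon> * v x) \<le> ennreal (\<epsilon> * c)" if "\<epsilon> > 0" for \<epsilon>
  proof (rule lux_norm_le)
    show "0 < \<epsilon> * c" using that c by simp
    have "modular \<Omega> \<phi> (\<lambda>x. ennreal \<epsilon> * v x / ennreal (\<epsilon> * c)) \<le> modular \<Omega> \<phi> (\<lambda>x. ennreal \<bar>H x\<bar> / ennreal c)"
    proof (rule modular_mono, rule eventually_mono[OF ae])
      fix x assume "v x = ennreal \<bar>H x\<bar>"
      then have "ennreal \<epsilon> * v x / ennreal (\<epsilon> * c) = ennreal (\<epsilon> * \<bar>H x\<bar> / (\<epsilon> * c))"
        using that c by (simp add: ennreal_mult[symmetric] divide_ennreal)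
      also have "\<dots> = ennreal \<bar>H x\<bar> / ennreal c" using that c by (simp add: divide_ennreal)
      finally show "ennreal \<epsilon> * v x / ennreal (\<epsilon> * c) \<le> ennreal \<bar>H x\<bar> / ennreal c" by simp
    qed
    then show "modular \<Omega> \<phi> (\<lambda>x. ennreal \<epsilon> * v x / ennreal (\<epsilon> * c)) \<le> 1" using c(2) by (rule order_trans)
  qed
  then show thesis using c(1) that by blast
qed

text \<open>The weight has integral \<infinity> along every curve of the family, so all its positive
  multiples are admissible, and their norms tend to 0.\<close>

lemma pointwise_lim_ACC:
  assumes w: "\<And>j. Ck_on 1 \<Omega> (w j)" and H: "H \<in> Lphi \<Omega> \<phi>"
    and ae: "AE x in lebesgue_on \<Omega>. exceptional_weight w x = ennreal \<bar>H x\<bar>"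
  shows "pointwise_lim w \<in> ACC \<Omega> \<phi>"
proof -
  let ?v = "exceptional_weight w"
  obtain c where c: "c > 0" "\<And>\<epsilon>. \<epsilon> > 0 \<Longrightarrow> lux_norm \<Omega> \<phi> (\<lambda>x. ennreal \<epsilon> * ?v x) \<le> ennreal (\<epsilon> * c)"
    by (rule lux_norm_scaled_le[OF H ae]) (rule that)
  have vm: "?v \<in> borel_measurable (restrict_space borel \<Omega>)" by (rule grad_majorant_measurable(3)[OF w])
  have "phi_modulus \<Omega> \<phi> (Gamma_NAC \<Omega> (pointwise_lim w)) \<le> 0 + ennreal e" if "e > 0" for e
  proof -
    define \<epsilon> where "\<epsilon> = e / c"
    have \<epsilon>: "\<epsilon> > 0" using that c by (simp add: \<epsilon>_def)
    have "(\<lambda>x. ennreal \<epsilon> * ?v x) \<in> F_adm \<Omega> (Gamma_NAC \<Omega> (pointwise_lim w))"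
      unfolding F_adm_def
    proof (intro CollectI conjI ballI)
      show "(\<lambda>x. ennreal \<epsilon> * ?v x) \<in> borel_measurable (restrict_space borel \<Omega>)" using vm by measurable
      fix cv assume cv: "cv \<in> Gamma_NAC \<Omega> (pointwise_lim w)"
      obtain l \<gamma> where l\<gamma>: "cv = (l, \<gamma>)" by fastforce
      have rect: "(l, \<gamma>) \<in> Gamma_rect \<Omega>" using cv l\<gamma> by (auto simp: Gamma_NAC_def)
      have "curve_integral cv (\<lambda>x. ennreal \<epsilon> * ?v x) = (\<integral>\<^sup>+t. ennreal \<epsilon> * (?v (\<gamma> t) * indicator {0..l} t) \<partial>lborel)"
        by (simp add: curve_integral_def l\<gamma> mult.assoc)
      also have "\<dots> = ennreal \<epsilon> * curve_integral (l, \<gamma>) ?v"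
        unfolding curve_integral_def fst_conv snd_conv by (rule nn_integral_cmult[OF curve_measurable[OF vm rect]])
      also have "curve_integral (l, \<gamma>) ?v = \<infinity>"
        by (rule pointwise_lim_NAC_curve[where w = w, OF w]) (use cv l\<gamma> in simp)
      finally show "1 \<le> curve_integral cv (\<lambda>x. ennreal \<epsilon> * ?v x)"
        using \<epsilon> by (simp add: ennreal_mult_top)
    qed
    then have "phi_modulus \<Omega> \<phi> (Gamma_NAC \<Omega> (pointwise_lim w)) \<le> lux_norm \<Omega> \<phi> (\<lambda>x. ennreal \<epsilon> * ?v x)"
      unfolding phi_modulus_def by (rule INF_lower)
    also have "\<dots> \<le> ennreal (\<epsilon> * c)" by (rule c(2)[OF \<epsilon>])
    finally show ?thesis using c by (simp add: \<epsilon>_def)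
  qed
  then have "phi_modulus \<Omega> \<phi> (Gamma_NAC \<Omega> (pointwise_lim w)) \<le> 0" 
    by (rule ennreal_le_epsilon)
  then show ?thesis by (simp add: ACC_def)
qed

text \<open>A finite norm gives finite integrals over bounded sets, so by Fubini's theorem almost
  every line has a finite integral; integer radii need only countably many null sets.\<close>

lemma AE_lines_locally_finite:
  assumes vm: "v \<in> borel_measurable (restrict_space borel \<Omega>)" and fin: "lux_norm \<Omega> \<phi> v < ennreal c"
  shows "AE y in lines_measure k. \<forall>R::nat.
    (\<integral>\<^sup>+z. v (insert_coord k y z) * indicator (\<Omega> \<inter> ball 0 (real R)) (insert_coord k y z) \<partial>lborel) < \<infinity>"
  unfolding AE_all_countable
proof
  fix R :: nat
  let ?w = "\<lambda>x. v x * indicator (\<Omega> \<inter> ball 0 (real R)) x"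
  have w[measurable]: "?w \<in> borel_measurable borel"
    by (rule borel_restrict_times_indicator[OF vm]) (use open_\<Omega> in auto)
  have "(\<integral>\<^sup>+y. \<integral>\<^sup>+z. ?w (insert_coord k y z) \<partial>lborel \<partial>lines_measure k) = (\<integral>\<^sup>+x. ?w x \<partial>lborel)"
    by (rule nn_integral_lines[symmetric, OF w])
  then have "(\<integral>\<^sup>+y. \<integral>\<^sup>+z. ?w (insert_coord k y z) \<partial>lborel \<partial>lines_measure k) \<noteq> \<infinity>"
    using ball_nn_integral_finite[OF vm fin, of "real R"] by (auto simp: top_unique)
  then have "AE y in lines_measure k. (\<integral>\<^sup>+z. ?w (insert_coord k y z) \<partial>lborel) \<noteq> \<infinity>"
    by (intro nn_integral_PInf_AE measurable_nn_integral_lines[OF w])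
  then show "AE y in lines_measure k. (\<integral>\<^sup>+z. ?w (insert_coord k y z) \<partial>lborel) < \<infinity>"
    by eventually_elim (simp add: less_top)
qed

text \<open>Along almost every line the increments of the limit are bounded by integrals of the
  majorant, hence so is the derivative by its values. This puts the classical gradient of the limit
  into \<open>Lphi\<close> by domination, without comparing it with the weak gradient.\<close>

lemma partial_pointwise_lim_le:
  assumes w: "\<And>j. Ck_on 1 \<Omega> (w j)" and H: "H \<in> Lphi \<Omega> \<phi>"
    and ae: "AE x in lebesgue_on \<Omega>. exceptional_weight w x = ennreal \<bar>H x\<bar>"
    and f: "pointwise_lim w \<in> ACL \<Omega>" "pointwise_lim w \<in> borel_measurable (lebesgue_on \<Omega>)"
  shows "AE x in lebesgue_on \<Omega>. ennreal \<bar>partial_deriv k (pointwise_lim w) x\<bar> \<le> grad_majorant w x"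
proof -
  let ?f = "pointwise_lim w" and ?v = "exceptional_weight w" and ?G = "grad_majorant w"
  have vm: "?v \<in> borel_measurable (restrict_space borel \<Omega>)" and Gm: "?G \<in> borel_measurable (restrict_space borel \<Omega>)"
    using grad_majorant_measurable[OF w] by auto
  obtain c where c: "c > 0" "\<And>\<epsilon>. \<epsilon> > 0 \<Longrightarrow> lux_norm \<Omega> \<phi> (\<lambda>x. ennreal \<epsilon> * ?v x) \<le> ennreal (\<epsilon> * c)"
    by (rule lux_norm_scaled_le[OF H ae]) (rule that)
  have "lux_norm \<Omega> \<phi> ?v \<le> ennreal c" using c(2)[of 1] by simp
  also have "\<dots> < ennreal (c + 1)" using c(1) by (simp add: ennreal_less_iff)
  finally have lux: "lux_norm \<Omega> \<phi> ?v < ennreal (c + 1)" .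
  \<comment> \<open>Extension of the majorant by zero, Borel on the whole space and hence along
    every line.\<close>
  define G0 where "G0 x = ?G x * indicator \<Omega> x" for x
  have G0[measurable]: "G0 \<in> borel_measurable borel"
    unfolding G0_def[abs_def] by (rule borel_restrict_times_indicator[OF Gm]) (use open_\<Omega> in auto)
  have [measurable]: "insert_coord k y \<in> borel_measurable borel" for y
    by (intro borel_measurable_continuous_onI continuous_insert_coord)
  note [measurable] = ACL_partial_deriv_measurable[OF open_\<Omega> f, of k] borel_restrict_imp_lebesgue_on[OF Gm]
  let ?B = "{x \<in> space (lebesgue_on \<Omega>). \<not> ennreal \<bar>partial_deriv k ?f x\<bar> \<le> ?G x}"
  have "?B \<in> sets (lebesgue_on \<Omega>)" by measurable
  then have B: "?B \<in> sets lebesgue" by (simp add: sets_restrict_space_iff)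
  have "?B \<in> null_sets lebesgue"
  proof (rule null_set_if_null_on_lines[OF B])
    show "AE y in lines_measure k. AE z in lborel. insert_coord k y z \<notin> ?B"
      using ACL_AE_lines[OF f(1), of k] AE_lines_locally_finite[OF vm lux, of k]
    proof eventually_elim
      case (elim y)
      let ?fy = "\<lambda>z. ?f (insert_coord k y z)" and ?Z = "line_section \<Omega> k y"
      have Z: "open ?Z" by (rule open_line_section[OF open_\<Omega>])
      have "AE z in lborel. z \<in> ?Z \<longrightarrow> (?fy has_real_derivative deriv ?fy z) (at z) \<longrightarrow> ennreal \<bar>deriv ?fy z\<bar> \<le> G0 (insert_coord k y z)"
      proof (rule AE_open_if_AE_intervals[OF Z])
        fix a b :: real assume ab: "a < b" "{a..b} \<subseteq> ?Z"
        let ?\<gamma> = "\<lambda>t. insert_coord k y (a + t)"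
        have rect: "(b - a, ?\<gamma>) \<in> Gamma_rect \<Omega>" by (rule coordinate_segment_Gamma_rect[OF ab])
        obtain R :: nat where R: "\<And>v. v \<in> borel_measurable (restrict_space borel \<Omega>) \<Longrightarrow>
            curve_integral (b - a, ?\<gamma>) v \<le> (\<integral>\<^sup>+z. v (insert_coord k y z) * indicator (\<Omega> \<inter> ball 0 (real R)) (insert_coord k y z) \<partial>lborel)"
          using segment_curve_integral_le[OF ab(2)] by blast
        have cfin: "curve_integral (b - a, ?\<gamma>) ?v < \<infinity>"
          by (rule order.strict_trans1[OF R[OF vm]]) (use elim(2) in blast)
        \<comment> \<open>Curves are parametrized from 0, lines by the coordinate itself; the
          substitution z = a + r translates between them.\<close>
        have shift: "(\<integral>\<^sup>+r\<in>{s - a..t - a}. ?G (?\<gamma> r) \<partial>lborel) = (\<integral>\<^sup>+z\<in>{s..t}. G0 (insert_coord k y z) \<partial>lborel)"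
          if "a \<le> s" "t \<le> b" for s t
        proof -
          have "(\<integral>\<^sup>+z\<in>{s..t}. G0 (insert_coord k y z) \<partial>lborel) =
              (\<integral>\<^sup>+r. G0 (insert_coord k y (a + 1 * r)) * indicator {s..t} (a + 1 * r) \<partial>lborel)"
            by (subst nn_integral_real_affine[where c = 1 and t = a]) auto
          also have "\<dots> = (\<integral>\<^sup>+r\<in>{s - a..t - a}. ?G (?\<gamma> r) \<partial>lborel)"
          proof (rule nn_integral_cong)
            fix r :: real
            show "G0 (insert_coord k y (a + 1 * r)) * indicator {s..t} (a + 1 * r) = ?G (?\<gamma> r) * indicator {s - a..t - a} r"
            proof (cases "r \<in> {s - a..t - a}")
              case True
              then have "a + r \<in> ?Z" using ab(2) that by (auto simp: subset_iff)
              then show ?thesis using True by (simp add: G0_def line_section_def)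
            next
              case False
              then show ?thesis by (auto simp: indicator_def)
            qed
          qed
          finally show ?thesis by simp
        qed
        have est: "ennreal \<bar>?fy t - ?fy s\<bar> \<le> (\<integral>\<^sup>+z\<in>{s..t}. G0 (insert_coord k y z) \<partial>lborel)"
          if st: "a \<le> s" "s \<le> t" "t \<le> b" for s t
          using pointwise_lim_curve_estimate[OF w rect cfin, of "s - a" "t - a"] st shift[of s t] by simp
        have "(\<integral>\<^sup>+z\<in>{a..b}. G0 (insert_coord k y z) \<partial>lborel) = (\<integral>\<^sup>+r\<in>{0..b - a}. ?G (?\<gamma> r) \<partial>lborel)"
          using shift[of a b] by simp
        also have "\<dots> \<le> curve_integral (b - a, ?\<gamma>) ?v"
          unfolding curve_integral_def by (intro nn_integral_mono) (auto simp: exceptional_weight_def indicator_def)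
        also note cfin
        finally have fin: "(\<integral>\<^sup>+z\<in>{a..b}. G0 (insert_coord k y z) \<partial>lborel) < \<infinity>" .
        have gm: "(\<lambda>z. G0 (insert_coord k y z)) \<in> borel_measurable lborel" by measurable
        from AE_derivative_le_dominated[OF gm fin est]
        show "AE z in lborel. z \<in> {a<..<b} \<longrightarrow> (?fy has_real_derivative deriv ?fy z) (at z) \<longrightarrow>
            ennreal \<bar>deriv ?fy z\<bar> \<le> G0 (insert_coord k y z)" .
      qed
      moreover have "AE z in lborel. z \<in> ?Z \<longrightarrow> (?fy has_real_derivative deriv ?fy z) (at z)"
        by (rule abs_cont_on_AE_differentiable[OF _ Z]) (use elim(1) in blast)
      ultimately show ?case
      proof eventually_elim
        case (elim z)
        then show ?case
          by (auto simp: G0_def line_section_def partial_deriv_insert_coord)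
      qed
    qed
  qed
  then have "AE x in lebesgue. x \<notin> ?B" by (rule AE_not_in)
  then have "AE x in lebesgue. x \<in> \<Omega> \<longrightarrow> ennreal \<bar>partial_deriv k ?f x\<bar> \<le> ?G x"
    by eventually_elim auto
  then show ?thesis by (simp add: AE_restrict_space_iff)
qed

text \<open>By uniqueness the classical partial derivative of a C1 function agrees almost everywhere
  with the weak one, which lies in \<open>Lphi\<close>.\<close>

lemma W1phi_partial_in_Lphi:
  assumes w: "Ck_on 1 \<Omega> w" "w \<in> W1phi \<Omega> \<phi>"
  shows "partial_deriv k w \<in> Lphi \<Omega> \<phi>"
proof -
  obtain h where h: "h \<in> Lphi \<Omega> \<phi>" "has_weak_partial \<Omega> k w h" using w(2) by (auto simp: W1phi_def)
  have ae: "AE x in lebesgue_on \<Omega>. h x = partial_deriv k w x"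
    by (rule weak_partial_unique[OF open_\<Omega> h(2) C1_has_weak_partial[OF open_\<Omega> w(1)]])
  have m: "partial_deriv k w \<in> borel_measurable (lebesgue_on \<Omega>)"
    using w by (intro ACL_partial_deriv_measurable open_\<Omega> C1_imp_ACL Lphi_measurable) (auto simp: W1phi_def)
  show ?thesis by (rule Lphi_dominated[OF h(1) m]) (use ae in \<open>auto elim: eventually_mono\<close>)
qed

text \<open>With errors chosen below \<open>small j\<close>, the series of function errors and that
  of gradient errors both have modular at most 1, so both are finite almost everywhere. The former
  gives convergence to \<open>u\<close> almost everywhere, the latter bounds the gradient
  jumps.\<close>

lemma W1phi_representative:
  assumes dense: "C1_dense_in_W1phi \<Omega> \<phi>" and u: "u \<in> W1phi \<Omega> \<phi>"
  obtains f where "f \<in> ACCphi \<Omega> \<phi>" "f \<in> Lphi \<Omega> \<phi>" "AE x in lebesgue_on \<Omega>. u x = f x"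
proof -
  have uL: "u \<in> Lphi \<Omega> \<phi>" using u by (simp add: W1phi_def)
  have "\<forall>k. \<exists>g. g \<in> Lphi \<Omega> \<phi> \<and> has_weak_partial \<Omega> k u g" using u by (auto simp: W1phi_def)
  then obtain g where g: "\<And>k. g k \<in> Lphi \<Omega> \<phi>" "\<And>k. has_weak_partial \<Omega> k u (g k)" by metis
  obtain w0 where w0: "\<And>j. Ck_on 1 \<Omega> (w0 j)" "\<And>j. w0 j \<in> W1phi \<Omega> \<phi>"
    "(\<lambda>j. W1phi_norm \<Omega> \<phi> (\<lambda>x. w0 j x - u x)) \<longlonglongrightarrow> 0"
    using dense u unfolding C1_dense_in_W1phi_def by blast
  have "\<exists>n. W1phi_norm \<Omega> \<phi> (\<lambda>x. w0 n x - u x) < ennreal (small j)" for j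
  proof -
    have "eventually (\<lambda>n. W1phi_norm \<Omega> \<phi> (\<lambda>x. w0 n x - u x) < ennreal (small j)) sequentially"
      by (rule order_tendstoD(2)[OF w0(3)]) (simp add: small_pos)
    then show ?thesis by (auto simp: eventually_sequentially)
  qed
  then obtain \<nu> where \<nu>: "\<And>j. W1phi_norm \<Omega> \<phi> (\<lambda>x. w0 (\<nu> j) x - u x) < ennreal (small j)" by metis
  define w where "w j = w0 (\<nu> j)" for j
  have w: "Ck_on 1 \<Omega> (w j)" "w j \<in> W1phi \<Omega> \<phi>" "w j \<in> Lphi \<Omega> \<phi>" for j
    using w0(1)[of "\<nu> j"] w0(2)[of "\<nu> j"] by (simp_all add: w_def W1phi_def)
  have norm_less: "W1phi_norm \<Omega> \<phi> (\<lambda>x. w j x - u x) < ennreal (small j)" for j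
    using \<nu> by (simp add: w_def)
  \<comment> \<open>The gradient error relative to one fixed choice \<open>g\<close> of weak
    derivatives of \<open>u\<close>. The norm makes its own choice for each difference, equal almost
    everywhere by uniqueness.\<close>
  define a where "a j x = norm (gradient (w j) x - (\<chi> k. g k x))" for j x
  note [measurable] = Lphi_measurable[OF uL] Lphi_measurable[OF w(3)] Lphi_measurable[OF g(1)]
    Lphi_measurable[OF W1phi_partial_in_Lphi[OF w(1,2)]]
  have am[measurable]: "a j \<in> borel_measurable (lebesgue_on \<Omega>)" for j
    unfolding a_def[abs_def] norm_vec_def L2_set_def by (simp add: gradient_def) measurable
  have ae_a: "AE x in lebesgue_on \<Omega>. norm (weak_gradient \<Omega> (\<lambda>x. w j x - u x) x) = a j x" for j
  proof -
    let ?d = "\<lambda>x. w j x - u x"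
    have "AE x in lebesgue_on \<Omega>. (SOME h. has_weak_partial \<Omega> k ?d h) x = partial_deriv k (w j) x - g k x" for k
    proof -
      have *: "has_weak_partial \<Omega> k ?d (\<lambda>x. partial_deriv k (w j) x - g k x)"
        by (rule has_weak_partial_diff[OF open_\<Omega> g(2) C1_has_weak_partial[OF open_\<Omega> w(1)]])
      then have "has_weak_partial \<Omega> k ?d (SOME h. has_weak_partial \<Omega> k ?d h)"
        by (rule someI[of "\<lambda>h. has_weak_partial \<Omega> k ?d h"])
      then show ?thesis by (rule weak_partial_unique[OF open_\<Omega> _ *])
    qed
    then have "AE x in lebesgue_on \<Omega>. \<forall>k\<in>UNIV. (SOME h. has_weak_partial \<Omega> k ?d h) x = partial_deriv k (w j) x - g k x"
      by (subst AE_finite_all) auto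
    then show ?thesis
    proof eventually_elim
      case (elim x)
      then have "weak_gradient \<Omega> ?d x = gradient (w j) x - (\<chi> k. g k x)"
        by (simp add: vec_eq_iff weak_gradient_def gradient_def)
      then show ?case by (simp add: a_def)
    qed
  qed
  have lux1: "lux_norm \<Omega> \<phi> (\<lambda>x. ennreal \<bar>w j x - u x\<bar>) < ennreal (small j)" for j
    by (rule order.strict_trans1[OF _ norm_less]) (simp add: W1phi_norm_def)
  have lux2: "lux_norm \<Omega> \<phi> (\<lambda>x. ennreal (a j x)) < ennreal (small j)" for j
  proof (rule order.strict_trans1[OF _ norm_less])
    have "lux_norm \<Omega> \<phi> (\<lambda>x. ennreal (a j x)) \<le> lux_norm \<Omega> \<phi> (\<lambda>x. ennreal (norm (weak_gradient \<Omega> (\<lambda>x. w j x - u x) x)))"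
      by (rule lux_norm_mono, rule eventually_mono[OF ae_a[of j]]) simp
    then show "lux_norm \<Omega> \<phi> (\<lambda>x. ennreal (a j x)) \<le> W1phi_norm \<Omega> \<phi> (\<lambda>x. w j x - u x)"
      unfolding W1phi_norm_def by (rule order_trans) simp
  qed
  have M1: "modular \<Omega> \<phi> (\<lambda>x. \<Sum>j. ennreal \<bar>w j x - u x\<bar>) \<le> 1" by (rule lux_norm_suminf_le_1[OF _ lux1]) measurable
  define T where "T x = (\<Sum>j. ennreal (a j x))" for x
  have M2: "modular \<Omega> \<phi> T \<le> 1" unfolding T_def[abs_def] by (rule lux_norm_suminf_le_1[OF _ lux2]) measurable
  have Tm[measurable]: "T \<in> borel_measurable (lebesgue_on \<Omega>)" unfolding T_def[abs_def] by measurable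
  have "AE x in lebesgue_on \<Omega>. (\<Sum>j. ennreal \<bar>w j x - u x\<bar>) < \<infinity>"
    by (rule modular_finite_imp_AE_finite) (measurable, rule order.strict_trans1[OF M1], simp)
  then have conv: "AE x in lebesgue_on \<Omega>. (\<lambda>j. w j x) \<longlonglongrightarrow> u x"
  proof eventually_elim
    case (elim x)
    have "summable (\<lambda>j. \<bar>w j x - u x\<bar>)" by (rule summable_suminf_not_top) (use elim in auto)
    then have "(\<lambda>j. \<bar>w j x - u x\<bar>) \<longlonglongrightarrow> 0" by (rule summable_LIMSEQ_zero)
    then have "(\<lambda>j. w j x - u x) \<longlonglongrightarrow> 0" by (rule tendsto_rabs_zero_cancel)
    then show ?case by (rule LIM_zero_cancel)
  qed
  have Tfin: "AE x in lebesgue_on \<Omega>. T x < \<infinity>"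
    by (rule modular_finite_imp_AE_finite[OF Tm]) (rule order.strict_trans1[OF M2], simp)
  \<comment> \<open>Each jump passes through the fixed weak gradient of \<open>u\<close>, which
    produces two error terms and hence two copies of \<open>T\<close>.\<close>
  have jump_le: "(\<Sum>j. ennreal (grad_jump w j x)) \<le> T x + T x" for x
  proof -
    have "ennreal (grad_jump w j x) \<le> ennreal (a (Suc j) x) + ennreal (a j x)" for j
    proof -
      have "grad_jump w j x = norm ((gradient (w (Suc j)) x - (\<chi> k. g k x)) - (gradient (w j) x - (\<chi> k. g k x)))"
        by (simp add: grad_jump_def)
      also have "\<dots> \<le> a (Suc j) x + a j x" unfolding a_def by (rule norm_triangle_ineq4)
      finally have "ennreal (grad_jump w j x) \<le> ennreal (a (Suc j) x + a j x)" by (rule ennreal_leI)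
      also have "\<dots> = ennreal (a (Suc j) x) + ennreal (a j x)" by (rule ennreal_plus) (auto simp: a_def)
      finally show ?thesis .
    qed
    then have "(\<Sum>j. ennreal (grad_jump w j x)) \<le> (\<Sum>j. ennreal (a (Suc j) x) + ennreal (a j x))"
      by (intro suminf_le) auto
    also have "\<dots> = (\<Sum>j. ennreal (a (Suc j) x)) + (\<Sum>j. ennreal (a j x))"
      by (rule suminf_add[symmetric]) auto
    also have "(\<Sum>j. ennreal (a (Suc j) x)) \<le> T x"
    proof -
      have "T x = (\<Sum>j. ennreal (a (j + 1) x)) + (\<Sum>j<1. ennreal (a j x))"
        unfolding T_def by (rule suminf_offset) simp
      then show ?thesis by simp
    qed
    finally show ?thesis by (simp add: T_def add_right_mono)
  qed
  \<comment> \<open>Real version of the jump sum, with value 0 on the null set where the sum is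
    infinite.\<close>
  define S where "S x = enn2real (\<Sum>j. ennreal (grad_jump w j x))" for x
  note [measurable] = borel_restrict_imp_lebesgue_on[OF grad_majorant_measurable(1)[OF w(1)]]
  have Sm: "S \<in> borel_measurable (lebesgue_on \<Omega>)" unfolding S_def[abs_def] by measurable
  have \<tau>: "(\<lambda>x. enn2real (T x)) \<in> Lphi \<Omega> \<phi>"
  proof (rule Lphi_if_modular_finite)
    have "modular \<Omega> \<phi> (\<lambda>x. ennreal \<bar>enn2real (T x)\<bar>) \<le> modular \<Omega> \<phi> T"
      by (rule modular_mono, rule eventually_mono[OF Tfin]) (simp add: less_top)
    then show "modular \<Omega> \<phi> (\<lambda>x. ennreal \<bar>enn2real (T x)\<bar>) < \<infinity>"
      by (rule order.strict_trans1[OF order_trans[OF _ M2]]) simp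
  qed measurable
  have SL: "S \<in> Lphi \<Omega> \<phi>"
  proof (rule Lphi_dominated[OF Lphi_add_abs[OF \<tau> \<tau>] Sm], rule eventually_mono[OF Tfin])
    fix x assume fin: "T x < \<infinity>"
    have "S x \<le> enn2real (T x + T x)"
      unfolding S_def using jump_le[of x] fin by (intro enn2real_mono) auto
    also have "\<dots> = enn2real (T x) + enn2real (T x)" using fin by (intro enn2real_plus) auto
    finally show "\<bar>S x\<bar> \<le> \<bar>\<bar>enn2real (T x)\<bar> + \<bar>enn2real (T x)\<bar>\<bar>" by (simp add: S_def)
  qed
  have G0L: "(\<lambda>x. norm (gradient (w 0) x)) \<in> Lphi \<Omega> \<phi>"
    by (rule Lphi_norm_vec) (simp add: gradient_def W1phi_partial_in_Lphi[OF w(1,2)])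
  define H where "H x = \<bar>norm (gradient (w 0) x)\<bar> + \<bar>S x\<bar>" for x
  have HL: "H \<in> Lphi \<Omega> \<phi>" unfolding H_def[abs_def] by (rule Lphi_add_abs[OF G0L SL])
  have ae_H: "AE x in lebesgue_on \<Omega>. exceptional_weight w x = ennreal \<bar>H x\<bar>"
    using conv Tfin
  proof eventually_elim
    case (elim x)
    have "Cauchy (\<lambda>j. w j x)" using elim(1) by (rule LIMSEQ_imp_Cauchy)
    moreover have "(\<Sum>j. ennreal (grad_jump w j x)) < \<infinity>"
      using jump_le[of x] elim(2) by (auto intro: order.strict_trans1)
    then have "(\<Sum>j. ennreal (grad_jump w j x)) = ennreal (S x)" by (simp add: S_def less_top)
    moreover have "S x \<ge> 0" by (simp add: S_def)
    ultimately show ?case by (simp add: exceptional_weight_def grad_majorant_def H_def)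
  qed
  let ?f = "pointwise_lim w"
  have uf: "AE x in lebesgue_on \<Omega>. u x = ?f x"
    using conv by eventually_elim (simp add: pointwise_lim_def limI)
  have fm: "?f \<in> borel_measurable (lebesgue_on \<Omega>)"
    unfolding pointwise_lim_def[abs_def] by (rule borel_measurable_lim_metric) measurable
  have fL: "?f \<in> Lphi \<Omega> \<phi>" by (rule Lphi_dominated[OF uL fm], rule eventually_mono[OF uf]) simp
  have fACC: "?f \<in> ACC \<Omega> \<phi>" by (rule pointwise_lim_ACC[OF w(1) HL ae_H])
  have fACL: "?f \<in> ACL \<Omega>" by (rule ACC_imp_ACL[OF fACC])
  have "partial_deriv k ?f \<in> Lphi \<Omega> \<phi>" for k
  proof (rule Lphi_dominated[OF HL ACL_partial_deriv_measurable[OF open_\<Omega> fACL fm]])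
    show "AE x in lebesgue_on \<Omega>. \<bar>partial_deriv k ?f x\<bar> \<le> \<bar>H x\<bar>"
      using partial_pointwise_lim_le[OF w(1) HL ae_H fACL fm, of k] ae_H
    proof eventually_elim
      case (elim x)
      have "ennreal \<bar>partial_deriv k ?f x\<bar> \<le> exceptional_weight w x"
        using elim(1) by (rule order_trans) (simp add: exceptional_weight_def)
      then show ?case using elim(2) by simp
    qed
  qed
  then have "(\<lambda>x. norm (gradient ?f x)) \<in> Lphi \<Omega> \<phi>"
    by (intro Lphi_norm_vec) (simp add: gradient_def)
  then show thesis using fACC fL uf by (intro that[of ?f]) (auto simp: ACCphi_def)
qed

end

text \<open>Classes are formed among all functions, so a class that meets both sets is literally the
  same element of both quotients.\<close>

lemma ae_eq_quotient_eqI: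
  assumes "A \<subseteq> B" and "\<And>b. b \<in> B \<Longrightarrow> \<exists>a\<in>A. (b, a) \<in> ae_eq \<Omega>"
  shows "A // ae_eq \<Omega> = B // ae_eq \<Omega>"
proof
  show "A // ae_eq \<Omega> \<subseteq> B // ae_eq \<Omega>" using assms(1) by (auto simp: quotient_def)
  have eq: "ae_eq \<Omega> `` {b} = ae_eq \<Omega> `` {a}" if "(b, a) \<in> ae_eq \<Omega>" for a b
  proof -
    have ba: "AE x in lebesgue_on \<Omega>. b x = a x" using that by (simp add: ae_eq_def)
    show ?thesis
    proof (intro set_eqI iffI)
      fix f assume "f \<in> ae_eq \<Omega> `` {b}"
      then have "AE x in lebesgue_on \<Omega>. b x = f x" by (simp add: ae_eq_def)
      with ba have "AE x in lebesgue_on \<Omega>. a x = f x" by eventually_elim simp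
      then show "f \<in> ae_eq \<Omega> `` {a}" by (simp add: ae_eq_def)
    next
      fix f assume "f \<in> ae_eq \<Omega> `` {a}"
      then have "AE x in lebesgue_on \<Omega>. a x = f x" by (simp add: ae_eq_def)
      with ba have "AE x in lebesgue_on \<Omega>. b x = f x" by eventually_elim simp
      then show "f \<in> ae_eq \<Omega> `` {b}" by (simp add: ae_eq_def)
    qed
  qed
  show "B // ae_eq \<Omega> \<subseteq> A // ae_eq \<Omega>"
  proof
    fix X assume "X \<in> B // ae_eq \<Omega>"
    then obtain b where b: "b \<in> B" "X = ae_eq \<Omega> `` {b}" by (rule quotientE)
    then obtain a where a: "a \<in> A" "(b, a) \<in> ae_eq \<Omega>" using assms(2) by blast
    show "X \<in> A // ae_eq \<Omega>" unfolding b(2) eq[OF a(2)] by (rule quotientI[OF a(1)])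
  qed
qed

theorem corollary5p14:
  fixes \<Omega> :: "(real ^ 'n) set"
    and \<phi> :: "real ^ 'n \<Rightarrow> real \<Rightarrow> ennreal"
  assumes "open \<Omega>"
    and "\<phi> \<in> weak_Phi \<Omega>"
    and "\<exists>\<beta>>0. AE x in lebesgue_on \<Omega>. \<phi> x \<beta> \<ge> 1"
    and "C1_dense_in_W1phi \<Omega> \<phi>"
  shows "(ACCphi \<Omega> \<phi> \<inter> Lphi \<Omega> \<phi>) // ae_eq \<Omega> = (ACLphi \<Omega> \<phi> \<inter> Lphi \<Omega> \<phi>) // ae_eq \<Omega> \<and>
         (ACLphi \<Omega> \<phi> \<inter> Lphi \<Omega> \<phi>) // ae_eq \<Omega> = W1phi \<Omega> \<phi> // ae_eq \<Omega>"
proof -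
  obtain \<beta> where \<beta>: "\<beta> > 0" "AE x in lebesgue_on \<Omega>. \<phi> x \<beta> \<ge> 1" using assms(3) by blast
  obtain L where L: "L \<ge> 1" "\<And>x s t. x \<in> \<Omega> \<Longrightarrow> 0 < s \<Longrightarrow> s < t \<Longrightarrow>
      \<phi> x s / ennreal s \<le> ennreal L * (\<phi> x t / ennreal t)"
    using assms(2) unfolding weak_Phi_def by (elim CollectE conjE exE) blast
  interpret weak_Phi_space \<Omega> \<phi> L \<beta>
    by unfold_locales (use assms(1,2) \<beta> L in \<open>auto simp: weak_Phi_def\<close>)
  have sub1: "ACCphi \<Omega> \<phi> \<inter> Lphi \<Omega> \<phi> \<subseteq> ACLphi \<Omega> \<phi> \<inter> Lphi \<Omega> \<phi>"
    using ACC_imp_ACL by (auto simp: ACCphi_def ACLphi_def)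
  have sub2: "ACLphi \<Omega> \<phi> \<inter> Lphi \<Omega> \<phi> \<subseteq> W1phi \<Omega> \<phi>"
    using ACLphi_imp_W1phi by blast
  \<comment> \<open>A representative in the smallest of the three sets serves both equalities, since
    the other sets contain it.\<close>
  have rep: "\<exists>f\<in>ACCphi \<Omega> \<phi> \<inter> Lphi \<Omega> \<phi>. (u, f) \<in> ae_eq \<Omega>" if u: "u \<in> W1phi \<Omega> \<phi>" for u
  proof -
    obtain f where "f \<in> ACCphi \<Omega> \<phi>" "f \<in> Lphi \<Omega> \<phi>" "AE x in lebesgue_on \<Omega>. u x = f x"
      by (rule W1phi_representative[OF assms(4) u])
    then show ?thesis by (auto simp: ae_eq_def)
  qed
  show ?thesis
  proof
    show "(ACCphi \<Omega> \<phi> \<inter> Lphi \<Omega> \<phi>) // ae_eq \<Omega> = (ACLphi \<Omega> \<phi> \<inter> Lphi \<Omega> \<phi>) // ae_eq \<Omega>"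
      using rep sub2 by (intro ae_eq_quotient_eqI[OF sub1]) blast
    show "(ACLphi \<Omega> \<phi> \<inter> Lphi \<Omega> \<phi>) // ae_eq \<Omega> = W1phi \<Omega> \<phi> // ae_eq \<Omega>"
      using rep sub1 by (intro ae_eq_quotient_eqI[OF sub2]) blast
  qed
qed

end
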